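(* (a) Let $P\in M_n(\Bbbk)$ be of Cartan type, $\mathcal R=(\mathfrak h,\Pi,\Pi^\vee)$ a realization of $P$ over $\Bbbk$, $\mathfrak g^{\mathcal R}_P$ the associated MpLbA, $\chi\in\mathrm{Alt}^S_\Bbbk(\mathfrak h)$ and $\chi_{\mathfrak g}$ the associated toral 2-cocycle. Then there exists a Lie bialgebra isomorphism $$f^{(\chi)}_P:\;\mathfrak g^{\mathcal R_{(\chi)}}_{P_{(\chi)}}\;\xrightarrow{\ \cong\ }\;\big(\mathfrak g^{\mathcal R}_P\big)_{\chi_{\mathfrak g}}.$$ In particular, the class of all MpLbA's of any fixed Cartan type and fixed rank is stable by toral 2-cocycle deformations; moreover, inside it the subclass of those associated with split, resp. minimal, realizations is stable as well. (b) Let $P,P'\in M_n(\Bbbk)$ be of Cartan type with the same associated Cartan matrix $A$. (b.1) Let $\mathcal R$ be a split realization of $P$. Then there is $\chi\in\mathrm{Alt}^S_\Bbbk(\mathfrak h)$ such that $P'=P_{(\chi)}$, the corresponding $\mathcal R_{(\chi)}$ is a split realization of $P'=P_{(\chi)}$, and $\mathfrak g^{\mathcal R_{(\chi)}}_{P'}\cong\big(\mathfrak g^{\mathcal R}_P\big)_{\chi_{\mathfrak g}}$. (b.2) Let $\mathcal R$ and $\mathcal R'$ be split minimal realizations of $P$ and $P'$ respectively. Then there exists $\chi\in\mathrm{Alt}^S_\Bbbk(\mathfrak h)$ such that $\mathfrak g^{\mathcal R'}_{P'}\cong\big(\mathfrak g^{\mathcal R}_P\big)_{\chi_{\mathfrak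 g}}$. (b.3) Every split minimal MpLbA over a matrix of Cartan type with Cartan matrix $A$ is isomorphic to some toral 2-cocycle deformation of the Manin double $\mathfrak g^D_{DA}=\mathfrak b_+\oplus\mathfrak b_-$ associated with $DA$, i.e. of the MpLbA attached to the split minimal realization of $DA$.
   Context: $\Bbbk$ is a field of characteristic zero, $n\ge1$, $I=\{1,\dots,n\}$. $A=(a_{ij})$ is a symmetrizable generalized Cartan matrix, $D=\mathrm{diag}(d_i)$ the unique diagonal matrix with coprime positive integer entries such that $DA$ is symmetric. $P=(p_{ij})\in M_n(\Bbbk)$ is of Cartan type with Cartan matrix $A$ if $P+P^T=2DA$. A realization of $P$ over $\Bbbk$ is a triple $\mathcal R=(\mathfrak h,\Pi,\Pi^\vee)$ with $\mathfrak h$ a finite-dimensional $\Bbbk$-vector space (its dimension is the rank), $\Pi^\vee=\{T_i^\pm\}_{i\in I}\subseteq\mathfrak h$, $\Pi=\{\alpha_i\}_{i\in I}\subseteq\mathfrak h^*$, $\alpha_j(T_i^+)=p_{ij}$, $\alpha_j(T_i^-)=p_{ji}$, and $\{S_i=\frac12(T_i^++T_i^-)\}_{i\in I}$ linearly independent. It is split if the $2n$ vectors $T_i^\pm$ are linearly independent; minimal if they span $\mathfrak h$. The MpLbA $\mathfrak g^{\mathcal R}_P$ is the Lie bialgebra generated as a Lie algebra by $\mathfrak h$ and elements $E_i,F_i$ ($i\in I$) with relations $[T',T'']=0$, $[T,E_j]=\alpha_j(T)E_j$, $[T,F_j]=-\alpha_j(T)F_j$, $[E_i,F_j]=\delta_{ij}\frac{T_i^++T_i^-}{2d_i}$,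 and $\mathrm{ad}(E_i)^{1-a_{ij}}(E_j)=0=\mathrm{ad}(F_i)^{1-a_{ij}}(F_j)$ for $i\neq j$, with Lie cobracket determined by $\delta(T)=0$, $\delta(E_i)=T_i^+\otimes E_i-E_i\otimes T_i^+$, $\delta(F_i)=T_i^-\otimes F_i-F_i\otimes T_i^-$. As a vector space $\mathfrak g^{\mathcal R}_P=\mathfrak n_+\oplus\mathfrak h\oplus\mathfrak n_-$, where $\mathfrak n_+$ (resp. $\mathfrak n_-$) is the Lie subalgebra generated by the $E_i$ (resp. $F_i$). A MpLbA is split, minimal, of given rank if its realization is. $\mathrm{Alt}^S_\Bbbk(\mathfrak h)$: antisymmetric bilinear $\chi:\mathfrak h\times\mathfrak h\to\Bbbk$ with $\chi(S_i,-)=0=\chi(-,S_i)$ for all $i$. Toral 2-cocycle: $\chi_{\mathfrak g}=\chi\circ(\pi_{\mathfrak h}\otimes\pi_{\mathfrak h})$, where $\pi_{\mathfrak h}:\mathfrak g^{\mathcal R}_P\to\mathfrak h$ is the projection onto $\mathfrak h$ with kernel $\mathfrak n_+\oplus\mathfrak n_-$ given by the decomposition $\mathfrak g^{\mathcal R}_P=\mathfrak n_+\oplus\mathfrak h\oplus\mathfrak n_-$. Deformation of a Lie bialgebra $(\mathfrak g,[\ ,\ ],\delta)$ by a 2-cocycle $\chi$: $\mathfrak g_\chi=(\mathfrak g,[\ ,\ ]_\chi,\delta)$ with $[x,y]_\chi=[x,y]+\chi(x_{[1]},y)x_{[2]}-\chi(y_{[1]},x)y_{[2]}$, $\delta(x)=x_{[1]}\otimes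 x_{[2]}$. Further $P_{(\chi)}=(p_{ij}+\chi(T_i^+,T_j^+))_{i,j}$, $\mathcal R_{(\chi)}=(\mathfrak h,\{\alpha_i^{(\chi)}\},\Pi^\vee)$ with $\alpha_i^{(\chi)}=\alpha_i\pm\chi(-,T_i^\pm)$ (the two signs agree); $\mathcal R_{(\chi)}$ is a realization of $P_{(\chi)}$. *)

theory Defs
  imports "HOL-Analysis.Finite_Cartesian_Product" "HOL-Library.Poly_Mapping" "HOL-Algebra.Module"
begin

section \<open>Lie algebras and Lie bialgebras\<close>

definition scalars :: "'k::field ring" where
  "scalars = \<lparr>carrier = UNIV, monoid.mult = (*), one = 1, zero = 0, add = (+)\<rparr>"

text \<open>The fields \<open>mult\<close> and \<open>one\<close> inherited from the record of modules are never used.\<close>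

record ('k, 'a) lie_alg = "('k, 'a) module" +
  bracket :: "'a \<Rightarrow> 'a \<Rightarrow> 'a"

locale lie_algebra = Module.module scalars L
  for L :: "('k::field, 'a, 'm) lie_alg_scheme" (structure) +
  assumes bracket_closed:
      "\<lbrakk>x \<in> carrier L; y \<in> carrier L\<rbrakk> \<Longrightarrow> bracket L x y \<in> carrier L"
    and bracket_add_left: "\<lbrakk>x \<in> carrier L; y \<in> carrier L; z \<in> carrier L\<rbrakk> \<Longrightarrow>
      bracket L (x \<oplus> y) z = bracket L x z \<oplus> bracket L y z"
    and bracket_add_right: "\<lbrakk>x \<in> carrier L; y \<in> carrier L; z \<in> carrier L\<rbrakk> \<Longrightarrow>
      bracket L x (y \<oplus> z) = bracket L x y \<oplus> bracket L x z"
    and bracket_smult_left: "\<lbrakk>x \<in> carrier L; y \<in> carrier L\<rbrakk> \<Longrightarrow>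
      bracket L (a \<odot> x) y = a \<odot> bracket L x y"
    and bracket_smult_right: "\<lbrakk>x \<in> carrier L; y \<in> carrier L\<rbrakk> \<Longrightarrow>
      bracket L x (a \<odot> y) = a \<odot> bracket L x y"
    and bracket_self: "x \<in> carrier L \<Longrightarrow> bracket L x x = \<zero>"
    and jacobi: "\<lbrakk>x \<in> carrier L; y \<in> carrier L; z \<in> carrier L\<rbrakk> \<Longrightarrow>
      bracket L x (bracket L y z) \<oplus> bracket L y (bracket L z x) \<oplus> bracket L z (bracket L x y) = \<zero>"

text \<open>
  Tensors over \<open>L\<close> of degree \<open>n\<close> are represented by formal linear combinations of words of
  length \<open>n\<close> in \<open>carrier L\<close>, the word \<open>[x\<^sub>1, \<dots>, x\<^sub>n]\<close> standing for the simple tensor of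
  \<open>x\<^sub>1, \<dots>, x\<^sub>n\<close>. Two representatives give the same tensor iff they differ by an element of the
  span of the multilinearity relators; every equation between tensors is stated as \<open>tensor_eq\<close>.
\<close>

definition fscale :: "'k::field \<Rightarrow> ('b \<Rightarrow>\<^sub>0 'k) \<Rightarrow> ('b \<Rightarrow>\<^sub>0 'k)" where
  "fscale a t = Poly_Mapping.map ((*) a) t"

definition lin_ext :: "('b \<Rightarrow> ('c \<Rightarrow>\<^sub>0 'k)) \<Rightarrow> ('b \<Rightarrow>\<^sub>0 'k::field) \<Rightarrow> ('c \<Rightarrow>\<^sub>0 'k)" where
  "lin_ext f t = (\<Sum>w\<in>Poly_Mapping.keys t. fscale (Poly_Mapping.lookup t w) (f w))"

definition word_map :: "('b \<Rightarrow> 'c) \<Rightarrow> ('b \<Rightarrow>\<^sub>0 'k::field) \<Rightarrow> ('c \<Rightarrow>\<^sub>0 'k)" where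
  "word_map g = lin_ext (\<lambda>w. Poly_Mapping.single (g w) 1)"

definition tensors :: "('k::field, 'a, 'm) module_scheme \<Rightarrow> nat \<Rightarrow> ('a list \<Rightarrow>\<^sub>0 'k) set" where
  "tensors L n = {t. \<forall>w\<in>Poly_Mapping.keys t. length w = n \<and> set w \<subseteq> carrier L}"

definition multilinear_relators :: "('k::field, 'a, 'm) module_scheme \<Rightarrow> ('a list \<Rightarrow>\<^sub>0 'k) set" where
  "multilinear_relators L =
     {Poly_Mapping.single (u @ (x \<oplus>\<^bsub>L\<^esub> y) # v) 1 - Poly_Mapping.single (u @ x # v) 1
        - Poly_Mapping.single (u @ y # v) 1 | u v x y.
        set u \<subseteq> carrier L \<and> set v \<subseteq> carrier L \<and> x \<in> carrier L \<and> y \<in> carrier L} \<union>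
     {Poly_Mapping.single (u @ (a \<odot>\<^bsub>L\<^esub> x) # v) 1 - Poly_Mapping.single (u @ x # v) a | u v x a.
        set u \<subseteq> carrier L \<and> set v \<subseteq> carrier L \<and> x \<in> carrier L}"

definition tensor_eq ::
  "('k::field, 'a, 'm) module_scheme \<Rightarrow> ('a list \<Rightarrow>\<^sub>0 'k) \<Rightarrow> ('a list \<Rightarrow>\<^sub>0 'k) \<Rightarrow> bool" where
  "tensor_eq L s t \<longleftrightarrow> s - t \<in> module.span fscale (multilinear_relators L)"

definition act :: "('k::field, 'a, 'm) lie_alg_scheme \<Rightarrow> 'a \<Rightarrow> ('a list \<Rightarrow>\<^sub>0 'k) \<Rightarrow> ('a list \<Rightarrow>\<^sub>0 'k)" where
  "act L x = lin_ext (\<lambda>w. \<Sum>i<length w. Poly_Mapping.single (w[i := bracket L x (w ! i)]) 1)"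

definition linear_cocycle ::
  "('k::field, 'a, 'm) lie_alg_scheme \<Rightarrow> ('a \<Rightarrow> ('a list \<Rightarrow>\<^sub>0 'k)) \<Rightarrow> bool" where
  "linear_cocycle L \<delta> \<longleftrightarrow>
     (\<forall>x\<in>carrier L. \<delta> x \<in> tensors L 2) \<and>
     (\<forall>x\<in>carrier L. \<forall>y\<in>carrier L. tensor_eq L (\<delta> (x \<oplus>\<^bsub>L\<^esub> y)) (\<delta> x + \<delta> y)) \<and>
     (\<forall>a. \<forall>x\<in>carrier L. tensor_eq L (\<delta> (a \<odot>\<^bsub>L\<^esub> x)) (fscale a (\<delta> x))) \<and>
     (\<forall>x\<in>carrier L. \<forall>y\<in>carrier L.
        tensor_eq L (\<delta> (bracket L x y)) (act L x (\<delta> y) - act L y (\<delta> x)))"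

record (overloaded) ('k::zero, 'a) lie_bialg = "('k, 'a) lie_alg" +
  cobracket :: "'a \<Rightarrow> ('a list \<Rightarrow>\<^sub>0 'k)"

text \<open>\<open>cobracket2\<close> is (cobracket tensor identity) applied after the cobracket.\<close>

definition cobracket2 :: "('k::field, 'a, 'm) lie_bialg_scheme \<Rightarrow> 'a \<Rightarrow> ('a list \<Rightarrow>\<^sub>0 'k)" where
  "cobracket2 L x = lin_ext (\<lambda>w. word_map (\<lambda>u. u @ tl w) (cobracket L (hd w))) (cobracket L x)"

locale lie_bialgebra = lie_algebra L
  for L :: "('k::field, 'a, 'm) lie_bialg_scheme" (structure) +
  assumes cobracket_cocycle: "linear_cocycle L (cobracket L)"
    and cobracket_antisym:
      "x \<in> carrier L \<Longrightarrow> tensor_eq L (cobracket L x + word_map rev (cobracket L x)) 0"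
    and cojacobi: "x \<in> carrier L \<Longrightarrow>
      tensor_eq L (cobracket2 L x + word_map rotate1 (cobracket2 L x)
        + word_map (rotate1 \<circ> rotate1) (cobracket2 L x)) 0"

definition lie_bialg_hom ::
  "('k::field, 'a, 'm) lie_bialg_scheme \<Rightarrow> ('k, 'b, 'o) lie_bialg_scheme \<Rightarrow> ('a \<Rightarrow> 'b) \<Rightarrow> bool" where
  "lie_bialg_hom L M f \<longleftrightarrow>
     f \<in> carrier L \<rightarrow> carrier M \<and>
     (\<forall>x\<in>carrier L. \<forall>y\<in>carrier L. f (x \<oplus>\<^bsub>L\<^esub> y) = f x \<oplus>\<^bsub>M\<^esub> f y) \<and>
     (\<forall>a. \<forall>x\<in>carrier L. f (a \<odot>\<^bsub>L\<^esub> x) = a \<odot>\<^bsub>M\<^esub> f x) \<and>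
     (\<forall>x\<in>carrier L. \<forall>y\<in>carrier L. f (bracket L x y) = bracket M (f x) (f y)) \<and>
     (\<forall>x\<in>carrier L. tensor_eq M (word_map (map f) (cobracket L x)) (cobracket M (f x)))"

definition lie_bialg_iso ::
  "('k::field, 'a, 'm) lie_bialg_scheme \<Rightarrow> ('k, 'b, 'o) lie_bialg_scheme \<Rightarrow> bool" (infix \<open>\<cong>\<^sub>b\<close> 50) where
  "L \<cong>\<^sub>b M \<longleftrightarrow> lie_bialgebra L \<and> lie_bialgebra M \<and>
     (\<exists>f. lie_bialg_hom L M f \<and> bij_betw f (carrier L) (carrier M))"

text \<open>\<open>contract L c x y\<close> is the Sweedler-type expression \<open>c(x\<^sub>[\<^sub>1\<^sub>], y) x\<^sub>[\<^sub>2\<^sub>]\<close>.\<close>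

definition contract ::
  "('k::field, 'a, 'm) lie_bialg_scheme \<Rightarrow> ('a \<Rightarrow> 'a \<Rightarrow> 'k) \<Rightarrow> 'a \<Rightarrow> 'a \<Rightarrow> 'a" where
  "contract L c x y = (\<Oplus>\<^bsub>L\<^esub>w\<in>Poly_Mapping.keys (cobracket L x).
     (Poly_Mapping.lookup (cobracket L x) w * c (w ! 0) y) \<odot>\<^bsub>L\<^esub> (w ! 1))"

definition cocycle_deformation ::
  "('k::field, 'a, 'm) lie_bialg_scheme \<Rightarrow> ('a \<Rightarrow> 'a \<Rightarrow> 'k) \<Rightarrow> ('k, 'a, 'm) lie_bialg_scheme" where
  "cocycle_deformation L c =
     L\<lparr>bracket := (\<lambda>x y. bracket L x y \<oplus>\<^bsub>L\<^esub> contract L c x y \<ominus>\<^bsub>L\<^esub> contract L c y x)\<rparr>"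

inductive_set lie_generated :: "('k::field, 'a, 'm) lie_alg_scheme \<Rightarrow> 'a set \<Rightarrow> 'a set"
  for L and X where
  zero: "\<zero>\<^bsub>L\<^esub> \<in> lie_generated L X"
| gen: "x \<in> X \<Longrightarrow> x \<in> lie_generated L X"
| add: "x \<in> lie_generated L X \<Longrightarrow> y \<in> lie_generated L X \<Longrightarrow> x \<oplus>\<^bsub>L\<^esub> y \<in> lie_generated L X"
| smult: "x \<in> lie_generated L X \<Longrightarrow> a \<odot>\<^bsub>L\<^esub> x \<in> lie_generated L X"
| bracket: "x \<in> lie_generated L X \<Longrightarrow> y \<in> lie_generated L X \<Longrightarrow> bracket L x y \<in> lie_generated L X"

section \<open>Lie algebras given by generators and relations\<close>

datatype ('k, 'x) lie_term =
    LGen 'x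
  | LZero
  | LAdd "('k, 'x) lie_term" "('k, 'x) lie_term"
  | LScale 'k "('k, 'x) lie_term"
  | LBr "('k, 'x) lie_term" "('k, 'x) lie_term"

text \<open>The least congruence on Lie terms that contains \<open>R\<close> and the laws of Lie algebras.\<close>

inductive lie_cong ::
  "(('k::field, 'x) lie_term \<times> ('k, 'x) lie_term) set \<Rightarrow> ('k, 'x) lie_term \<Rightarrow> ('k, 'x) lie_term \<Rightarrow> bool"
  for R where
  rel: "(s, t) \<in> R \<Longrightarrow> lie_cong R s t"
| refl: "lie_cong R s s"
| sym: "lie_cong R s t \<Longrightarrow> lie_cong R t s"
| trans: "lie_cong R s t \<Longrightarrow> lie_cong R t u \<Longrightarrow> lie_cong R s u"
| cong_add: "lie_cong R s s' \<Longrightarrow> lie_cong R t t' \<Longrightarrow> lie_cong R (LAdd s t) (LAdd s' t')"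
| cong_scale: "lie_cong R s s' \<Longrightarrow> lie_cong R (LScale a s) (LScale a s')"
| cong_br: "lie_cong R s s' \<Longrightarrow> lie_cong R t t' \<Longrightarrow> lie_cong R (LBr s t) (LBr s' t')"
| add_assoc: "lie_cong R (LAdd (LAdd s t) u) (LAdd s (LAdd t u))"
| add_comm: "lie_cong R (LAdd s t) (LAdd t s)"
| add_zero: "lie_cong R (LAdd s LZero) s"
| add_neg: "lie_cong R (LAdd s (LScale (- 1) s)) LZero"
| scale_add: "lie_cong R (LScale a (LAdd s t)) (LAdd (LScale a s) (LScale a t))"
| add_scale: "lie_cong R (LScale (a + b) s) (LAdd (LScale a s) (LScale b s))"
| scale_scale: "lie_cong R (LScale a (LScale b s)) (LScale (a * b) s)"
| scale_one: "lie_cong R (LScale 1 s) s"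
| br_add_left: "lie_cong R (LBr (LAdd s t) u) (LAdd (LBr s u) (LBr t u))"
| br_add_right: "lie_cong R (LBr s (LAdd t u)) (LAdd (LBr s t) (LBr s u))"
| br_scale_left: "lie_cong R (LBr (LScale a s) t) (LScale a (LBr s t))"
| br_scale_right: "lie_cong R (LBr s (LScale a t)) (LScale a (LBr s t))"
| br_self: "lie_cong R (LBr s s) LZero"
| br_jacobi: "lie_cong R (LAdd (LAdd (LBr s (LBr t u)) (LBr t (LBr u s))) (LBr u (LBr s t))) LZero"

definition term_class ::
  "(('k::field, 'x) lie_term \<times> ('k, 'x) lie_term) set \<Rightarrow> ('k, 'x) lie_term \<Rightarrow> ('k, 'x) lie_term set" where
  "term_class R s = Collect (lie_cong R s)"

definition presented_lie_alg ::
  "(('k::field, 'x) lie_term \<times> ('k, 'x) lie_term) set \<Rightarrow> ('k, ('k, 'x) lie_term set) lie_alg" where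
  "presented_lie_alg R =
     \<lparr>carrier = range (term_class R), monoid.mult = undefined, one = undefined,
      zero = term_class R LZero,
      add = (\<lambda>X Y. term_class R (LAdd (SOME s. s \<in> X) (SOME t. t \<in> Y))),
      smult = (\<lambda>a X. term_class R (LScale a (SOME s. s \<in> X))),
      bracket = (\<lambda>X Y. term_class R (LBr (SOME s. s \<in> X) (SOME t. t \<in> Y)))\<rparr>"

section \<open>Matrices of Cartan type and their realizations\<close>

definition gen_cartan_matrix :: "int^'n^'n \<Rightarrow> bool" where
  "gen_cartan_matrix A \<longleftrightarrow>
     (\<forall>i. A $ i $ i = 2) \<and> (\<forall>i j. i \<noteq> j \<longrightarrow> A $ i $ j \<le> 0) \<and>
     (\<forall>i j. A $ i $ j = 0 \<longleftrightarrow> A $ j $ i = 0)"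

text \<open>
  For decomposable \<open>A\<close> the coprime symmetrizer \<open>d\<close> need not be unique, so it is carried along with \<open>A\<close>.
\<close>

definition symmetrizer :: "int^'n^'n \<Rightarrow> nat^'n \<Rightarrow> bool" where
  "symmetrizer A d \<longleftrightarrow>
     (\<forall>i. d $ i > 0) \<and> Gcd (range (($) d)) = 1 \<and>
     (\<forall>i j. int (d $ i) * A $ i $ j = int (d $ j) * A $ j $ i)"

definition DA :: "int^'n^'n \<Rightarrow> nat^'n \<Rightarrow> 'k::field_char_0^'n^'n" where
  "DA A d = (\<chi> i j. of_nat (d $ i) * of_int (A $ i $ j))"

definition cartan_type :: "int^'n^'n \<Rightarrow> nat^'n \<Rightarrow> 'k::field_char_0^'n^'n \<Rightarrow> bool" where
  "cartan_type A d P \<longleftrightarrow> P + transpose P = (\<chi> i j. 2 * DA A d $ i $ j)"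

text \<open>
  The vector space of a realization is a whole type \<open>'h\<close> with scalar multiplication \<open>scl\<close>;
  \<open>Tp i\<close>, \<open>Tm i\<close> are the coroots with sign plus, minus, and \<open>rt i\<close> is the root with index \<open>i\<close>.
\<close>

record ('k, 'n, 'h) realization_data =
  scl :: "'k \<Rightarrow> 'h \<Rightarrow> 'h"
  Tp :: "'n \<Rightarrow> 'h"
  Tm :: "'n \<Rightarrow> 'h"
  rt :: "'n \<Rightarrow> 'h \<Rightarrow> 'k"

definition coroot_S :: "('k::field_char_0, 'n, 'h::ab_group_add) realization_data \<Rightarrow> 'n \<Rightarrow> 'h" where
  "coroot_S \<R> i = scl \<R> (1 / 2) (Tp \<R> i + Tm \<R> i)"

definition lin_indep_family :: "('k::field \<Rightarrow> 'h::ab_group_add \<Rightarrow> 'h) \<Rightarrow> ('i \<Rightarrow> 'h) \<Rightarrow> bool" where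
  "lin_indep_family s v \<longleftrightarrow> inj v \<and> \<not> module.dependent s (range v)"

definition realization ::
  "'k::field_char_0^'n^'n \<Rightarrow> ('k, 'n, 'h::ab_group_add) realization_data \<Rightarrow> bool" where
  "realization P \<R> \<longleftrightarrow>
     vector_space (scl \<R>) \<and>
     (\<exists>B. finite B \<and> module.span (scl \<R>) B = UNIV) \<and>
     (\<forall>i. Vector_Spaces.linear (scl \<R>) (*) (rt \<R> i)) \<and>
     (\<forall>i j. rt \<R> j (Tp \<R> i) = P $ i $ j \<and> rt \<R> j (Tm \<R> i) = P $ j $ i) \<and>
     lin_indep_family (scl \<R>) (coroot_S \<R>)"

definition realization_rank :: "('k::field_char_0, 'n, 'h::ab_group_add) realization_data \<Rightarrow> nat" where
  "realization_rank \<R> = vector_space.dim (scl \<R>) (UNIV :: 'h set)"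

definition split_realization :: "('k::field_char_0, 'n, 'h::ab_group_add) realization_data \<Rightarrow> bool" where
  "split_realization \<R> \<longleftrightarrow> lin_indep_family (scl \<R>) (case_sum (Tp \<R>) (Tm \<R>))"

definition minimal_realization :: "('k::field_char_0, 'n, 'h::ab_group_add) realization_data \<Rightarrow> bool" where
  "minimal_realization \<R> \<longleftrightarrow> module.span (scl \<R>) (range (Tp \<R>) \<union> range (Tm \<R>)) = UNIV"

definition Alt_S ::
  "('k::field_char_0, 'n, 'h::ab_group_add) realization_data \<Rightarrow> ('h \<Rightarrow> 'h \<Rightarrow> 'k) set" where
  "Alt_S \<R> = {c.
     (\<forall>x. Vector_Spaces.linear (scl \<R>) (*) (c x)) \<and>
     (\<forall>y. Vector_Spaces.linear (scl \<R>) (*) (\<lambda>x. c x y)) \<and>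
     (\<forall>x y. c x y = - c y x) \<and>
     (\<forall>i x. c (coroot_S \<R> i) x = 0 \<and> c x (coroot_S \<R> i) = 0)}"

definition deformed_matrix ::
  "'k::field_char_0^'n^'n \<Rightarrow> ('k, 'n, 'h) realization_data \<Rightarrow> ('h \<Rightarrow> 'h \<Rightarrow> 'k) \<Rightarrow> 'k^'n^'n" where
  "deformed_matrix P \<R> c = (\<chi> i j. P $ i $ j + c (Tp \<R> i) (Tp \<R> j))"

text \<open>For \<open>c \<in> Alt_S \<R>\<close> one has \<open>c t (Tp \<R> i) = - c t (Tm \<R> i)\<close>, so either sign may be used.\<close>

definition deformed_realization ::
  "('k::field_char_0, 'n, 'h) realization_data \<Rightarrow> ('h \<Rightarrow> 'h \<Rightarrow> 'k) \<Rightarrow> ('k, 'n, 'h) realization_data" where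
  "deformed_realization \<R> c = \<R>\<lparr>rt := (\<lambda>i t. rt \<R> i t + c t (Tp \<R> i))\<rparr>"

section \<open>Multiparameter Lie bialgebras\<close>

datatype ('n, 'h) mp_gen = GT 'h | GE 'n | GF 'n

definition mp_relations ::
  "int^'n^'n \<Rightarrow> nat^'n \<Rightarrow> ('k::field_char_0, 'n, 'h::ab_group_add) realization_data \<Rightarrow>
     (('k, ('n, 'h) mp_gen) lie_term \<times> ('k, ('n, 'h) mp_gen) lie_term) set" where
  "mp_relations A d \<R> =
     {(LGen (GT (s + t)), LAdd (LGen (GT s)) (LGen (GT t))) | s t. True} \<union>
     {(LGen (GT (scl \<R> a t)), LScale a (LGen (GT t))) | a t. True} \<union>
     {(LBr (LGen (GT s)) (LGen (GT t)), LZero) | s t. True} \<union>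
     {(LBr (LGen (GT t)) (LGen (GE j)), LScale (rt \<R> j t) (LGen (GE j))) | t j. True} \<union>
     {(LBr (LGen (GT t)) (LGen (GF j)), LScale (- rt \<R> j t) (LGen (GF j))) | t j. True} \<union>
     {(LBr (LGen (GE i)) (LGen (GF i)),
       LScale (1 / (2 * of_nat (d $ i))) (LAdd (LGen (GT (Tp \<R> i))) (LGen (GT (Tm \<R> i))))) | i. True} \<union>
     {(LBr (LGen (GE i)) (LGen (GF j)), LZero) | i j. i \<noteq> j} \<union>
     {((LBr (LGen (GE i)) ^^ nat (1 - A $ i $ j)) (LGen (GE j)), LZero) | i j. i \<noteq> j} \<union>
     {((LBr (LGen (GF i)) ^^ nat (1 - A $ i $ j)) (LGen (GF j)), LZero) | i j. i \<noteq> j}"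

type_synonym ('k, 'n, 'h) mp_elem = "('k, ('n, 'h) mp_gen) lie_term set"

definition mp_gen_class ::
  "int^'n^'n \<Rightarrow> nat^'n \<Rightarrow> ('k::field_char_0, 'n, 'h::ab_group_add) realization_data \<Rightarrow>
     ('n, 'h) mp_gen \<Rightarrow> ('k, 'n, 'h) mp_elem" where
  "mp_gen_class A d \<R> g = term_class (mp_relations A d \<R>) (LGen g)"

definition mp_lie_alg ::
  "int^'n^'n \<Rightarrow> nat^'n \<Rightarrow> ('k::field_char_0, 'n, 'h::ab_group_add) realization_data \<Rightarrow>
     ('k, ('k, 'n, 'h) mp_elem) lie_alg" where
  "mp_lie_alg A d \<R> = presented_lie_alg (mp_relations A d \<R>)"

text \<open>The one-cocycle is determined by the following values, up to \<open>tensor_eq\<close>.\<close>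

definition is_mp_cobracket ::
  "int^'n^'n \<Rightarrow> nat^'n \<Rightarrow> ('k::field_char_0, 'n, 'h::ab_group_add) realization_data \<Rightarrow>
     (('k, 'n, 'h) mp_elem \<Rightarrow> (('k, 'n, 'h) mp_elem list \<Rightarrow>\<^sub>0 'k)) \<Rightarrow> bool" where
  "is_mp_cobracket A d \<R> \<delta> \<longleftrightarrow>
     (let L = mp_lie_alg A d \<R>; g = mp_gen_class A d \<R> in
      linear_cocycle L \<delta> \<and>
      (\<forall>t. tensor_eq L (\<delta> (g (GT t))) 0) \<and>
      (\<forall>i. tensor_eq L (\<delta> (g (GE i)))
         (Poly_Mapping.single [g (GT (Tp \<R> i)), g (GE i)] 1
          - Poly_Mapping.single [g (GE i), g (GT (Tp \<R> i))] 1)) \<and>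
      (\<forall>i. tensor_eq L (\<delta> (g (GF i)))
         (Poly_Mapping.single [g (GT (Tm \<R> i)), g (GF i)] 1
          - Poly_Mapping.single [g (GF i), g (GT (Tm \<R> i))] 1)))"

text \<open>The matrix \<open>P\<close> enters only through the roots of its realization \<open>\<R>\<close>.\<close>

definition mplba ::
  "int^'n^'n \<Rightarrow> nat^'n \<Rightarrow> ('k::field_char_0, 'n, 'h::ab_group_add) realization_data \<Rightarrow>
     ('k, ('k, 'n, 'h) mp_elem) lie_bialg" where
  "mplba A d \<R> = lie_alg.extend (mp_lie_alg A d \<R>)
     (lie_bialg.fields (SOME \<delta>. is_mp_cobracket A d \<R> \<delta>))"

definition n_plus ::
  "int^'n^'n \<Rightarrow> nat^'n \<Rightarrow> ('k::field_char_0, 'n, 'h::ab_group_add) realization_data \<Rightarrow>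
     ('k, 'n, 'h) mp_elem set" where
  "n_plus A d \<R> = lie_generated (mplba A d \<R>) (range (\<lambda>i. mp_gen_class A d \<R> (GE i)))"

definition n_minus ::
  "int^'n^'n \<Rightarrow> nat^'n \<Rightarrow> ('k::field_char_0, 'n, 'h::ab_group_add) realization_data \<Rightarrow>
     ('k, 'n, 'h) mp_elem set" where
  "n_minus A d \<R> = lie_generated (mplba A d \<R>) (range (\<lambda>i. mp_gen_class A d \<R> (GF i)))"

definition cartan_projection ::
  "int^'n^'n \<Rightarrow> nat^'n \<Rightarrow> ('k::field_char_0, 'n, 'h::ab_group_add) realization_data \<Rightarrow>
     ('k, 'n, 'h) mp_elem \<Rightarrow> 'h" where
  "cartan_projection A d \<R> x =
     (THE t. \<exists>u\<in>n_plus A d \<R>. \<exists>v\<in>n_minus A d \<R>.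
        x = u \<oplus>\<^bsub>mplba A d \<R>\<^esub> mp_gen_class A d \<R> (GT t) \<oplus>\<^bsub>mplba A d \<R>\<^esub> v)"

definition toral_cocycle ::
  "int^'n^'n \<Rightarrow> nat^'n \<Rightarrow> ('k::field_char_0, 'n, 'h::ab_group_add) realization_data \<Rightarrow>
     ('h \<Rightarrow> 'h \<Rightarrow> 'k) \<Rightarrow> ('k, 'n, 'h) mp_elem \<Rightarrow> ('k, 'n, 'h) mp_elem \<Rightarrow> 'k" where
  "toral_cocycle A d \<R> c x y = c (cartan_projection A d \<R> x) (cartan_projection A d \<R> y)"

definition toral_deformation ::
  "int^'n^'n \<Rightarrow> nat^'n \<Rightarrow> ('k::field_char_0, 'n, 'h::ab_group_add) realization_data \<Rightarrow>
     ('h \<Rightarrow> 'h \<Rightarrow> 'k) \<Rightarrow> ('k, ('k, 'n, 'h) mp_elem) lie_bialg" where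
  "toral_deformation A d \<R> c = cocycle_deformation (mplba A d \<R>) (toral_cocycle A d \<R> c)"

definition cartan_realizations ::
  "int^'n^'n \<Rightarrow> nat^'n \<Rightarrow> nat \<Rightarrow> ('k::field_char_0, 'n, 'h::ab_group_add) realization_data set" where
  "cartan_realizations A d r =
     {\<R>. (\<exists>P. cartan_type A d P \<and> realization P \<R>) \<and> realization_rank \<R> = r}"

text \<open>
  Stability, up to isomorphism, under toral deformations of the class of the Lie bialgebras
  \<open>mplba A d \<R>\<close> with \<open>\<R>\<close> ranging over \<open>C\<close>.
\<close>

definition toral_stable ::
  "int^'n^'n \<Rightarrow> nat^'n \<Rightarrow> ('k::field_char_0, 'n, 'h::ab_group_add) realization_data set \<Rightarrow> bool" where
  "toral_stable A d C \<longleftrightarrow>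
     (\<forall>\<R>\<in>C. \<forall>c\<in>Alt_S \<R>. \<exists>\<R>'\<in>C. mplba A d \<R>' \<cong>\<^sub>b toral_deformation A d \<R> c)"

text \<open>
  The split minimal realization of \<open>DA\<close> on the vector space with basis the coroots
  \<open>T\<^sub>i\<^sup>+\<close> (basis vectors \<open>Inl i\<close>) and \<open>T\<^sub>i\<^sup>-\<close> (basis vectors \<open>Inr i\<close>).
\<close>

definition double_realization ::
  "int^'n^'n \<Rightarrow> nat^'n \<Rightarrow> ('k::field_char_0, 'n, 'k^('n + 'n)) realization_data" where
  "double_realization A d =
     \<lparr>scl = (*s), Tp = (\<lambda>i. axis (Inl i) 1), Tm = (\<lambda>i. axis (Inr i) 1),
      rt = (\<lambda>j t. \<Sum>i\<in>UNIV. t $ Inl i * DA A d $ i $ j + t $ Inr i * DA A d $ j $ i)\<rparr>"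

end

theory Submission
  imports Defs "HOL-Library.Function_Algebras"
begin

text \<open>
  Tensors are compared through multilinear functionals, so that every identity in a tensor power of
  the Lie algebra becomes an identity in the field. The cobracket extends from the generators
  because the coefficient produced by iterating the cocycle rule along \<open>ad(E\<^sub>i)\<^sup>m E\<^sub>j\<close> is
  \<open>2 d\<^sub>i m (a\<^sub>i\<^sub>j + m - 1)\<close>, which vanishes at the Serre exponent; co-Jacobi holds since
  the cyclic sum is again a cocycle. The Cartan part of an element is read off from the highest weight
  coefficient in modules of arbitrary highest weight.

  The contraction \<open>D\<^sub>s x = \<chi>(\<pi> x\<^sub>[\<^sub>1\<^sub>], s) x\<^sub>[\<^sub>2\<^sub>]\<close> is a derivation that is diagonal on
  root vectors, because \<open>\<chi>(\<pi> _, s)\<close> vanishes on brackets. Hence the deformed bracket is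
  \<open>[x, y] + D\<^bsub>\<pi> y\<^esub> x - D\<^bsub>\<pi> x\<^esub> y\<close>: brackets inside \<open>\<nn>\<^sub>+\<close> and inside \<open>\<nn>\<^sub>-\<close> are unchanged and the
  roots are shifted by \<open>\<chi>\<close>. The universal property gives the morphism from the
  deformed Lie bialgebra; the one for \<open>-\<chi>\<close> provides its inverse. On a split realization \<open>\<chi>\<close> can take
  any prescribed antisymmetric values on the \<open>T\<^sub>i\<^sup>+\<close>, and split minimal realizations of the same
  matrix are isomorphic.
\<close>

section \<open>Pairings with formal linear combinations\<close>

text \<open>Equality of tensors is membership in a span of relators inside a free vector space, and
  a subspace is cut out by the functionals that vanish on it; this makes tests by functionals
  complete. In degree one the same argument shows that functionals separate the points of the Lie
  algebra, so its own identities move into the field as well. The form \<chi> is seen only through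
  the projection \<pi>, so \<hh> must be known to embed in an algebra given by generators and
  relations; this is why weights run over the whole dual of \<hh>. The condition \<chi>(S_i, -) = 0
  enters because the Cartan part of every bracket lies in the span of the S_i. The constant in the
  Serre computation comes from p_ii = 2 d_i and p_ij + p_ji = 2 d_i a_ij, so the cobracket respects
  the Serre relations whatever the antisymmetric part of P. The morphism for -\<chi> lands in a
  deformation of the bialgebra in question, not in that bialgebra itself. Hence the two maps are
  compared on \<nn>_+, \<hh> and \<nn>_- separately.\<close>

definition pairing :: "('b \<Rightarrow> 'k) \<Rightarrow> ('b \<Rightarrow>\<^sub>0 'k::field) \<Rightarrow> 'k" where
  "pairing \<phi> t = (\<Sum>w\<in>Poly_Mapping.keys t. Poly_Mapping.lookup t w * \<phi> w)"

lemma pairing_superset: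
  assumes "finite S" "Poly_Mapping.keys t \<subseteq> S"
  shows "pairing \<phi> t = (\<Sum>w\<in>S. Poly_Mapping.lookup t w * \<phi> w)"
  unfolding pairing_def
  by (rule sum.mono_neutral_left) (use assms in \<open>auto simp: in_keys_iff\<close>)

lemma lookup_fscale [simp]: "Poly_Mapping.lookup (fscale a t) w = a * Poly_Mapping.lookup t w"
  unfolding fscale_def by (simp add: Poly_Mapping.map.rep_eq when_def)

lemma vector_space_fscale: "vector_space (fscale :: 'k::field \<Rightarrow> ('b \<Rightarrow>\<^sub>0 'k) \<Rightarrow> _)"
  by unfold_locales (auto intro!: poly_mapping_eqI simp: lookup_add algebra_simps)

lemma keys_fscale_subset: "Poly_Mapping.keys (fscale a t) \<subseteq> Poly_Mapping.keys t"
  by (auto simp: in_keys_iff)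

lemma keys_diff_subset:
  "Poly_Mapping.keys (s - t :: 'b \<Rightarrow>\<^sub>0 'k::field) \<subseteq> Poly_Mapping.keys s \<union> Poly_Mapping.keys t"
  by (auto simp: in_keys_iff lookup_minus)

lemma pairing_zero [simp]: "pairing \<phi> 0 = 0"
  by (simp add: pairing_def)

lemma pairing_add [simp]: "pairing \<phi> (s + t) = pairing \<phi> s + pairing \<phi> t"
proof -
  let ?S = "Poly_Mapping.keys s \<union> Poly_Mapping.keys t"
  have "Poly_Mapping.keys (s + t) \<subseteq> ?S" by (rule keys_add)
  then show ?thesis
    by (simp add: pairing_superset[of ?S] lookup_add algebra_simps sum.distrib)
qed

lemma pairing_fscale [simp]: "pairing \<phi> (fscale a t) = a * pairing \<phi> t"
  by (simp add: pairing_superset[OF finite_keys keys_fscale_subset] sum_distrib_left mult.assoc)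
    (simp add: pairing_def sum_distrib_left mult.assoc)

lemma pairing_uminus [simp]: "pairing \<phi> (- t) = - pairing \<phi> t"
proof -
  have "pairing \<phi> t + pairing \<phi> (- t) = 0"
    by (simp flip: pairing_add)
  then show ?thesis by (simp add: add_eq_0_iff)
qed

lemma pairing_diff [simp]: "pairing \<phi> (s - t) = pairing \<phi> s - pairing \<phi> t"
  using pairing_add[of \<phi> s "- t"] by simp

lemma pairing_single [simp]: "pairing \<phi> (Poly_Mapping.single w a) = a * \<phi> w"
  by (cases "a = 0") (simp_all add: pairing_def)

lemma pairing_sum: "pairing \<phi> (sum f S) = (\<Sum>x\<in>S. pairing \<phi> (f x))"
  by (induction S rule: infinite_finite_induct) auto

lemma pairing_lin_ext [simp]: "pairing \<phi> (lin_ext f t) = pairing (\<lambda>w. pairing \<phi> (f w)) t"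
  by (simp add: lin_ext_def pairing_sum) (simp add: pairing_def)

lemma pairing_word_map [simp]: "pairing \<phi> (word_map g t) = pairing (\<lambda>w. \<phi> (g w)) t"
  by (simp add: word_map_def)

lemma pairing_cong:
  "(\<And>w. w \<in> Poly_Mapping.keys t \<Longrightarrow> \<phi> w = \<psi> w) \<Longrightarrow> pairing \<phi> t = pairing \<psi> t"
  by (simp add: pairing_def)

lemma pairing_fun_add: "pairing (\<lambda>w. \<phi> w + \<psi> w) t = pairing \<phi> t + pairing \<psi> t"
  by (simp add: pairing_def algebra_simps sum.distrib)

lemma pairing_fun_diff: "pairing (\<lambda>w. \<phi> w - \<psi> w) t = pairing \<phi> t - pairing \<psi> t"
  by (simp add: pairing_def algebra_simps sum_subtractf)

lemma pairing_fun_uminus: "pairing (\<lambda>w. - \<phi> w) t = - pairing \<phi> t"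
  by (simp add: pairing_def sum_negf)

lemma pairing_fun_mult: "pairing (\<lambda>w. a * \<phi> w) t = a * pairing \<phi> t"
  by (simp add: pairing_def sum_distrib_left mult.left_commute)

lemma pairing_swap:
  "pairing (\<lambda>w. pairing (\<lambda>v. \<phi> w v) t) s = pairing (\<lambda>v. pairing (\<lambda>w. \<phi> w v) s) t"
proof -
  have "pairing (\<lambda>w. pairing (\<lambda>v. \<phi> w v) t) s =
      (\<Sum>w\<in>Poly_Mapping.keys s. \<Sum>v\<in>Poly_Mapping.keys t.
        Poly_Mapping.lookup s w * (Poly_Mapping.lookup t v * \<phi> w v))"
    by (simp add: pairing_def sum_distrib_left)
  also have "\<dots> = (\<Sum>v\<in>Poly_Mapping.keys t. \<Sum>w\<in>Poly_Mapping.keys s.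
        Poly_Mapping.lookup t v * (Poly_Mapping.lookup s w * \<phi> w v))"
    by (subst sum.swap) (simp add: mult.left_commute)
  also have "\<dots> = pairing (\<lambda>v. pairing (\<lambda>w. \<phi> w v) s) t"
    by (simp add: pairing_def sum_distrib_left)
  finally show ?thesis .
qed

text \<open>If x lies outside the span, a basis of the span stays independent after x is added, and
  the functional that is 1 at x and 0 on that basis separates the two.\<close>

lemma (in vector_space) in_span_iff_functionals:
  "x \<in> span S \<longleftrightarrow> (\<forall>f. Vector_Spaces.linear scale (*) f \<longrightarrow> (\<forall>y\<in>S. f y = 0) \<longrightarrow> f x = 0)"
proof
  assume x: "x \<in> span S"
  show "\<forall>f. Vector_Spaces.linear scale (*) f \<longrightarrow> (\<forall>y\<in>S. f y = 0) \<longrightarrow> f x = 0"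
  proof (intro allI impI)
    fix f assume f: "Vector_Spaces.linear scale (*) f" and 0: "\<forall>y\<in>S. f y = 0"
    interpret f: Vector_Spaces.linear scale "(*)" f by fact
    show "f x = 0" by (rule f.eq_0_on_span[OF _ x]) (use 0 in auto)
  qed
next
  assume *: "\<forall>f. Vector_Spaces.linear scale (*) f \<longrightarrow> (\<forall>y\<in>S. f y = 0) \<longrightarrow> f x = 0"
  show "x \<in> span S"
  proof (rule ccontr)
    assume x: "x \<notin> span S"
    obtain B where B: "B \<subseteq> span S" "independent B" "span S \<subseteq> span B"
      using maximal_independent_subset .
    have "span B = span S"
      using B by (metis span_mono span_span subset_antisym)
    then have ind: "independent (insert x B)" using B x by (simp add: independent_insertI)
    interpret k: vector_space "(*) :: 'a \<Rightarrow> 'a \<Rightarrow> 'a"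
      by unfold_locales (auto simp: algebra_simps)
    interpret p: vector_space_pair scale "(*)" ..
    obtain g where g: "Vector_Spaces.linear scale (*) g"
        "\<forall>y\<in>insert x B. g y = (if y = x then 1 else 0)"
      using p.linear_independent_extend[OF ind, of "\<lambda>y. if y = x then 1 else 0"] by blast
    interpret g: Vector_Spaces.linear scale "(*)" g by (rule g(1))
    have "x \<notin> B" using B x by auto
    have "g y = 0" if "y \<in> span B" for y
      by (rule g.eq_0_on_span[OF _ that]) (use g \<open>x \<notin> B\<close> in auto)
    then have "\<forall>y\<in>S. g y = 0" using \<open>span B = span S\<close> span_base by blast
    with * g(1) have "g x = 0" by blast
    with g(2) show False by simp
  qed
qed

section \<open>Multilinear functionals as tests for equality of tensors\<close>

definition multilin :: "('k::field, 'a, 'm) module_scheme \<Rightarrow> ('a list \<Rightarrow> 'k) \<Rightarrow> bool" where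
  "multilin L \<phi> \<longleftrightarrow>
     (\<forall>u v x y. set u \<subseteq> carrier L \<longrightarrow> set v \<subseteq> carrier L \<longrightarrow> x \<in> carrier L \<longrightarrow> y \<in> carrier L \<longrightarrow>
        \<phi> (u @ (x \<oplus>\<^bsub>L\<^esub> y) # v) = \<phi> (u @ x # v) + \<phi> (u @ y # v)) \<and>
     (\<forall>u v x a. set u \<subseteq> carrier L \<longrightarrow> set v \<subseteq> carrier L \<longrightarrow> x \<in> carrier L \<longrightarrow>
        \<phi> (u @ (a \<odot>\<^bsub>L\<^esub> x) # v) = a * \<phi> (u @ x # v))"

lemma linear_pairing: "Vector_Spaces.linear fscale (*) (pairing (\<phi> :: 'b \<Rightarrow> 'k::field))"
proof -
  interpret vector_space "fscale :: 'k \<Rightarrow> ('b \<Rightarrow>\<^sub>0 'k) \<Rightarrow> _" by (rule vector_space_fscale)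
  show ?thesis by unfold_locales (auto simp: algebra_simps)
qed

lemma linear_is_pairing:
  assumes "Vector_Spaces.linear fscale (*) (f :: ('b \<Rightarrow>\<^sub>0 'k::field) \<Rightarrow> 'k)"
  shows "f t = pairing (\<lambda>w. f (Poly_Mapping.single w 1)) t"
proof -
  interpret f: Vector_Spaces.linear fscale "(*)" f by fact
  have "t = (\<Sum>w\<in>Poly_Mapping.keys t. fscale (Poly_Mapping.lookup t w) (Poly_Mapping.single w 1))"
    by (rule poly_mapping_eqI) (simp add: lookup_sum lookup_single when_def if_distrib[of "(*) _"] in_keys_iff cong: if_cong)
  then have "f t = f (\<Sum>w\<in>Poly_Mapping.keys t. fscale (Poly_Mapping.lookup t w) (Poly_Mapping.single w 1))"
    by simp
  also have "\<dots> = pairing (\<lambda>w. f (Poly_Mapping.single w 1)) t"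
    by (simp add: f.sum f.scale pairing_def)
  finally show ?thesis .
qed

text \<open>A functional on the free space kills every relator exactly when its restriction to words
  is additive and homogeneous in each letter. Words of different length are never related by such a
  condition, so one test covers tensors of all degrees.\<close>

lemma tensor_eq_iff_multilin:
  "tensor_eq L s t \<longleftrightarrow> (\<forall>\<phi>. multilin L \<phi> \<longrightarrow> pairing \<phi> s = pairing \<phi> t)" (is "?l \<longleftrightarrow> ?r")
  for L :: "('k::field, 'a, 'm) module_scheme"
proof -
  interpret vector_space "fscale :: 'k \<Rightarrow> ('a list \<Rightarrow>\<^sub>0 'k) \<Rightarrow> _" by (rule vector_space_fscale)
  have relators: "(\<forall>r\<in>multilinear_relators L. pairing \<phi> r = 0) \<longleftrightarrow> multilin L \<phi>" for \<phi>
  proof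
    assume *: "\<forall>r\<in>multilinear_relators L. pairing \<phi> r = 0"
    show "multilin L \<phi>"
      unfolding multilin_def
    proof (intro conjI allI impI)
      fix u v x y assume "set u \<subseteq> carrier L" "set v \<subseteq> carrier L" "x \<in> carrier L" "y \<in> carrier L"
      then have "Poly_Mapping.single (u @ (x \<oplus>\<^bsub>L\<^esub> y) # v) 1 - Poly_Mapping.single (u @ x # v) 1
        - Poly_Mapping.single (u @ y # v) 1 \<in> multilinear_relators L"
        unfolding multilinear_relators_def by blast
      with * have "pairing \<phi> (Poly_Mapping.single (u @ (x \<oplus>\<^bsub>L\<^esub> y) # v) 1 - Poly_Mapping.single (u @ x # v) 1
        - Poly_Mapping.single (u @ y # v) 1) = 0" by blast
      then show "\<phi> (u @ (x \<oplus>\<^bsub>L\<^esub> y) # v) = \<phi> (u @ x # v) + \<phi> (u @ y # v)"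
        by (simp add: algebra_simps)
    next
      fix u v x and a :: 'k assume "set u \<subseteq> carrier L" "set v \<subseteq> carrier L" "x \<in> carrier L"
      then have "Poly_Mapping.single (u @ (a \<odot>\<^bsub>L\<^esub> x) # v) 1 - Poly_Mapping.single (u @ x # v) a
          \<in> multilinear_relators L"
        unfolding multilinear_relators_def by blast
      with * have "pairing \<phi> (Poly_Mapping.single (u @ (a \<odot>\<^bsub>L\<^esub> x) # v) 1
          - Poly_Mapping.single (u @ x # v) a) = 0" by blast
      then show "\<phi> (u @ (a \<odot>\<^bsub>L\<^esub> x) # v) = a * \<phi> (u @ x # v)"
        by simp
    qed
  next
    assume *: "multilin L \<phi>"
    show "\<forall>r\<in>multilinear_relators L. pairing \<phi> r = 0"
      using * unfolding multilinear_relators_def multilin_def by auto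
  qed
  have "?l \<longleftrightarrow> (\<forall>\<phi>. (\<forall>r\<in>multilinear_relators L. pairing \<phi> r = 0) \<longrightarrow> pairing \<phi> (s - t) = 0)"
    unfolding tensor_eq_def in_span_iff_functionals
  proof (intro iffI allI impI)
    fix \<phi> :: "'a list \<Rightarrow> 'k"
    assume "\<forall>f. Vector_Spaces.linear fscale (*) f \<longrightarrow> (\<forall>y\<in>multilinear_relators L. f y = 0) \<longrightarrow> f (s - t) = 0"
    then show "(\<forall>r\<in>multilinear_relators L. pairing \<phi> r = 0) \<Longrightarrow> pairing \<phi> (s - t) = 0"
      using linear_pairing by blast
  next
    fix f :: "('a list \<Rightarrow>\<^sub>0 'k) \<Rightarrow> 'k"
    assume *: "\<forall>\<phi>. (\<forall>r\<in>multilinear_relators L. pairing \<phi> r = 0) \<longrightarrow> pairing \<phi> (s - t) = 0"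
      and f: "Vector_Spaces.linear fscale (*) f" and 0: "\<forall>y\<in>multilinear_relators L. f y = 0"
    show "f (s - t) = 0"
      using * 0 linear_is_pairing[OF f] by metis
  qed
  then show ?thesis unfolding relators by simp
qed

section \<open>The field as a ring of scalars\<close>

lemma scalars_simps [simp]:
  "carrier scalars = UNIV" "a \<oplus>\<^bsub>scalars\<^esub> b = a + b" "a \<otimes>\<^bsub>scalars\<^esub> b = a * b"
  "\<zero>\<^bsub>scalars\<^esub> = 0" "\<one>\<^bsub>scalars\<^esub> = 1"
  by (simp_all add: scalars_def)

lemma cring_scalars: "cring (scalars :: 'k::field ring)"
proof (rule cringI)
  show "abelian_group (scalars :: 'k ring)"
    by (rule abelian_groupI) (auto simp: algebra_simps intro: exI[of _ "- _"])
  show "comm_monoid (scalars :: 'k ring)"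
    by (rule comm_monoidI) (auto simp: algebra_simps)
qed (auto simp: algebra_simps)

lemma minus_scalars [simp]: "\<ominus>\<^bsub>scalars\<^esub> a = - (a :: 'k::field)"
proof -
  interpret cring "scalars :: 'k ring" by (rule cring_scalars)
  show ?thesis using minus_equality[of "- a" a] by simp
qed

section \<open>Bilinear functionals and tensors of degree two\<close>

definition lfun :: "('k::field, 'a, 'm) module_scheme \<Rightarrow> ('a \<Rightarrow> 'k) \<Rightarrow> bool" where
  "lfun L \<psi> \<longleftrightarrow> (\<forall>x\<in>carrier L. \<forall>y\<in>carrier L. \<psi> (x \<oplus>\<^bsub>L\<^esub> y) = \<psi> x + \<psi> y) \<and>
     (\<forall>a. \<forall>x\<in>carrier L. \<psi> (a \<odot>\<^bsub>L\<^esub> x) = a * \<psi> x)"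

definition bilin :: "('k::field, 'a, 'm) module_scheme \<Rightarrow> ('a \<Rightarrow> 'a \<Rightarrow> 'k) \<Rightarrow> bool" where
  "bilin L b \<longleftrightarrow> (\<forall>x\<in>carrier L. lfun L (b x) \<and> lfun L (\<lambda>y. b y x))"

text \<open>Letters are read by position, so the value is meaningful only on words of length two;
  comparisons therefore carry the hypothesis that the tensor has degree two.\<close>

definition pair2 :: "('a \<Rightarrow> 'a \<Rightarrow> 'k) \<Rightarrow> ('a list \<Rightarrow>\<^sub>0 'k::field) \<Rightarrow> 'k" where
  "pair2 b = pairing (\<lambda>w. b (w ! 0) (w ! 1))"

lemma lfun_add: "lfun L \<psi> \<Longrightarrow> x \<in> carrier L \<Longrightarrow> y \<in> carrier L \<Longrightarrow> \<psi> (x \<oplus>\<^bsub>L\<^esub> y) = \<psi> x + \<psi> y"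
  and lfun_smult: "lfun L \<psi> \<Longrightarrow> x \<in> carrier L \<Longrightarrow> \<psi> (a \<odot>\<^bsub>L\<^esub> x) = a * \<psi> x"
  by (auto simp: lfun_def)

lemma bilin_lfun: "bilin L b \<Longrightarrow> x \<in> carrier L \<Longrightarrow> lfun L (b x)"
  and bilin_lfun': "bilin L b \<Longrightarrow> x \<in> carrier L \<Longrightarrow> lfun L (\<lambda>y. b y x)"
  by (auto simp: bilin_def)

lemma tensors2_cases:
  assumes "t \<in> tensors L 2" "w \<in> Poly_Mapping.keys t"
  obtains x y where "w = [x, y]" "x \<in> carrier L" "y \<in> carrier L"
proof -
  from assms have "length w = 2" "set w \<subseteq> carrier L" by (auto simp: tensors_def)
  then show ?thesis by (auto simp: numeral_2_eq_2 length_Suc_conv intro: that)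
qed

lemma pair2_cong:
  assumes "t \<in> tensors L 2" "\<And>x y. x \<in> carrier L \<Longrightarrow> y \<in> carrier L \<Longrightarrow> b x y = b' x y"
  shows "pair2 b t = pair2 b' t"
  unfolding pair2_def by (rule pairing_cong) (use assms in \<open>auto elim!: tensors2_cases\<close>)

lemma pairing_eq_pair2:
  "t \<in> tensors L 2 \<Longrightarrow> pairing \<phi> t = pair2 (\<lambda>x y. \<phi> [x, y]) t"
  unfolding pair2_def by (rule pairing_cong) (auto elim!: tensors2_cases)

lemma multilin_add:
  "multilin L \<phi> \<Longrightarrow> set u \<subseteq> carrier L \<Longrightarrow> set v \<subseteq> carrier L \<Longrightarrow> x \<in> carrier L \<Longrightarrow> y \<in> carrier L \<Longrightarrow>
    \<phi> (u @ (x \<oplus>\<^bsub>L\<^esub> y) # v) = \<phi> (u @ x # v) + \<phi> (u @ y # v)"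
  and multilin_smult:
  "multilin L \<phi> \<Longrightarrow> set u \<subseteq> carrier L \<Longrightarrow> set v \<subseteq> carrier L \<Longrightarrow> x \<in> carrier L \<Longrightarrow>
    \<phi> (u @ (a \<odot>\<^bsub>L\<^esub> x) # v) = a * \<phi> (u @ x # v)"
  by (auto simp: multilin_def)

lemma multilin_lfun:
  assumes "multilin L \<phi>" "set u \<subseteq> carrier L" "set v \<subseteq> carrier L"
  shows "lfun L (\<lambda>x. \<phi> (u @ x # v))"
  using assms by (auto simp: lfun_def multilin_add multilin_smult)

lemma multilin_bilin: "multilin L \<phi> \<Longrightarrow> bilin L (\<lambda>x y. \<phi> [x, y])"
  unfolding bilin_def
  using multilin_lfun[of L \<phi> "[_]" "[]"] multilin_lfun[of L \<phi> "[]" "[_]"] by simp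

lemma bilin_multilin:
  assumes "bilin L b"
  shows "multilin L (\<lambda>w. if length w = 2 then b (w ! 0) (w ! 1) else 0)"
proof -
  let ?\<phi> = "\<lambda>w. if length w = 2 then b (w ! 0) (w ! 1) else 0"
  have l: "lfun L (\<lambda>x. ?\<phi> (u @ x # v))" if uv: "set u \<subseteq> carrier L" "set v \<subseteq> carrier L" for u v
  proof -
    \<comment> \<open>The word has length two exactly when its context is a single letter, to the
      right or to the left of the variable slot.\<close>
    consider "length u + length v \<noteq> 1" | z where "u = []" "v = [z]" | z where "u = [z]" "v = []"
      by (cases u; cases v; cases "tl u"; cases "tl v") auto
    then show ?thesis
    proof cases
      case 1
      then have "(\<lambda>x. ?\<phi> (u @ x # v)) = (\<lambda>x. 0)" by auto
      then show ?thesis by (simp add: lfun_def)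
    qed (use uv bilin_lfun[OF assms] bilin_lfun'[OF assms] in auto)
  qed
  show ?thesis
    unfolding multilin_def using lfun_add[OF l] lfun_smult[OF l] by blast
qed

lemma tensor_eq2_iff:
  assumes "s \<in> tensors L 2" "t \<in> tensors L 2"
  shows "tensor_eq L s t \<longleftrightarrow> (\<forall>b. bilin L b \<longrightarrow> pair2 b s = pair2 b t)"
proof
  assume *: "tensor_eq L s t"
  show "\<forall>b. bilin L b \<longrightarrow> pair2 b s = pair2 b t"
  proof (intro allI impI)
    fix b assume "bilin L b"
    from bilin_multilin[OF this] * show "pair2 b s = pair2 b t"
      unfolding tensor_eq_iff_multilin using assms by (auto simp: pairing_eq_pair2)
  qed
next
  assume "\<forall>b. bilin L b \<longrightarrow> pair2 b s = pair2 b t"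
  then show "tensor_eq L s t"
    unfolding tensor_eq_iff_multilin using assms by (simp add: pairing_eq_pair2 multilin_bilin)
qed

lemma pair2_zero [simp]: "pair2 b 0 = 0"
  and pair2_add [simp]: "pair2 b (s + t) = pair2 b s + pair2 b t"
  and pair2_diff [simp]: "pair2 b (s - t) = pair2 b s - pair2 b t"
  and pair2_fscale [simp]: "pair2 b (fscale a t) = a * pair2 b t"
  and pair2_single [simp]: "pair2 b (Poly_Mapping.single [x, y] a) = a * b x y"
  by (simp_all add: pair2_def)

lemma pair2_fun_add: "pair2 (\<lambda>x y. b x y + b' x y) t = pair2 b t + pair2 b' t"
  and pair2_fun_diff: "pair2 (\<lambda>x y. b x y - b' x y) t = pair2 b t - pair2 b' t"
  and pair2_fun_uminus: "pair2 (\<lambda>x y. - b x y) t = - pair2 b t"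
  and pair2_fun_mult: "pair2 (\<lambda>x y. a * b x y) t = a * pair2 b t"
  by (simp_all add: pair2_def pairing_fun_add pairing_fun_diff pairing_fun_uminus pairing_fun_mult)

lemma pair2_swap:
  "pair2 (\<lambda>x y. pair2 (\<lambda>p q. c x y p q) t) s = pair2 (\<lambda>p q. pair2 (\<lambda>x y. c x y p q) s) t"
  unfolding pair2_def by (rule pairing_swap)

lemma tensors_zero [simp]: "0 \<in> tensors L n"
  by (simp add: tensors_def)

lemma tensors_add: "s \<in> tensors L n \<Longrightarrow> t \<in> tensors L n \<Longrightarrow> s + t \<in> tensors L n"
  using keys_add[of s t] by (auto simp: tensors_def)

lemma tensors_diff: "s \<in> tensors L n \<Longrightarrow> t \<in> tensors L n \<Longrightarrow> s - t \<in> tensors L n"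
  using keys_diff_subset[of s t] by (force simp: tensors_def)

lemma tensors_fscale: "t \<in> tensors L n \<Longrightarrow> fscale a t \<in> tensors L n"
  using keys_fscale_subset[of a t] by (auto simp: tensors_def)

lemma tensors_single: "length w = n \<Longrightarrow> set w \<subseteq> carrier L \<Longrightarrow> Poly_Mapping.single w a \<in> tensors L n"
  by (auto simp: tensors_def split: if_splits)

lemma tensors_sum: "(\<And>x. x \<in> S \<Longrightarrow> f x \<in> tensors L n) \<Longrightarrow> sum f S \<in> tensors L n"
  by (induction S rule: infinite_finite_induct) (auto intro: tensors_add)

lemma tensors_lin_ext:
  "(\<And>w. w \<in> Poly_Mapping.keys t \<Longrightarrow> f w \<in> tensors L n) \<Longrightarrow> lin_ext f t \<in> tensors L n"
  unfolding lin_ext_def by (auto intro: tensors_sum tensors_fscale)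

lemma tensors_word_map:
  "(\<And>w. w \<in> Poly_Mapping.keys t \<Longrightarrow> length (g w) = n \<and> set (g w) \<subseteq> carrier L) \<Longrightarrow>
    word_map g t \<in> tensors L n"
  unfolding word_map_def by (rule tensors_lin_ext, rule tensors_single) auto

section \<open>Linear functionals separate points\<close>

context lie_algebra
begin

lemma smult_zero [simp]: "x \<in> carrier L \<Longrightarrow> 0 \<odot> x = \<zero>"
  using smult_l_null[of x] by simp

lemma smult_minus_one: "x \<in> carrier L \<Longrightarrow> (- 1) \<odot> x = \<ominus> x"
  using smult_l_minus[of 1 x] smult_one[of x] by simp

lemma smult_closed' [simp]: "x \<in> carrier L \<Longrightarrow> a \<odot> x \<in> carrier L"
  using smult_closed[of a x] by simp

lemmas smult_simps = smult_l_distr[simplified] smult_r_distr[simplified] smult_assoc1[simplified] smult_one[simplified]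

declare bracket_closed [simp]

lemma a_inv_zero [simp]: "\<ominus> \<zero> = \<zero>"
  using minus_equality[of \<zero> \<zero>] by simp

lemma lfun_zero: "lfun L \<psi> \<Longrightarrow> \<psi> \<zero> = 0"
  using lfun_smult[of L \<psi> \<zero> 0] by simp

lemma lfun_minus: "lfun L \<psi> \<Longrightarrow> x \<in> carrier L \<Longrightarrow> \<psi> (\<ominus> x) = - \<psi> x"
  using lfun_smult[of L \<psi> x "- 1"] by (simp add: smult_minus_one)

lemma lfun_diff: "lfun L \<psi> \<Longrightarrow> x \<in> carrier L \<Longrightarrow> y \<in> carrier L \<Longrightarrow> \<psi> (x \<ominus> y) = \<psi> x - \<psi> y"
  by (simp add: minus_eq lfun_add lfun_minus)

lemmas lfun_simps = lfun_add lfun_smult lfun_zero lfun_minus lfun_diff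

lemma bilin_simps:
  assumes "bilin L b"
  shows "x \<in> carrier L \<Longrightarrow> y \<in> carrier L \<Longrightarrow> z \<in> carrier L \<Longrightarrow> b (x \<oplus> y) z = b x z + b y z"
    "x \<in> carrier L \<Longrightarrow> y \<in> carrier L \<Longrightarrow> z \<in> carrier L \<Longrightarrow> b z (x \<oplus> y) = b z x + b z y"
    "x \<in> carrier L \<Longrightarrow> z \<in> carrier L \<Longrightarrow> b (a \<odot> x) z = a * b x z"
    "x \<in> carrier L \<Longrightarrow> z \<in> carrier L \<Longrightarrow> b z (a \<odot> x) = a * b z x"
    "z \<in> carrier L \<Longrightarrow> b \<zero> z = 0"
    "z \<in> carrier L \<Longrightarrow> b z \<zero> = 0"
    "x \<in> carrier L \<Longrightarrow> z \<in> carrier L \<Longrightarrow> b (\<ominus> x) z = - b x z"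
    "x \<in> carrier L \<Longrightarrow> z \<in> carrier L \<Longrightarrow> b z (\<ominus> x) = - b z x"
    "x \<in> carrier L \<Longrightarrow> y \<in> carrier L \<Longrightarrow> z \<in> carrier L \<Longrightarrow> b (x \<ominus> y) z = b x z - b y z"
    "x \<in> carrier L \<Longrightarrow> y \<in> carrier L \<Longrightarrow> z \<in> carrier L \<Longrightarrow> b z (x \<ominus> y) = b z x - b z y"
  using lfun_simps[OF bilin_lfun[OF assms]] lfun_simps[OF bilin_lfun'[OF assms]] by auto

lemma lfun_finsum:
  assumes "lfun L \<psi>" "finite S" "\<And>i. i \<in> S \<Longrightarrow> f i \<in> carrier L"
  shows "\<psi> (\<Oplus>i\<in>S. f i) = (\<Sum>i\<in>S. \<psi> (f i))"
  using assms(2,3)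
proof (induction S)
  case empty
  then show ?case by (simp add: lfun_zero[OF assms(1)])
next
  case (insert i S)
  then have "f \<in> S \<rightarrow> carrier L" by auto
  then show ?case using insert by (simp add: lfun_add[OF assms(1)])
qed

text \<open>The carrier is an abstract module, so no basis is at hand; instead the completeness of
  functionals for formal combinations is used in degree one. If all functionals agree at x and y,
  then [x] - [y] lies in the span of the relators, and the evaluation that reads [z] as z kills that
  span. Many later identities in the carrier are proved by this rule, which moves them into the
  field.\<close>

lemma lfun_eqI:
  assumes "x \<in> carrier L" "y \<in> carrier L" and eq: "\<And>\<psi>. lfun L \<psi> \<Longrightarrow> \<psi> x = \<psi> y"
  shows "x = y"
proof -
  \<comment> \<open>The sum runs over a fixed S rather than over the support, which makes
    \<open>\<kappa> S\<close> additive. S has to be finite, and a relator is killed once S contains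
    its letters; this is the source of the finite sets \<open>S0\<close> below.\<close>
  define \<kappa> :: "'a set \<Rightarrow> ('a list \<Rightarrow>\<^sub>0 'k) \<Rightarrow> 'a"
    where "\<kappa> S t = (\<Oplus>z\<in>S. Poly_Mapping.lookup t [z] \<odot> z)" for S t
  have add: "\<kappa> S (s + t) = \<kappa> S s \<oplus> \<kappa> S t" if "S \<subseteq> carrier L" for S s t
  proof -
    have "\<kappa> S (s + t) =
        (\<Oplus>z\<in>S. Poly_Mapping.lookup s [z] \<odot> z \<oplus> Poly_Mapping.lookup t [z] \<odot> z)"
      unfolding \<kappa>_def by (rule finsum_cong') (use that in \<open>auto simp: lookup_add smult_simps\<close>)
    also have "\<dots> = \<kappa> S s \<oplus> \<kappa> S t"
      unfolding \<kappa>_def by (rule finsum_addf) (use that in auto)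
    finally show ?thesis .
  qed
  have closed: "\<kappa> S t \<in> carrier L" if "S \<subseteq> carrier L" for S t
    unfolding \<kappa>_def using that by (auto intro!: finsum_closed)
  have scale: "\<kappa> S (fscale a t) = a \<odot> \<kappa> S t" if "S \<subseteq> carrier L" "finite S" for S a t
  proof -
    have "\<kappa> S (fscale a t) = (\<Oplus>z\<in>S. a \<odot> (Poly_Mapping.lookup t [z] \<odot> z))"
      unfolding \<kappa>_def by (rule finsum_cong') (use that in \<open>auto simp: smult_simps\<close>)
    also have "\<dots> = a \<odot> \<kappa> S t"
      unfolding \<kappa>_def by (rule finsum_smult_ldistr[symmetric]) (use that in auto)
    finally show ?thesis .
  qed
  have diff: "\<kappa> S (s - t) = \<kappa> S s \<ominus> \<kappa> S t" if "S \<subseteq> carrier L" "finite S" for S s t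
  proof -
    have *: "s - t = s + fscale (- 1) t" by (rule poly_mapping_eqI) (simp add: lookup_add lookup_minus)
    show ?thesis unfolding * using that by (simp add: add scale smult_minus_one closed minus_eq)
  qed
  have single: "\<kappa> S (Poly_Mapping.single [z] a) = a \<odot> z" if "S \<subseteq> carrier L" "finite S" "z \<in> S" for S z a
  proof -
    have "\<kappa> S (Poly_Mapping.single [z] a) = (\<Oplus>y\<in>S. if z = y then a \<odot> y else \<zero>)"
      unfolding \<kappa>_def by (rule finsum_cong') (use that in \<open>auto simp: lookup_single when_def\<close>)
    also have "\<dots> = a \<odot> z"
      using that by (intro finsum_singleton) auto
    finally show ?thesis .
  qed
  have other: "\<kappa> S (Poly_Mapping.single w a) = \<zero>" if "S \<subseteq> carrier L" "length w \<noteq> 1" for S w a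
  proof -
    have "\<kappa> S (Poly_Mapping.single w a) = (\<Oplus>y\<in>S. \<zero>)"
      unfolding \<kappa>_def by (rule finsum_cong') (use that in \<open>auto simp: lookup_single when_def\<close>)
    then show ?thesis by simp
  qed
  interpret v: vector_space "fscale :: 'k \<Rightarrow> ('a list \<Rightarrow>\<^sub>0 'k) \<Rightarrow> _" by (rule vector_space_fscale)
  \<comment> \<open>Only a relator with empty context consists of words of length one, and its
    letters form \<open>S0\<close>. All other relators vanish under \<open>\<kappa> S\<close> word
    by word.\<close>
  have rel: "\<exists>S0. finite S0 \<and> S0 \<subseteq> carrier L \<and> (\<forall>S. finite S \<longrightarrow> S0 \<subseteq> S \<longrightarrow> S \<subseteq> carrier L \<longrightarrow> \<kappa> S r = \<zero>)"
    if r: "r \<in> multilinear_relators L" for r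
    using r unfolding multilinear_relators_def
  proof (elim UnE CollectE exE conjE)
    fix u v x y assume r: "r = Poly_Mapping.single (u @ (x \<oplus> y) # v) 1 - Poly_Mapping.single (u @ x # v) 1
        - Poly_Mapping.single (u @ y # v) 1" and xy: "x \<in> carrier L" "y \<in> carrier L"
    have "x \<oplus> (y \<oplus> (\<ominus> x \<oplus> \<ominus> y)) = \<zero>"
      using r_neg[of "x \<oplus> y"] xy by (simp add: minus_add a_assoc)
    with r xy show ?thesis
      by (intro exI[of _ "{x \<oplus> y, x, y}"], cases "u = [] \<and> v = []")
        (auto simp: diff single other minus_eq minus_add a_assoc smult_simps)
  next
    fix u v x a assume r: "r = Poly_Mapping.single (u @ (a \<odot> x) # v) 1 - Poly_Mapping.single (u @ x # v) a"
      and "x \<in> carrier L"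
    then show ?thesis
      by (intro exI[of _ "{a \<odot> x, x}"], cases "u = [] \<and> v = []")
        (auto simp: diff single other minus_eq smult_simps r_neg)
  qed
  have span: "\<exists>S0. finite S0 \<and> S0 \<subseteq> carrier L \<and> (\<forall>S. finite S \<longrightarrow> S0 \<subseteq> S \<longrightarrow> S \<subseteq> carrier L \<longrightarrow> \<kappa> S t = \<zero>)"
    if "t \<in> v.span (multilinear_relators L)" for t
    using that
  proof (induction rule: v.span_induct_alt)
    case base
    have "\<kappa> S 0 = \<zero>" if "S \<subseteq> carrier L" for S
      using other[of S "[]" 0] that by simp
    then show ?case by blast
  next
    case (step c r t)
    from rel[OF step(1)] obtain S1 where S1: "finite S1" "S1 \<subseteq> carrier L"
      "\<And>S. finite S \<Longrightarrow> S1 \<subseteq> S \<Longrightarrow> S \<subseteq> carrier L \<Longrightarrow> \<kappa> S r = \<zero>" by blast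
    from step(2) obtain S2 where S2: "finite S2" "S2 \<subseteq> carrier L"
      "\<And>S. finite S \<Longrightarrow> S2 \<subseteq> S \<Longrightarrow> S \<subseteq> carrier L \<Longrightarrow> \<kappa> S t = \<zero>" by blast
    show ?case
      by (rule exI[of _ "S1 \<union> S2"]) (use S1 S2 in \<open>auto simp: add scale smult_r_null[simplified]\<close>)
  qed
  have "tensor_eq L (Poly_Mapping.single [x] 1) (Poly_Mapping.single [y] 1)"
    unfolding tensor_eq_iff_multilin
  proof (intro allI impI)
    fix \<phi> assume "multilin L \<phi>"
    then have "lfun L (\<lambda>z. \<phi> [z])"
      unfolding multilin_def lfun_def by (auto dest!: spec[of _ "[]"])
    then show "pairing \<phi> (Poly_Mapping.single [x] 1) = pairing \<phi> (Poly_Mapping.single [y] 1)"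
      using eq by simp
  qed
  then have "Poly_Mapping.single [x] 1 - Poly_Mapping.single [y] 1 \<in> v.span (multilinear_relators L)"
    unfolding tensor_eq_def .
  from span[OF this] obtain S0 where S0: "finite S0" "S0 \<subseteq> carrier L"
    "\<And>S. finite S \<Longrightarrow> S0 \<subseteq> S \<Longrightarrow> S \<subseteq> carrier L \<Longrightarrow>
      \<kappa> S (Poly_Mapping.single [x] 1 - Poly_Mapping.single [y] 1) = \<zero>"
    by (elim exE conjE) blast
  define S where "S = S0 \<union> {x, y}"
  have S: "finite S" "S \<subseteq> carrier L" "x \<in> S" "y \<in> S" "S0 \<subseteq> S"
    using S0(1,2) assms(1,2) by (auto simp: S_def)
  have "\<zero> = \<kappa> S (Poly_Mapping.single [x] 1 - Poly_Mapping.single [y] 1)"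
    by (rule S0(3)[OF S(1,5,2), symmetric])
  also have "\<dots> = 1 \<odot> x \<ominus> 1 \<odot> y"
    by (simp only: diff[OF S(2,1)] single[OF S(2,1,3)] single[OF S(2,1,4)])
  also have "\<dots> = x \<ominus> y"
    using assms(1,2) by (simp only: smult_simps)
  finally show ?thesis
    using minus_equality[of x "\<ominus> y"] assms(1,2) by (simp add: minus_eq)
qed

end

section \<open>Cocycles and the co-Jacobi identity\<close>

text \<open>The transpose of the action of x on L \<otimes> L, without the sign of the
  contragredient action: testing x.t with b is testing t with this form, see
  \<open>pair2_act\<close>.\<close>

definition badj :: "('k::field, 'a, 'm) lie_alg_scheme \<Rightarrow> 'a \<Rightarrow> ('a \<Rightarrow> 'a \<Rightarrow> 'k) \<Rightarrow> 'a \<Rightarrow> 'a \<Rightarrow> 'k" where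
  "badj L x b = (\<lambda>p q. b (bracket L x p) q + b p (bracket L x q))"

context lie_algebra
begin

lemma lfun_bracket:
  assumes "lfun L \<psi>" "x \<in> carrier L"
  shows "lfun L (\<lambda>y. \<psi> (bracket L x y))" "lfun L (\<lambda>y. \<psi> (bracket L y x))"
  using assms by (auto simp: lfun_def bracket_add_left bracket_add_right bracket_smult_left bracket_smult_right)

lemma bracket_zero_left [simp]: "x \<in> carrier L \<Longrightarrow> bracket L \<zero> x = \<zero>"
  and bracket_zero_right [simp]: "x \<in> carrier L \<Longrightarrow> bracket L x \<zero> = \<zero>"
  using bracket_smult_left[of \<zero> x 0] bracket_smult_right[of x \<zero> 0] by simp_all

lemma bracket_minus_left: "x \<in> carrier L \<Longrightarrow> y \<in> carrier L \<Longrightarrow> bracket L (\<ominus> x) y = \<ominus> bracket L x y"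
  and bracket_minus_right: "x \<in> carrier L \<Longrightarrow> y \<in> carrier L \<Longrightarrow> bracket L y (\<ominus> x) = \<ominus> bracket L y x"
  using bracket_smult_left[of x y "- 1"] bracket_smult_right[of y x "- 1"]
  by (simp_all add: smult_minus_one)

lemma bracket_antisym: "x \<in> carrier L \<Longrightarrow> y \<in> carrier L \<Longrightarrow> bracket L y x = \<ominus> bracket L x y"
proof -
  assume c: "x \<in> carrier L" "y \<in> carrier L"
  have "bracket L y x \<oplus> bracket L x y = \<zero>"
    using bracket_self[of "x \<oplus> y"] bracket_self[of x] bracket_self[of y] c
    by (simp add: bracket_add_left bracket_add_right a_comm)
  then show ?thesis
    using minus_equality[of "bracket L y x" "bracket L x y"] c by simp
qed

lemma bracket_diff_left: "x \<in> carrier L \<Longrightarrow> y \<in> carrier L \<Longrightarrow> z \<in> carrier L \<Longrightarrow>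
    bracket L (x \<ominus> y) z = bracket L x z \<ominus> bracket L y z"
  and bracket_diff_right: "x \<in> carrier L \<Longrightarrow> y \<in> carrier L \<Longrightarrow> z \<in> carrier L \<Longrightarrow>
    bracket L z (x \<ominus> y) = bracket L z x \<ominus> bracket L z y"
  by (simp_all add: minus_eq bracket_add_left bracket_add_right bracket_minus_left bracket_minus_right)

lemmas bracket_simps = bracket_add_left bracket_add_right bracket_smult_left bracket_smult_right
  bracket_minus_left bracket_minus_right bracket_diff_left bracket_diff_right

lemma jacobi_leibniz:
  assumes c: "x \<in> carrier L" "y \<in> carrier L" "z \<in> carrier L"
  shows "bracket L (bracket L x y) z = bracket L x (bracket L y z) \<ominus> bracket L y (bracket L x z)"
proof (rule lfun_eqI)
  fix \<psi> assume \<psi>: "lfun L \<psi>"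
  have "\<psi> (bracket L x (bracket L y z) \<oplus> bracket L y (bracket L z x) \<oplus> bracket L z (bracket L x y)) = 0"
    using jacobi[OF c] lfun_zero[OF \<psi>] by simp
  moreover have "bracket L z (bracket L x y) = \<ominus> bracket L (bracket L x y) z"
    "bracket L z x = \<ominus> bracket L x z"
    using c by (auto intro: bracket_antisym)
  ultimately show "\<psi> (bracket L (bracket L x y) z) =
      \<psi> (bracket L x (bracket L y z) \<ominus> bracket L y (bracket L x z))"
    using c by (simp add: lfun_simps[OF \<psi>] bracket_simps)
qed (use c in auto)

lemma bilin_badj: "bilin L b \<Longrightarrow> x \<in> carrier L \<Longrightarrow> bilin L (badj L x b)"
  unfolding bilin_def lfun_def badj_def
  by (auto simp: bracket_simps algebra_simps)

lemma badj_add: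
  assumes "t \<in> tensors L 2" "bilin L b" "x \<in> carrier L" "y \<in> carrier L"
  shows "pair2 (badj L (x \<oplus> y) b) t = pair2 (badj L x b) t + pair2 (badj L y b) t"
  unfolding pair2_fun_add[symmetric]
  by (rule pair2_cong[OF assms(1)])
    (use assms in \<open>auto simp: badj_def bracket_simps bilin_simps[OF assms(2)]\<close>)

lemma badj_smult:
  assumes "t \<in> tensors L 2" "bilin L b" "x \<in> carrier L"
  shows "pair2 (badj L (a \<odot> x) b) t = a * pair2 (badj L x b) t"
  unfolding pair2_fun_mult[symmetric]
  by (rule pair2_cong[OF assms(1)])
    (use assms in \<open>auto simp: badj_def bracket_simps bilin_simps[OF assms(2)] algebra_simps\<close>)

text \<open>Transposition reverses composition, which explains the order of the two terms. The mixed
  terms, with one bracket in each slot, cancel.\<close>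

lemma badj_bracket:
  assumes "t \<in> tensors L 2" "bilin L b" "x \<in> carrier L" "y \<in> carrier L"
  shows "pair2 (badj L (bracket L x y) b) t =
    pair2 (badj L y (badj L x b)) t - pair2 (badj L x (badj L y b)) t"
  unfolding pair2_fun_diff[symmetric]
  by (rule pair2_cong[OF assms(1)])
    (use assms in \<open>auto simp: badj_def jacobi_leibniz bilin_simps[OF assms(2)]\<close>)

lemma act_tensors:
  assumes "x \<in> carrier L" "t \<in> tensors L n"
  shows "act L x t \<in> tensors L n"
  unfolding act_def
proof (rule tensors_lin_ext, rule tensors_sum)
  fix w i assume w: "w \<in> Poly_Mapping.keys t" "i \<in> {..<length w}"
  then have l: "length w = n" "set w \<subseteq> carrier L" using assms(2) by (auto simp: tensors_def)
  then have "w ! i \<in> carrier L" using w(2) by auto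
  then have "insert (bracket L x (w ! i)) (set w) \<subseteq> carrier L" using l assms(1) by auto
  then show "Poly_Mapping.single (w[i := bracket L x (w ! i)]) 1 \<in> tensors L n"
    using l set_update_subset_insert[of w i "bracket L x (w ! i)"] by (intro tensors_single) auto
qed

lemma pair2_act:
  assumes "t \<in> tensors L 2"
  shows "pair2 b (act L x t) = pair2 (badj L x b) t"
proof -
  have "pair2 b (act L x t) = pairing (\<lambda>w. \<Sum>i<length w.
      b (w[i := bracket L x (w ! i)] ! 0) (w[i := bracket L x (w ! i)] ! 1)) t"
    by (simp add: pair2_def act_def pairing_sum)
  also have "\<dots> = pair2 (badj L x b) t"
    unfolding pair2_def
  proof (rule pairing_cong)
    fix w assume "w \<in> Poly_Mapping.keys t"
    then obtain p q where "w = [p, q]" using assms by (elim tensors2_cases)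
    then show "(\<Sum>i<length w. b (w[i := bracket L x (w ! i)] ! 0) (w[i := bracket L x (w ! i)] ! 1))
        = badj L x b (w ! 0) (w ! 1)"
      by (simp add: badj_def numeral_2_eq_2)
  qed
  finally show ?thesis .
qed

lemma linear_cocycle_iff:
  "linear_cocycle L \<delta> \<longleftrightarrow>
     (\<forall>x\<in>carrier L. \<delta> x \<in> tensors L 2) \<and>
     (\<forall>b. bilin L b \<longrightarrow> lfun L (\<lambda>x. pair2 b (\<delta> x))) \<and>
     (\<forall>b. bilin L b \<longrightarrow> (\<forall>x\<in>carrier L. \<forall>y\<in>carrier L.
        pair2 b (\<delta> (bracket L x y)) = pair2 (badj L x b) (\<delta> y) - pair2 (badj L y b) (\<delta> x)))"
proof (cases "\<forall>x\<in>carrier L. \<delta> x \<in> tensors L 2")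
  case True
  have a: "tensor_eq L (\<delta> (x \<oplus> y)) (\<delta> x + \<delta> y) \<longleftrightarrow>
      (\<forall>b. bilin L b \<longrightarrow> pair2 b (\<delta> (x \<oplus> y)) = pair2 b (\<delta> x) + pair2 b (\<delta> y))"
    if "x \<in> carrier L" "y \<in> carrier L" for x y
    using that True by (subst tensor_eq2_iff) (auto intro: tensors_add)
  have s: "tensor_eq L (\<delta> (a \<odot> x)) (fscale a (\<delta> x)) \<longleftrightarrow>
      (\<forall>b. bilin L b \<longrightarrow> pair2 b (\<delta> (a \<odot> x)) = a * pair2 b (\<delta> x))"
    if "x \<in> carrier L" for x a
    using that True by (subst tensor_eq2_iff) (auto intro: tensors_fscale)
  have b: "tensor_eq L (\<delta> (bracket L x y)) (act L x (\<delta> y) - act L y (\<delta> x)) \<longleftrightarrow>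
      (\<forall>b. bilin L b \<longrightarrow> pair2 b (\<delta> (bracket L x y)) =
         pair2 (badj L x b) (\<delta> y) - pair2 (badj L y b) (\<delta> x))"
    if "x \<in> carrier L" "y \<in> carrier L" for x y
    using that True by (subst tensor_eq2_iff) (auto intro: tensors_diff act_tensors simp: pair2_act)
  show ?thesis
    unfolding linear_cocycle_def lfun_def using a s b True by (simp cong: ball_cong) blast
qed (unfold linear_cocycle_def, blast)

end

section \<open>Antisymmetry and co-Jacobi reduced to generators\<close>

definition trilin :: "('k::field, 'a, 'm) module_scheme \<Rightarrow> ('a \<Rightarrow> 'a \<Rightarrow> 'a \<Rightarrow> 'k) \<Rightarrow> bool" where
  "trilin L \<tau> \<longleftrightarrow> (\<forall>x\<in>carrier L. bilin L (\<tau> x) \<and> bilin L (\<lambda>y. \<tau> y x) \<and> bilin L (\<lambda>y z. \<tau> y z x))"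

text \<open>Only the cocycle rule is assumed here; the lemmas of this locale derive antisymmetry and
  co-Jacobi from their validity on generators.\<close>

locale lie_coalgebra_cocycle = lie_algebra L
  for L :: "('k::field, 'a, 'm) lie_alg_scheme" (structure) +
  fixes \<delta> :: "'a \<Rightarrow> ('a list \<Rightarrow>\<^sub>0 'k)"
  assumes cocycle: "linear_cocycle L \<delta>"
begin

lemma cocycle_tensors [simp]: "x \<in> carrier L \<Longrightarrow> \<delta> x \<in> tensors L 2"
  using cocycle by (simp add: linear_cocycle_def)

lemma cocycle_lfun: "bilin L b \<Longrightarrow> lfun L (\<lambda>x. pair2 b (\<delta> x))"
  using cocycle by (simp add: linear_cocycle_iff)

lemma cocycle_bracket: "bilin L b \<Longrightarrow> x \<in> carrier L \<Longrightarrow> y \<in> carrier L \<Longrightarrow>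
   pair2 b (\<delta> (bracket L x y)) = pair2 (badj L x b) (\<delta> y) - pair2 (badj L y b) (\<delta> x)"
  using cocycle by (simp add: linear_cocycle_iff)

lemma bilin_flip: "bilin L b \<Longrightarrow> bilin L (\<lambda>p q. b q p)"
  by (auto simp: bilin_def)

text \<open>The flip of L \<otimes> L commutes with the adjoint action, so the sum of \<delta> and
  its flip is a cocycle, and a cocycle that vanishes on generators vanishes.\<close>

lemma antisym_generated:
  assumes X: "X \<subseteq> carrier L" "carrier L \<subseteq> lie_generated L X"
    and gen: "\<And>b x. bilin L b \<Longrightarrow> x \<in> X \<Longrightarrow> pair2 b (\<delta> x) + pair2 (\<lambda>p q. b q p) (\<delta> x) = 0"
    and "bilin L b" "x \<in> carrier L"
  shows "pair2 (\<lambda>p q. b q p) (\<delta> x) = - pair2 b (\<delta> x)"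
proof -
  have "x \<in> lie_generated L X" using assms by auto
  then have "x \<in> carrier L \<and> (\<forall>b. bilin L b \<longrightarrow> pair2 b (\<delta> x) + pair2 (\<lambda>p q. b q p) (\<delta> x) = 0)"
  proof induction
    case zero
    then show ?case by (simp add: lfun_zero[OF cocycle_lfun] bilin_flip)
  next
    case (gen x)
    then show ?case using assms(1,3) by auto
  next
    case (add x y)
    then show ?case by (simp add: lfun_add[OF cocycle_lfun] bilin_flip algebra_simps)
  next
    case (smult x a)
    then show ?case by (simp add: lfun_smult[OF cocycle_lfun] bilin_flip flip: distrib_left)
  next
    case (bracket x y)
    then have c: "x \<in> carrier L" "y \<in> carrier L" by auto
    have flip: "badj L z (\<lambda>p q. b q p) = (\<lambda>p q. badj L z b q p)" for z b
      by (simp add: badj_def add.commute)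
    have "pair2 b (\<delta> (bracket L x y)) + pair2 (\<lambda>p q. b q p) (\<delta> (bracket L x y)) = 0"
      if b: "bilin L b" for b
    proof -
      have "pair2 b (\<delta> (bracket L x y)) + pair2 (\<lambda>p q. b q p) (\<delta> (bracket L x y)) =
          (pair2 (badj L x b) (\<delta> y) + pair2 (\<lambda>p q. badj L x b q p) (\<delta> y))
          - (pair2 (badj L y b) (\<delta> x) + pair2 (\<lambda>p q. badj L y b q p) (\<delta> x))"
        using b c by (simp add: cocycle_bracket bilin_flip flip[of x b] flip[of y b])
      also have "\<dots> = 0"
        using bracket bilin_badj[OF b] by simp
      finally show ?thesis .
    qed
    then show ?case using c by simp
  qed
  then show ?thesis using assms(4) by (simp add: eq_neg_iff_add_eq_0 add.commute)
qed

text \<open>The value of \<tau> at (\<delta> \<otimes> id) \<delta>(x). Co-Jacobi is its vanishing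
  for cyclically invariant \<tau>.\<close>

definition cojac :: "('a \<Rightarrow> 'a \<Rightarrow> 'a \<Rightarrow> 'k) \<Rightarrow> 'a \<Rightarrow> 'k" where
  "cojac \<tau> x = pair2 (\<lambda>a c. pair2 (\<lambda>p q. \<tau> p q c) (\<delta> a)) (\<delta> x)"

lemma trilinD:
  assumes "trilin L \<tau>" "x \<in> carrier L"
  shows "bilin L (\<tau> x)" "bilin L (\<lambda>y. \<tau> y x)" "bilin L (\<lambda>y z. \<tau> y z x)"
  using assms by (auto simp: trilin_def)

lemma bilin_cojac:
  assumes "trilin L \<tau>"
  shows "bilin L (\<lambda>a c. pair2 (\<lambda>p q. \<tau> p q c) (\<delta> a))"
  unfolding bilin_def
proof (intro ballI conjI)
  fix x assume x: "x \<in> carrier L"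
  show "lfun L (\<lambda>a. pair2 (\<lambda>p q. \<tau> p q x) (\<delta> a))"
    by (intro cocycle_lfun trilinD[OF assms x])
  show "lfun L (\<lambda>c. pair2 (\<lambda>p q. \<tau> p q c) (\<delta> x))"
    unfolding lfun_def
  proof (intro conjI ballI allI)
    fix y z a assume yz: "y \<in> carrier L" "z \<in> carrier L"
    show "pair2 (\<lambda>p q. \<tau> p q (y \<oplus> z)) (\<delta> x) = pair2 (\<lambda>p q. \<tau> p q y) (\<delta> x) + pair2 (\<lambda>p q. \<tau> p q z) (\<delta> x)"
      unfolding pair2_fun_add[symmetric]
      by (rule pair2_cong[OF cocycle_tensors[OF x]]) (use yz in \<open>simp add: bilin_simps(2)[OF trilinD(1)[OF assms]]\<close>)
    show "pair2 (\<lambda>p q. \<tau> p q (a \<odot> y)) (\<delta> x) = a * pair2 (\<lambda>p q. \<tau> p q y) (\<delta> x)"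
      unfolding pair2_fun_mult[symmetric]
      by (rule pair2_cong[OF cocycle_tensors[OF x]]) (use yz in \<open>simp add: bilin_simps(4)[OF trilinD(1)[OF assms]]\<close>)
  qed
qed

text \<open>For (\<delta> \<otimes> id) \<delta>([x, y]) the cocycle rule gives the action of x on
  (\<delta> \<otimes> id) \<delta>(y), the same with x and y exchanged, and cross terms in which a
  leg of \<delta>(y) acts on \<delta>(x) or conversely. The former vanish by induction, the latter
  cancel by antisymmetry and cyclic invariance.\<close>

lemma cojac_generated:
  assumes X: "X \<subseteq> carrier L" "carrier L \<subseteq> lie_generated L X"
    and antisym: "\<And>b x. bilin L b \<Longrightarrow> x \<in> carrier L \<Longrightarrow> pair2 (\<lambda>p q. b q p) (\<delta> x) = - pair2 b (\<delta> x)"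
    and gen: "\<And>\<tau> x. trilin L \<tau> \<Longrightarrow>
      (\<And>p q r. p \<in> carrier L \<Longrightarrow> q \<in> carrier L \<Longrightarrow> r \<in> carrier L \<Longrightarrow> \<tau> q r p = \<tau> p q r) \<Longrightarrow>
      x \<in> X \<Longrightarrow> cojac \<tau> x = 0"
    and "trilin L \<tau>" "\<And>p q r. p \<in> carrier L \<Longrightarrow> q \<in> carrier L \<Longrightarrow> r \<in> carrier L \<Longrightarrow> \<tau> q r p = \<tau> p q r"
    and "x \<in> carrier L"
  shows "cojac \<tau> x = 0"
proof -
  let ?cyc = "\<lambda>\<tau>. \<forall>p\<in>carrier L. \<forall>q\<in>carrier L. \<forall>r\<in>carrier L. \<tau> q r p = \<tau> p q r"
  have "x \<in> lie_generated L X" using assms by auto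
  \<comment> \<open>The form is quantified inside the induction, since the bracket case applies the
    hypothesis to the transformed forms \<open>\<tau>' x\<close> and
    \<open>\<tau>' y\<close>.\<close>
  then have "x \<in> carrier L \<and> (\<forall>\<tau>. trilin L \<tau> \<longrightarrow> ?cyc \<tau> \<longrightarrow> cojac \<tau> x = 0)"
  proof induction
    case zero
    then show ?case by (simp add: cojac_def lfun_zero[OF cocycle_lfun] bilin_cojac)
  next
    case (gen x)
    then show ?case using assms(1,4) by auto
  next
    case (add x y)
    then show ?case by (simp add: cojac_def lfun_add[OF cocycle_lfun] bilin_cojac)
  next
    case (smult x a)
    then show ?case by (simp add: cojac_def lfun_smult[OF cocycle_lfun] bilin_cojac)
  next
    case (bracket x y)
    then have c: "x \<in> carrier L" "y \<in> carrier L" by auto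
    have "cojac \<tau> (bracket L x y) = 0" if \<tau>: "trilin L \<tau>" and cyc: "?cyc \<tau>" for \<tau>
    proof -
      define B :: "('a \<Rightarrow> 'a \<Rightarrow> 'a \<Rightarrow> 'k) \<Rightarrow> 'a \<Rightarrow> 'a \<Rightarrow> 'k"
        where "B = (\<lambda>\<tau> a c. pair2 (\<lambda>p q. \<tau> p q c) (\<delta> a))"
      define \<tau>' where "\<tau>' = (\<lambda>x p q c. \<tau> (bracket L x p) q c + \<tau> p (bracket L x q) c + \<tau> p q (bracket L x c))"
      \<comment> \<open>\<open>C z a c\<close> collects the part of \<delta>([z, a]) in which the
        leg a acts on \<delta>(z); it enters with a minus sign.\<close>
      define C where "C = (\<lambda>x a c. pair2 (\<lambda>p q. \<tau> (bracket L a p) q c + \<tau> p (bracket L a q) c) (\<delta> x))"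
      note \<tau>_simps = bilin_simps[OF trilinD(1)[OF \<tau>]] bilin_simps[OF trilinD(2)[OF \<tau>]]
      have \<tau>': "trilin L (\<tau>' z)" if "z \<in> carrier L" for z
        using that unfolding trilin_def bilin_def lfun_def \<tau>'_def
        by (auto simp: bracket_simps \<tau>_simps algebra_simps)
      have cyc': "?cyc (\<tau>' z)" if "z \<in> carrier L" for z
        using that cyc unfolding \<tau>'_def by simp
      have badj_B: "badj L z (B \<tau>) a c = B (\<tau>' z) a c - C z a c"
        if "z \<in> carrier L" "a \<in> carrier L" "c \<in> carrier L" for z a c
      proof -
        have "badj L z (B \<tau>) a c = pair2 (badj L z (\<lambda>p q. \<tau> p q c)) (\<delta> a)
            + pair2 (\<lambda>p q. \<tau> p q (bracket L z c)) (\<delta> a) - pair2 (badj L a (\<lambda>p q. \<tau> p q c)) (\<delta> z)"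
          using that cocycle_bracket[OF trilinD(3)[OF \<tau>]]
          by (subst badj_def) (simp add: B_def)
        then show ?thesis
          by (simp add: B_def \<tau>'_def C_def badj_def pair2_fun_add)
      qed
      have pair_B: "pair2 (badj L z (B \<tau>)) (\<delta> w) = - pair2 (C z) (\<delta> w)"
        if "z \<in> carrier L" "w \<in> carrier L" and w: "\<forall>\<tau>. trilin L \<tau> \<longrightarrow> ?cyc \<tau> \<longrightarrow> cojac \<tau> w = 0" for z w
      proof -
        have "pair2 (badj L z (B \<tau>)) (\<delta> w) = pair2 (\<lambda>a c. B (\<tau>' z) a c - C z a c) (\<delta> w)"
          using that by (intro pair2_cong[OF cocycle_tensors] badj_B)
        also have "pair2 (B (\<tau>' z)) (\<delta> w) = 0"
          using w \<tau>'[OF that(1)] cyc'[OF that(1)] unfolding cojac_def B_def by blast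
        then have "pair2 (\<lambda>a c. B (\<tau>' z) a c - C z a c) (\<delta> w) = - pair2 (C z) (\<delta> w)"
          by (simp add: pair2_fun_diff)
        finally show ?thesis .
      qed
      \<comment> \<open>The common value of both cross terms. Antisymmetry moves the bracketed leg
        to the first tensor position and cyclic invariance puts it into the first argument of
        \<tau>, so that only brackets of first legs remain.\<close>
      define S where "S = pair2 (\<lambda>a c. pair2 (\<lambda>p q. \<tau> (bracket L a p) q c - \<tau> (bracket L a p) c q) (\<delta> x)) (\<delta> y)"
      have "pair2 (C x) (\<delta> y) = S"
        unfolding S_def
      proof (rule pair2_cong[OF cocycle_tensors[OF c(2)]])
        fix a r assume ar: "a \<in> carrier L" "r \<in> carrier L"
        have "bilin L (\<lambda>p q. \<tau> p (bracket L a q) r)"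
          using ar unfolding bilin_def lfun_def by (auto simp: bracket_simps \<tau>_simps)
        from antisym[OF this c(1)]
        have "pair2 (\<lambda>p q. \<tau> p (bracket L a q) r) (\<delta> x) = - pair2 (\<lambda>p q. \<tau> q (bracket L a p) r) (\<delta> x)" by simp
        also have "pair2 (\<lambda>p q. \<tau> q (bracket L a p) r) (\<delta> x) = pair2 (\<lambda>p q. \<tau> (bracket L a p) r q) (\<delta> x)"
          using cyc ar by (intro pair2_cong[OF cocycle_tensors[OF c(1)]]) auto
        finally show "C x a r = pair2 (\<lambda>p q. \<tau> (bracket L a p) q r - \<tau> (bracket L a p) r q) (\<delta> x)"
          by (simp add: C_def pair2_fun_add pair2_fun_diff)
      qed
      moreover have "pair2 (C y) (\<delta> x) = S"
        unfolding S_def pair2_swap[of _ "\<delta> x" "\<delta> y"]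
      proof (rule pair2_cong[OF cocycle_tensors[OF c(1)]])
        fix p q assume pq: "p \<in> carrier L" "q \<in> carrier L"
        have flip: "bracket L p a = \<ominus> bracket L a p" if "a \<in> carrier L" for a
          using pq that by (intro bracket_antisym)
        have "bilin L (\<lambda>a r. \<tau> a (bracket L p r) q)"
          using pq unfolding bilin_def lfun_def by (auto simp: bracket_simps \<tau>_simps)
        from antisym[OF this c(2)]
        have "pair2 (\<lambda>a r. \<tau> a (bracket L p r) q) (\<delta> y) = - pair2 (\<lambda>a r. \<tau> r (bracket L p a) q) (\<delta> y)" by simp
        also have "pair2 (\<lambda>a r. \<tau> r (bracket L p a) q) (\<delta> y) = pair2 (\<lambda>a r. - \<tau> (bracket L a p) q r) (\<delta> y)"
          using cyc pq by (intro pair2_cong[OF cocycle_tensors[OF c(2)]]) (auto simp: flip \<tau>_simps)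
        finally have 1: "pair2 (\<lambda>a r. \<tau> a (bracket L p r) q) (\<delta> y) = pair2 (\<lambda>a r. \<tau> (bracket L a p) q r) (\<delta> y)"
          by (simp add: pair2_fun_uminus)
        have 2: "pair2 (\<lambda>a r. \<tau> (bracket L p a) r q) (\<delta> y) = pair2 (\<lambda>a r. - \<tau> (bracket L a p) r q) (\<delta> y)"
          using pq by (intro pair2_cong[OF cocycle_tensors[OF c(2)]]) (auto simp: flip \<tau>_simps)
        show "C y p q = pair2 (\<lambda>a r. \<tau> (bracket L a p) q r - \<tau> (bracket L a p) r q) (\<delta> y)"
          by (simp add: C_def pair2_fun_add pair2_fun_diff 1 2 pair2_fun_uminus)
      qed
      moreover have "cojac \<tau> (bracket L x y) = pair2 (badj L x (B \<tau>)) (\<delta> y) - pair2 (badj L y (B \<tau>)) (\<delta> x)"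
        unfolding cojac_def B_def by (rule cocycle_bracket[OF bilin_cojac[OF \<tau>] c])
      ultimately show ?thesis
        using bracket c by (simp add: pair_B)
    qed
    then show ?case using c by simp
  qed
  then show ?thesis using assms(5,6) by blast
qed

lemma tensor_eq_antisym:
  assumes "\<And>b. bilin L b \<Longrightarrow> pair2 (\<lambda>p q. b q p) (\<delta> x) = - pair2 b (\<delta> x)" "x \<in> carrier L"
  shows "tensor_eq L (\<delta> x + word_map rev (\<delta> x)) 0"
  unfolding tensor_eq_iff_multilin
proof (intro allI impI)
  fix \<phi> assume "multilin L \<phi>"
  then have "bilin L (\<lambda>p q. \<phi> [p, q])" by (rule multilin_bilin)
  from assms(1)[OF this] assms(2) show "pairing \<phi> (\<delta> x + word_map rev (\<delta> x)) = pairing \<phi> 0"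
    by (simp add: pairing_eq_pair2[OF cocycle_tensors])
qed

lemma tensor_eq_cojacobi:
  assumes "\<And>\<tau>. trilin L \<tau> \<Longrightarrow>
      (\<And>p q r. p \<in> carrier L \<Longrightarrow> q \<in> carrier L \<Longrightarrow> r \<in> carrier L \<Longrightarrow> \<tau> q r p = \<tau> p q r) \<Longrightarrow> cojac \<tau> x = 0"
    and x: "x \<in> carrier L"
  defines "t \<equiv> lin_ext (\<lambda>w. word_map (\<lambda>u. u @ tl w) (\<delta> (hd w))) (\<delta> x)"
  shows "tensor_eq L (t + word_map rotate1 t + word_map (rotate1 \<circ> rotate1) t) 0"
  unfolding tensor_eq_iff_multilin
proof (intro allI impI)
  fix \<phi> assume \<phi>: "multilin L \<phi>"
  \<comment> \<open>Rotating words before applying \<phi> is the same as summing \<phi> over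
    rotations, so only cyclically invariant forms have to be tested.\<close>
  define \<tau> where "\<tau> = (\<lambda>p q r. \<phi> [p, q, r] + \<phi> [q, r, p] + \<phi> [r, p, q])"
  have p: "pairing \<psi> t = cojac (\<lambda>p q r. \<psi> [p, q, r]) x" for \<psi>
    unfolding t_def cojac_def
    by (simp add: pairing_eq_pair2[OF cocycle_tensors[OF x]])
      (rule pair2_cong[OF cocycle_tensors[OF x]], simp add: pairing_eq_pair2[OF cocycle_tensors])
  have "trilin L \<tau>"
    unfolding trilin_def bilin_def lfun_def \<tau>_def
    using multilin_lfun[OF \<phi>, of "[]" "[_, _]"] multilin_lfun[OF \<phi>, of "[_]" "[_]"] multilin_lfun[OF \<phi>, of "[_, _]" "[]"]
    by (auto simp: lfun_def algebra_simps)
  then have "cojac \<tau> x = 0"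
    by (rule assms(1)) (simp add: \<tau>_def)
  then show "pairing \<phi> (t + word_map rotate1 t + word_map (rotate1 \<circ> rotate1) t) = pairing \<phi> 0"
    by (simp add: p \<tau>_def cojac_def pair2_fun_add)
qed

end

section \<open>Presented Lie algebras\<close>

text \<open>Stated for record extensions, so that it applies to \<open>mplba\<close>, which carries
  a cobracket, as well as to a bare presented Lie algebra.\<close>

locale lie_presentation =
  fixes L :: "('k::field, ('k, 'x) lie_term set, 'm) lie_alg_scheme" (structure)
    and R :: "(('k, 'x) lie_term \<times> ('k, 'x) lie_term) set"
  assumes carrier_eq: "carrier L = range (term_class R)"
    and zero_eq: "\<zero> = term_class R LZero"
    and add_eq: "X \<oplus> Y = term_class R (LAdd (SOME s. s \<in> X) (SOME t. t \<in> Y))"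
    and smult_eq: "a \<odot> X = term_class R (LScale a (SOME s. s \<in> X))"
    and bracket_eq: "bracket L X Y = term_class R (LBr (SOME s. s \<in> X) (SOME t. t \<in> Y))"

lemma term_class_eq_iff: "term_class R s = term_class R t \<longleftrightarrow> lie_cong R s t"
  unfolding term_class_def
  by (auto intro: lie_cong.refl lie_cong.sym lie_cong.trans dest: lie_cong.sym lie_cong.trans
      simp: set_eq_iff)

lemma lie_cong_some: "lie_cong R s (SOME t. t \<in> term_class R s)"
proof -
  have "s \<in> term_class R s" by (simp add: term_class_def lie_cong.refl)
  then have "(SOME t. t \<in> term_class R s) \<in> term_class R s" by (rule someI)
  then show ?thesis by (simp add: term_class_def)
qed

primrec leval :: "('k, 'b, 'm) lie_alg_scheme \<Rightarrow> ('x \<Rightarrow> 'b) \<Rightarrow> ('k, 'x) lie_term \<Rightarrow> 'b" where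
  "leval M g (LGen x) = g x"
| "leval M g LZero = \<zero>\<^bsub>M\<^esub>"
| "leval M g (LAdd s t) = leval M g s \<oplus>\<^bsub>M\<^esub> leval M g t"
| "leval M g (LScale a s) = a \<odot>\<^bsub>M\<^esub> leval M g s"
| "leval M g (LBr s t) = bracket M (leval M g s) (leval M g t)"

context lie_algebra
begin

lemma leval_closed [simp]: "(\<And>x. g x \<in> carrier L) \<Longrightarrow> leval L g s \<in> carrier L"
  by (induction s) auto

lemma leval_cong:
  assumes g: "\<And>x. g x \<in> carrier L" and R: "\<And>s t. (s, t) \<in> R \<Longrightarrow> leval L g s = leval L g t"
    and st: "lie_cong R s t"
  shows "leval L g s = leval L g t"
  using st
proof induction
  case (add_neg s)
  then show ?case using g by (simp add: smult_minus_one r_neg)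
next
  case (br_jacobi s t u)
  then show ?case using g jacobi by simp
next
  case (add_comm s t)
  then show ?case using g by (simp add: a_comm)
qed (use g R in \<open>auto simp: smult_simps bracket_simps bracket_self a_assoc\<close>)

end

context lie_presentation
begin

abbreviation cls :: "('k, 'x) lie_term \<Rightarrow> ('k, 'x) lie_term set" where
  "cls \<equiv> term_class R"

lemma cls_closed [simp]: "cls s \<in> carrier L"
  by (simp add: carrier_eq)

lemma carrier_cases: assumes "X \<in> carrier L" obtains s where "X = cls s"
  using assms by (auto simp: carrier_eq)

lemma cls_add: "cls s \<oplus> cls t = cls (LAdd s t)"
  and cls_smult: "a \<odot> cls s = cls (LScale a s)"
  and cls_bracket: "bracket L (cls s) (cls t) = cls (LBr s t)"
  unfolding add_eq smult_eq bracket_eq term_class_eq_iff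
  by (intro lie_cong.intros(5-7) lie_cong.sym[OF lie_cong_some])+

lemmas cls_simps = cls_add cls_smult cls_bracket zero_eq

lemmas cls_eq_simps = cls_simps term_class_eq_iff

lemma module_L: "Module.module scalars L"
proof (rule moduleI[OF cring_scalars abelian_groupI])
  fix X Y Z and a c :: 'k
  assume X: "X \<in> carrier L"
  then obtain s where s: "X = cls s" by (elim carrier_cases)
  have "cls (LScale (- 1) s) \<oplus> X = \<zero>"
    unfolding s cls_eq_simps by (rule lie_cong.trans[OF lie_cong.add_comm lie_cong.add_neg])
  then show "\<exists>Y\<in>carrier L. Y \<oplus> X = \<zero>" by (rule bexI[OF _ cls_closed])
  show "\<zero> \<oplus> X = X"
    unfolding s cls_eq_simps by (rule lie_cong.trans[OF lie_cong.add_comm lie_cong.add_zero])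
  show "a \<odot> X \<in> carrier L" "\<one>\<^bsub>scalars\<^esub> \<odot> X = X"
    "(a \<oplus>\<^bsub>scalars\<^esub> c) \<odot> X = a \<odot> X \<oplus> c \<odot> X" "(a \<otimes>\<^bsub>scalars\<^esub> c) \<odot> X = a \<odot> (c \<odot> X)"
    unfolding s by (simp_all add: cls_eq_simps lie_cong.scale_one lie_cong.add_scale
        lie_cong.sym[OF lie_cong.scale_scale])
  assume Y: "Y \<in> carrier L"
  then obtain t where t: "Y = cls t" by (elim carrier_cases)
  show "X \<oplus> Y \<in> carrier L" "X \<oplus> Y = Y \<oplus> X" "a \<odot> (X \<oplus> Y) = a \<odot> X \<oplus> a \<odot> Y"
    unfolding s t by (simp_all add: cls_eq_simps lie_cong.add_comm lie_cong.scale_add)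
  assume Z: "Z \<in> carrier L"
  then obtain u where u: "Z = cls u" by (elim carrier_cases)
  show "X \<oplus> Y \<oplus> Z = X \<oplus> (Y \<oplus> Z)"
    unfolding s t u by (simp add: cls_eq_simps lie_cong.add_assoc)
qed (simp add: zero_eq)

sublocale lie_algebra L
proof (rule lie_algebra.intro[OF module_L lie_algebra_axioms.intro])
  fix X Y Z and a :: 'k
  assume X: "X \<in> carrier L"
  then obtain s where s: "X = cls s" by (elim carrier_cases)
  show "bracket L X X = \<zero>"
    unfolding s by (simp add: cls_eq_simps lie_cong.br_self)
  assume Y: "Y \<in> carrier L"
  then obtain t where t: "Y = cls t" by (elim carrier_cases)
  show "bracket L X Y \<in> carrier L" "bracket L (a \<odot> X) Y = a \<odot> bracket L X Y"
    "bracket L X (a \<odot> Y) = a \<odot> bracket L X Y"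
    unfolding s t by (simp_all add: cls_eq_simps lie_cong.br_scale_left lie_cong.br_scale_right)
  assume Z: "Z \<in> carrier L"
  then obtain u where u: "Z = cls u" by (elim carrier_cases)
  show "bracket L (X \<oplus> Y) Z = bracket L X Z \<oplus> bracket L Y Z"
    "bracket L X (Y \<oplus> Z) = bracket L X Y \<oplus> bracket L X Z"
    "bracket L X (bracket L Y Z) \<oplus> bracket L Y (bracket L Z X) \<oplus> bracket L Z (bracket L X Y) = \<zero>"
    unfolding s t u by (simp_all add: cls_eq_simps lie_cong.br_add_left lie_cong.br_add_right lie_cong.br_jacobi)
qed

lemma carrier_generated: "carrier L \<subseteq> lie_generated L (range (\<lambda>x. cls (LGen x)))"
proof
  fix X assume "X \<in> carrier L"
  then obtain s where X: "X = cls s" by (elim carrier_cases)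
  have "cls s \<in> lie_generated L (range (\<lambda>x. cls (LGen x)))"
    by (induction s) (auto simp flip: cls_simps intro: lie_generated.intros)
  then show "X \<in> lie_generated L (range (\<lambda>x. cls (LGen x)))" by (simp add: X)
qed

definition lift :: "('k, 'b, 'o) lie_alg_scheme \<Rightarrow> ('x \<Rightarrow> 'b) \<Rightarrow> ('k, 'x) lie_term set \<Rightarrow> 'b" where
  "lift M g X = leval M g (SOME s. s \<in> X)"

lemma lift_cls:
  assumes "lie_algebra M" "\<And>x. g x \<in> carrier M" "\<And>s t. (s, t) \<in> R \<Longrightarrow> leval M g s = leval M g t"
  shows "lift M g (cls s) = leval M g s"
  unfolding lift_def by (rule lie_algebra.leval_cong[OF assms lie_cong_some, symmetric])

text \<open>The cocycle rule read as a recursion on terms. Paired with the class of the term, this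
  is evaluation in the semidirect product of L with the module L \<otimes> L. Congruent terms may
  get different formal combinations that agree only as tensors.\<close>

primrec coext :: "('x \<Rightarrow> (('k, 'x) lie_term set list \<Rightarrow>\<^sub>0 'k)) \<Rightarrow> ('k, 'x) lie_term \<Rightarrow> (('k, 'x) lie_term set list \<Rightarrow>\<^sub>0 'k)" where
  "coext \<delta>0 (LGen x) = \<delta>0 x"
| "coext \<delta>0 LZero = 0"
| "coext \<delta>0 (LAdd s t) = coext \<delta>0 s + coext \<delta>0 t"
| "coext \<delta>0 (LScale a s) = fscale a (coext \<delta>0 s)"
| "coext \<delta>0 (LBr s t) = act L (cls s) (coext \<delta>0 t) - act L (cls t) (coext \<delta>0 s)"

lemma coext_tensors [simp]: "(\<And>x. \<delta>0 x \<in> tensors L 2) \<Longrightarrow> coext \<delta>0 s \<in> tensors L 2"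
  by (induction s) (auto intro!: tensors_add tensors_fscale tensors_diff act_tensors)

text \<open>The Lie laws hold automatically because L \<otimes> L is an L-module, so only the
  defining relations remain as a hypothesis.\<close>

lemma coext_cong:
  assumes \<delta>0: "\<And>x. \<delta>0 x \<in> tensors L 2"
    and R: "\<And>s t b. (s, t) \<in> R \<Longrightarrow> bilin L b \<Longrightarrow> pair2 b (coext \<delta>0 s) = pair2 b (coext \<delta>0 t)"
    and st: "lie_cong R s t" and b: "bilin L b"
  shows "pair2 b (coext \<delta>0 s) = pair2 b (coext \<delta>0 t)"
  using st b
proof (induction arbitrary: b)
  case (rel s t)
  then show ?case using R by blast
next
  case (cong_br s s' t t')
  then have "cls s = cls s'" "cls t = cls t'" by (simp_all add: term_class_eq_iff)
  then show ?case using cong_br \<delta>0 by (simp add: pair2_act bilin_badj)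
next
  case (br_add_left s t u)
  then show ?case using \<delta>0
    by (simp add: pair2_act bilin_badj badj_add tensors_add flip: cls_add)
next
  case (br_add_right s t u)
  then show ?case using \<delta>0
    by (simp add: pair2_act bilin_badj badj_add tensors_add flip: cls_add)
next
  case (br_scale_left s t u)
  then show ?case using \<delta>0
    by (simp add: pair2_act bilin_badj badj_smult tensors_fscale algebra_simps flip: cls_smult)
next
  case (br_scale_right s t u)
  then show ?case using \<delta>0
    by (simp add: pair2_act bilin_badj badj_smult tensors_fscale algebra_simps flip: cls_smult)
next
  case (br_jacobi s t u)
  then show ?case using \<delta>0
    by (simp add: pair2_act bilin_badj badj_bracket act_tensors tensors_diff flip: cls_bracket)
qed (use \<delta>0 in \<open>simp_all add: algebra_simps\<close>)

lemma linear_cocycle_extension: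
  assumes \<delta>0: "\<And>x. \<delta>0 x \<in> tensors L 2"
    and R: "\<And>s t b. (s, t) \<in> R \<Longrightarrow> bilin L b \<Longrightarrow> pair2 b (coext \<delta>0 s) = pair2 b (coext \<delta>0 t)"
  obtains \<delta> where "linear_cocycle L \<delta>" "\<And>x. tensor_eq L (\<delta> (cls (LGen x))) (\<delta>0 x)"
proof
  define \<delta> where "\<delta> X = coext \<delta>0 (SOME s. s \<in> X)" for X
  have \<delta>: "pair2 b (\<delta> (cls s)) = pair2 b (coext \<delta>0 s)" if "bilin L b" for b s
    unfolding \<delta>_def using coext_cong[OF assms lie_cong_some that] by simp
  have t: "\<delta> X \<in> tensors L 2" for X unfolding \<delta>_def using \<delta>0 by simp
  show "tensor_eq L (\<delta> (cls (LGen x))) (\<delta>0 x)" for x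
    using \<delta>0 t by (subst tensor_eq2_iff) (auto simp: \<delta>)
  show "linear_cocycle L \<delta>"
    unfolding linear_cocycle_iff lfun_def
    using t \<delta>0 by (auto elim!: carrier_cases simp: cls_simps \<delta> pair2_act bilin_badj)
qed

end

section \<open>Highest weight modules\<close>

definition comm_op :: "('v \<Rightarrow> 'v) \<Rightarrow> ('v \<Rightarrow> 'v) \<Rightarrow> 'v \<Rightarrow> 'v::ab_group_add" where
  "comm_op f g w = f (g w) - g (f w)"

text \<open>One rank-two computation for both Serre relations: e is commuted past iterated
  commutators of f1 with f2, and h is the commutator of e with f1 or with f2. It is used for e = E_k
  with two F's and for e = F_k with two E's.\<close>

locale serre_ops = vector_space scale for scale :: "'k::field \<Rightarrow> 'v::ab_group_add \<Rightarrow> 'v" +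
  fixes e f1 f2 h :: "'v \<Rightarrow> 'v"
  assumes add: "e (v + w) = e v + e w" "f1 (v + w) = f1 v + f1 w" "f2 (v + w) = f2 v + f2 w"
    "h (v + w) = h v + h w"
    and sc: "e (scale c v) = scale c (e v)" "f1 (scale c v) = scale c (f1 v)"
    "f2 (scale c v) = scale c (f2 v)" "h (scale c v) = scale c (h v)"
begin

definition x :: "nat \<Rightarrow> 'v \<Rightarrow> 'v" where "x m = (comm_op f1 ^^ m) f2"

lemma x_0: "x 0 w = f2 w"
  and x_Suc: "x (Suc m) w = f1 (x m w) - x m (f1 w)"
  by (simp_all add: x_def comm_op_def)

lemma uminus: "e (- w) = - e w" "f1 (- w) = - f1 w" "f2 (- w) = - f2 w" "h (- w) = - h w"
  using sc[of "- 1" w] by simp_all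

lemma zero: "e 0 = 0" "f1 0 = 0" "f2 0 = 0" "h 0 = 0"
  using sc[of 0 0] by simp_all

lemma diff: "e (v - w) = e v - e w" "f1 (v - w) = f1 v - f1 w" "f2 (v - w) = f2 v - f2 w" "h (v - w) = h v - h w"
  using add[of v "- w"] by (simp_all add: uminus)

lemma x_lin: "x m (v + w) = x m v + x m w" "x m (scale c v) = scale c (x m v)"
  "x m (- v) = - x m v" "x m (v - w) = x m v - x m w"
proof (induction m arbitrary: v w)
  case 0
  { case 1 show ?case by (simp add: add x_0) }
  { case 2 show ?case by (simp add: sc x_0) }
  { case 3 show ?case by (simp add: uminus x_0) }
  { case 4 show ?case by (simp add: diff x_0) }
next
  case (Suc m)
  { case 1 show ?case by (simp add: x_Suc x_0 add Suc) }
  { case 2 show ?case by (simp add: x_Suc x_0 sc Suc scale_right_diff_distrib) }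
  { case 3 show ?case by (simp add: x_Suc x_0 uminus Suc) }
  { case 4 show ?case by (simp add: x_Suc x_0 diff Suc) }
qed

lemma comm_independent:
  assumes "\<And>w. e (f1 w) = f1 (e w)" "\<And>w. e (f2 w) = f2 (e w)"
  shows "e (x m w) = x m (e w)"
  by (induction m arbitrary: w) (simp_all add: x_Suc x_0 assms diff)

text \<open>The sl_2 computation: f2 commutes with e and has weight -a under h, each commutator with
  f1 lowers the weight by 2, and the weights met on the way add up to (m + 1)(a + m). This is zero
  for m = -a, that is, at the Serre exponent m + 1 = 1 - a.\<close>

lemma comm_first:
  assumes "\<And>w. e (f1 w) = f1 (e w) + h w" "\<And>w. e (f2 w) = f2 (e w)"
    "\<And>w. h (f1 w) = f1 (h w) - scale 2 (f1 w)" "\<And>w. h (f2 w) = f2 (h w) - scale a (f2 w)"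
  shows "e (x (Suc m) w) = x (Suc m) (e w) - scale (of_nat (Suc m) * (a + of_nat m)) (x m w)"
proof -
  have h: "h (x m w) = x m (h w) - scale (2 * of_nat m + a) (x m w)" for m w
  proof (induction m arbitrary: w)
    case (Suc m)
    have "h (x (Suc m) w) = f1 (h (x m w)) - scale 2 (f1 (x m w)) - h (x m (f1 w))"
      by (simp add: x_Suc x_0 diff assms)
    also have "\<dots> = x (Suc m) (h w) - scale (2 * of_nat (Suc m) + a) (x (Suc m) w)"
      by (simp add: x_Suc x_0 Suc diff sc add assms x_lin algebra_simps)
    finally show ?case .
  qed (simp add: assms x_0)
  show ?thesis
  proof (induction m arbitrary: w)
    case 0
    then show ?case by (simp add: x_Suc x_0 diff assms x_lin add algebra_simps)
  next
    case (Suc m)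
    have "e (x (Suc (Suc m)) w) = f1 (e (x (Suc m) w)) + h (x (Suc m) w) - e (x (Suc m) (f1 w))"
      by (simp only: x_Suc[of "Suc m"] diff assms)
    also have "\<dots> = f1 (x (Suc m) (e w)) - scale (of_nat (Suc m) * (a + of_nat m)) (f1 (x m w))
        + x (Suc m) (h w) - scale (2 * of_nat (Suc m) + a) (x (Suc m) w)
        - (x (Suc m) (f1 (e w)) + x (Suc m) (h w) - scale (of_nat (Suc m) * (a + of_nat m)) (x m (f1 w)))"
      unfolding Suc h assms(1) by (simp only: diff sc x_lin add_diff_eq)
    also have "\<dots> = x (Suc (Suc m)) (e w)
       - (scale (of_nat (Suc m) * (a + of_nat m)) (x (Suc m) w) + scale (2 * of_nat (Suc m) + a) (x (Suc m) w))"
    proof -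
      have "x (Suc (Suc m)) (e w) = f1 (x (Suc m) (e w)) - x (Suc m) (f1 (e w))"
        "x (Suc m) w = f1 (x m w) - x m (f1 w)"
        by (simp_all add: x_Suc x_0)
      then show ?thesis by (simp only: scale_right_diff_distrib) (simp only: algebra_simps)
    qed
    \<comment> \<open>The old coefficient (m + 1)(a + m) plus the weight 2(m + 1) + a equals (m +
      2)(a + m + 1).\<close>
    also have "scale (of_nat (Suc m) * (a + of_nat m)) (x (Suc m) w) + scale (2 * of_nat (Suc m) + a) (x (Suc m) w)
      = scale (of_nat (Suc (Suc m)) * (a + of_nat (Suc m))) (x (Suc m) w)"
      unfolding scale_left_distrib[symmetric] by (rule arg_cong[where f = "\<lambda>c. scale c _"]) (simp add: algebra_simps)
    finally show ?case .
  qed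
qed

text \<open>Now e meets f2: the first commutator leaves a multiple of f1, and since f1 commutes with
  itself nothing survives from the second on. The term for m = 0 concerns Serre exponent 1, where
  the zero pattern of the Cartan matrix gives a = 0.\<close>

lemma comm_second:
  assumes "\<And>w. e (f1 w) = f1 (e w)" "\<And>w. e (f2 w) = f2 (e w) + h w"
    "\<And>w. h (f1 w) = f1 (h w) - scale a (f1 w)"
  shows "e (x (Suc m) w) = x (Suc m) (e w) + (if m = 0 then scale a (f1 w) else 0)"
proof (induction m arbitrary: w)
  case 0
  then show ?case by (simp add: x_Suc x_0 diff assms add algebra_simps)
next
  case (Suc m)
  have "e (x (Suc (Suc m)) w) = f1 (e (x (Suc m) w)) - e (x (Suc m) (f1 w))"
    by (simp only: x_Suc[of "Suc m"] diff assms)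
  also have "\<dots> = f1 (x (Suc m) (e w)) - x (Suc m) (f1 (e w))"
    unfolding Suc by (simp add: assms add sc zero)
  also have "\<dots> = x (Suc (Suc m)) (e w)" by (simp add: x_Suc x_0)
  finally show ?case by simp
qed

end

section \<open>Cartan data of a realization\<close>

locale mp_realization =
  fixes A :: "int^'n^'n" and d :: "nat^'n" and P :: "'k::field_char_0^'n^'n"
    and \<R> :: "('k, 'n, 'h::ab_group_add) realization_data"
  assumes cartan: "gen_cartan_matrix A" and symmetrizer: "symmetrizer A d"
    and type_P: "cartan_type A d P" and real: "realization P \<R>"
begin

abbreviation alpha :: "'n \<Rightarrow> 'h \<Rightarrow> 'k" where "alpha \<equiv> rt \<R>"

lemma d_nonzero [simp]: "d $ i \<noteq> 0"
  using symmetrizer by (metis symmetrizer_def less_numeral_extra(3))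

lemma vector_space_scl: "vector_space (scl \<R>)"
  using real by (simp add: realization_def)

lemma linear_alpha: "Vector_Spaces.linear (scl \<R>) (*) (alpha i)"
  using real by (simp add: realization_def)

lemma alpha_add: "alpha i (s + t) = alpha i s + alpha i t"
  and alpha_scl: "alpha i (scl \<R> c t) = c * alpha i t"
proof -
  interpret Vector_Spaces.linear "scl \<R>" "(*)" "alpha i" by (rule linear_alpha)
  show "alpha i (s + t) = alpha i s + alpha i t" "alpha i (scl \<R> c t) = c * alpha i t"
    by (rule add, rule scale)
qed

lemma alpha_T [simp]: "alpha j (Tp \<R> i) = P $ i $ j" "alpha j (Tm \<R> i) = P $ j $ i"
  using real by (simp_all add: realization_def)

lemma P_sum: "P $ i $ j + P $ j $ i = 2 * of_nat (d $ i) * of_int (A $ i $ j)"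
proof -
  have "(P + transpose P) $ i $ j = (\<chi> i j. 2 * DA A d $ i $ j) $ i $ j"
    using type_P by (simp add: cartan_type_def)
  then show ?thesis by (simp add: transpose_def DA_def mult.assoc)
qed

lemma A_diag: "A $ i $ i = 2" and A_nonpos: "i \<noteq> j \<Longrightarrow> A $ i $ j \<le> 0"
  and A_zero: "A $ i $ j = 0 \<longleftrightarrow> A $ j $ i = 0"
  using cartan by (simp_all add: gen_cartan_matrix_def)

definition hpair :: "'n \<Rightarrow> 'n \<Rightarrow> 'k" where
  "hpair i j = alpha j (Tp \<R> i + Tm \<R> i) / (2 * of_nat (d $ i))"

text \<open>Normalised by 2 d_i, the sum of the two coroots acts as the Kac-Moody coroot, because
  the antisymmetric part of P drops out of p_ij + p_ji.\<close>

lemma hpair: "hpair i j = of_int (A $ i $ j)"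
  by (simp add: hpair_def alpha_add P_sum)

end

section \<open>The dual Verma module of an arbitrary highest weight\<close>

locale dual_verma = mp_realization A d P \<R>
  for A :: "int^'n^'n" and d :: "nat^'n" and P :: "'k::field_char_0^'n^'n"
    and \<R> :: "('k, 'n, 'h::ab_group_add) realization_data" +
  fixes lam :: "'h \<Rightarrow> 'k"
  assumes linear_lam: "Vector_Spaces.linear (scl \<R>) (*) lam"
begin

text \<open>The dual of a Verma module: a function on words stands for the matrix coefficients against the
  words in the \<open>E\<^sub>i\<close> at the highest weight vector. This makes the action of \<open>E\<^sub>i\<close> a shift, and the
  relation for \<open>[E\<^sub>i, F\<^sub>j]\<close> becomes the recursion that defines \<open>F\<^sub>j\<close>.\<close>

definition smul :: "'k \<Rightarrow> ('n list \<Rightarrow> 'k) \<Rightarrow> 'n list \<Rightarrow> 'k" where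
  "smul c f = (\<lambda>K. c * f K)"

lemma smul_apply [simp]: "smul c f K = c * f K"
  by (simp add: smul_def)

declare plus_fun_apply [simp del] zero_fun_apply [simp del] minus_apply [simp del]
  uminus_apply [simp del] smul_apply [simp del]

lemmas pointwise = fun_eq_iff plus_fun_apply zero_fun_apply minus_apply uminus_apply smul_apply

lemma smul_zero: "smul 0 f = 0" "smul c 0 = 0"
  and smul_minus: "smul (- c) f = - smul c f"
  by (simp_all add: pointwise)

lemma vector_space_smul: "vector_space smul"
  by unfold_locales (auto simp: pointwise algebra_simps)

text \<open>The word K sees the component whose weight is \<open>lam\<close> minus the roots of its
  letters, since the E_i in K raise exactly that component to the highest weight space.\<close>

primrec wt :: "'n list \<Rightarrow> 'h \<Rightarrow> 'k" where
  "wt [] t = lam t"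
| "wt (i # K) t = wt K t - alpha i t"

lemma wt_lin: "wt K (s + t) = wt K s + wt K t" "wt K (scl \<R> c t) = c * wt K t"
proof -
  interpret l: Vector_Spaces.linear "scl \<R>" "(*)" lam by (rule linear_lam)
  show "wt K (s + t) = wt K s + wt K t" "wt K (scl \<R> c t) = c * wt K t"
    by (induction K) (auto simp: l.add l.scale alpha_add alpha_scl algebra_simps)
qed

definition top :: "'h \<Rightarrow> ('n list \<Rightarrow> 'k) \<Rightarrow> 'n list \<Rightarrow> 'k" where
  "top t f = (\<lambda>K. wt K t * f K)"

definition hop :: "'n \<Rightarrow> ('n list \<Rightarrow> 'k) \<Rightarrow> 'n list \<Rightarrow> 'k" where
  "hop i f = (\<lambda>K. wt K (Tp \<R> i + Tm \<R> i) / (2 * of_nat (d $ i)) * f K)"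

definition eop :: "'n \<Rightarrow> ('n list \<Rightarrow> 'k) \<Rightarrow> 'n list \<Rightarrow> 'k" where
  "eop i f = (\<lambda>K. f (i # K))"

text \<open>The start value is 0 because F_j lowers weights and so produces nothing in the highest
  weight space. The function varies in the recursion, being shifted at each letter.\<close>

primrec fval :: "'n \<Rightarrow> 'n list \<Rightarrow> ('n list \<Rightarrow> 'k) \<Rightarrow> 'k" where
  "fval j [] f = 0"
| "fval j (i # K) f = fval j K (eop i f) + (if i = j then hop i f K else 0)"

definition fop :: "'n \<Rightarrow> ('n list \<Rightarrow> 'k) \<Rightarrow> 'n list \<Rightarrow> 'k" where
  "fop j f = (\<lambda>K. fval j K f)"

lemma top_lin: "top t (f + g) = top t f + top t g" "top t (smul c f) = smul c (top t f)"
  by (auto simp: top_def pointwise algebra_simps)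

lemma hop_lin: "hop i (f + g) = hop i f + hop i g" "hop i (smul c f) = smul c (hop i f)"
  by (auto simp: hop_def pointwise algebra_simps add_divide_distrib)

lemma eop_lin: "eop i (f + g) = eop i f + eop i g" "eop i (smul c f) = smul c (eop i f)"
  by (auto simp: eop_def pointwise algebra_simps)

lemma fval_lin: "fval j K (f + g) = fval j K f + fval j K g" "fval j K (smul c f) = c * fval j K f"
  by (induction K arbitrary: f g) (auto simp: eop_lin hop_lin plus_fun_apply smul_apply algebra_simps)

lemma fop_lin: "fop i (f + g) = fop i f + fop i g" "fop i (smul c f) = smul c (fop i f)"
  by (auto simp: fop_def pointwise fval_lin)

lemma eop_fop: "eop i (fop j f) = fop j (eop i f) + (if i = j then hop i f else 0)"
proof
  fix K
  have "eop i (fop j f) K = fop j f (i # K)" by (simp add: eop_def)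
  then show "eop i (fop j f) K = (fop j (eop i f) + (if i = j then hop i f else 0)) K"
    by (simp add: fop_def plus_fun_apply zero_fun_apply)
qed

lemma eop_top: "eop i (top t f) = top t (eop i f) - smul (alpha i t) (eop i f)"
  by (auto simp: eop_def top_def pointwise algebra_simps)

lemma fop_diff: "fop j (f - g) = fop j f - fop j g"
  using fop_lin(1)[of j "f - g" g] by simp

lemma top_fop: "top t (fop j f) = fop j (top t f) - smul (alpha j t) (fop j f)"
proof
  fix K
  show "top t (fop j f) K = (fop j (top t f) - smul (alpha j t) (fop j f)) K"
  proof (induction K arbitrary: f)
    case Nil
    then show ?case by (simp add: top_def fop_def minus_apply smul_apply)
  next
    case (Cons i K)
    have "fop j (top t f) (i # K) = fop j (eop i (top t f)) K + (if i = j then hop i (top t f) K else 0)"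
      by (simp add: fop_def)
    also have "fop j (eop i (top t f)) K = wt K t * fop j (eop i f) K + alpha j t * fop j (eop i f) K
        - alpha i t * fop j (eop i f) K"
      using Cons[of "eop i f"] by (simp add: eop_top fop_diff fop_lin top_def[of t "fop j _"] minus_apply smul_apply algebra_simps)
    finally show ?case
      by (auto simp: top_def fop_def hop_def minus_apply smul_apply algebra_simps)
  qed
qed

lemma hop_top: "hop i f = smul (1 / (2 * of_nat (d $ i))) (top (Tp \<R> i + Tm \<R> i) f)"
  by (auto simp: hop_def top_def pointwise)

lemma hop_fop: "hop i (fop j f) = fop j (hop i f) - smul (of_int (A $ i $ j)) (fop j f)"
  unfolding hop_top top_fop fop_lin fop_diff hpair[symmetric]
  by (auto simp: pointwise hpair_def algebra_simps add_divide_distrib diff_divide_distrib)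

lemma hop_eop: "hop i (eop j f) = eop j (hop i f) + smul (of_int (A $ i $ j)) (eop j f)"
  unfolding hpair[symmetric]
  by (auto simp: hop_def eop_def pointwise hpair_def algebra_simps add_divide_distrib diff_divide_distrib)

lemma serre_ops_fop: "serre_ops smul (eop k) (fop i) (fop j) (hop k)"
  unfolding serre_ops_def serre_ops_axioms_def
  by (simp add: vector_space_smul eop_lin fop_lin hop_lin)

text \<open>Exchanging E and F turns the commutator H_k into its negative, and the E_i have under
  this negative the weights that the F_i have under \<open>hop\<close>.\<close>

lemma serre_ops_eop: "serre_ops smul (fop k) (eop i) (eop j) (\<lambda>f. - hop k f)"
  unfolding serre_ops_def serre_ops_axioms_def
  by (simp add: vector_space_smul eop_lin fop_lin hop_lin) (simp add: pointwise)

text \<open>These facts make the remainders of \<open>comm_first\<close> and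
  \<open>comm_second\<close> vanish: m = -a_ij kills the first, and a_ji = 0 the second in the one
  case in which it occurs.\<close>

lemma serre_exponent:
  assumes "i \<noteq> j"
  shows "\<exists>m. nat (1 - A $ i $ j) = Suc m \<and> (of_int (A $ i $ j) :: 'k) + of_nat m = 0 \<and>
    (m = 0 \<longrightarrow> A $ j $ i = 0)"
proof (intro exI conjI impI)
  have *: "A $ i $ j \<le> 0" by (rule A_nonpos[OF assms])
  then show "nat (1 - A $ i $ j) = Suc (nat (- A $ i $ j))"
    "(of_int (A $ i $ j) :: 'k) + of_nat (nat (- A $ i $ j)) = 0"
    by (auto simp: of_nat_nat)
  show "A $ j $ i = 0" if "nat (- A $ i $ j) = 0" using * that A_zero[of i j] by auto
qed

lemma serre_eop_commute:
  assumes ij: "i \<noteq> j" and x: "x = (comm_op (fop i) ^^ nat (1 - A $ i $ j)) (fop j)"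
  shows "eop k (x f) = x (eop k f)"
proof -
  obtain m where m: "nat (1 - A $ i $ j) = Suc m" "(of_int (A $ i $ j) :: 'k) + of_nat m = 0"
    "m = 0 \<Longrightarrow> A $ j $ i = 0"
    using serre_exponent[OF ij] by blast
  interpret s: serre_ops smul "eop k" "fop i" "fop j" "hop k" by (rule serre_ops_fop)
  have x: "x = s.x (Suc m)" by (simp add: x m s.x_def)
  consider "k \<noteq> i" "k \<noteq> j" | "k = i" | "k = j" by blast
  then show ?thesis
  proof cases
    case 1
    then show ?thesis unfolding x by (intro s.comm_independent) (auto simp: eop_fop)
  next
    case 2
    have "eop k (x f) = x (eop k f) - smul (of_nat (Suc m) * (of_int (A $ i $ j) + of_nat m)) (s.x m f)"
      unfolding x using 2 ij A_diag[of i] by (intro s.comm_first) (auto simp: eop_fop hop_fop)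
    then show ?thesis unfolding m(2) by (simp add: pointwise)
  next
    case 3
    have "eop k (x f) = x (eop k f) + (if m = 0 then smul (of_int (A $ j $ i)) (fop i f) else 0)"
      unfolding x using 3 ij by (intro s.comm_second) (auto simp: eop_fop hop_fop)
    then show ?thesis using m(3) by (auto simp: pointwise)
  qed
qed

lemma serre_fop_commute:
  assumes ij: "i \<noteq> j" and x: "x = (comm_op (eop i) ^^ nat (1 - A $ i $ j)) (eop j)"
  shows "fop k (x f) = x (fop k f)"
proof -
  obtain m where m: "nat (1 - A $ i $ j) = Suc m" "(of_int (A $ i $ j) :: 'k) + of_nat m = 0"
    "m = 0 \<Longrightarrow> A $ j $ i = 0"
    using serre_exponent[OF ij] by blast
  interpret s: serre_ops smul "fop k" "eop i" "eop j" "\<lambda>f. - hop k f" by (rule serre_ops_eop)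
  have x: "x = s.x (Suc m)" by (simp add: x m s.x_def)
  note uminus = s.uminus(2,3)
  consider "k \<noteq> i" "k \<noteq> j" | "k = i" | "k = j" by blast
  then show ?thesis
  proof cases
    case 1
    then show ?thesis unfolding x by (intro s.comm_independent) (auto simp: eop_fop)
  next
    case 2
    have "fop k (x f) = x (fop k f) - smul (of_nat (Suc m) * (of_int (A $ i $ j) + of_nat m)) (s.x m f)"
      unfolding x using 2 ij A_diag[of i] by (intro s.comm_first) (auto simp: eop_fop hop_eop uminus)
    then show ?thesis unfolding m(2) by (simp add: pointwise)
  next
    case 3
    have "fop k (x f) = x (fop k f) + (if m = 0 then smul (of_int (A $ j $ i)) (eop i f) else 0)"
      unfolding x using 3 ij by (intro s.comm_second) (auto simp: eop_fop hop_eop uminus)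
    then show ?thesis using m(3) by (auto simp: pointwise)
  qed
qed

text \<open>Every iterated commutator of F's vanishes at the empty word, and commuting with all
  shifts carries this to every word. The argument covers all functions, in contrast to the positive
  Serre relations.\<close>

lemma serre_fop_zero:
  assumes "i \<noteq> j" and x: "x = (comm_op (fop i) ^^ nat (1 - A $ i $ j)) (fop j)"
  shows "x f = 0"
proof -
  have at_Nil: "(comm_op (fop i) ^^ m) (fop j) f [] = 0" for m f
    by (induction m arbitrary: f) (simp_all add: comm_op_def fop_def minus_apply)
  have "x f K = 0" for K
  proof (induction K arbitrary: f)
    case Nil
    show ?case unfolding x by (rule at_Nil)
  next
    case (Cons k K)
    have "x f (k # K) = eop k (x f) K" by (simp add: eop_def)
    also have "\<dots> = x (eop k f) K" by (simp add: serre_eop_commute[OF assms])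
    finally show ?case using Cons by simp
  qed
  then show ?thesis by (simp add: pointwise)
qed

definition vac :: "'n list \<Rightarrow> 'k" where
  "vac K = (if K = [] then 1 else 0)"

text \<open>The submodule generated by the highest weight vector. On all functions the E_i are free
  shifts and satisfy no Serre relation, so the representation has to live here.\<close>

inductive_set hw_mod :: "('n list \<Rightarrow> 'k) set" where
  vac: "vac \<in> hw_mod"
| add: "f \<in> hw_mod \<Longrightarrow> g \<in> hw_mod \<Longrightarrow> f + g \<in> hw_mod"
| scale: "f \<in> hw_mod \<Longrightarrow> smul c f \<in> hw_mod"
| fop: "f \<in> hw_mod \<Longrightarrow> fop j f \<in> hw_mod"

lemma hw_mod_zero: "0 \<in> hw_mod"
proof -
  have "smul 0 vac = 0" by (simp add: pointwise)
  then show ?thesis using hw_mod.scale[OF hw_mod.vac, of 0] by simp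
qed

lemma hw_mod_diff: "f \<in> hw_mod \<Longrightarrow> g \<in> hw_mod \<Longrightarrow> f - g \<in> hw_mod"
proof -
  assume *: "f \<in> hw_mod" "g \<in> hw_mod"
  have eq: "f - g = f + smul (- 1) g" by (simp add: pointwise)
  show ?thesis unfolding eq by (intro hw_mod.intros *)
qed

lemma eop_vac: "eop i vac = 0"
  by (simp add: eop_def vac_def pointwise)

lemma top_vac: "top t vac = smul (lam t) vac"
  by (simp add: top_def vac_def pointwise)

lemma top_hw_mod: "f \<in> hw_mod \<Longrightarrow> top t f \<in> hw_mod"
  by (induction rule: hw_mod.induct)
    (auto simp: top_vac top_lin top_fop intro: hw_mod.intros hw_mod_diff)

lemma hop_hw_mod: "f \<in> hw_mod \<Longrightarrow> hop i f \<in> hw_mod"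
  by (simp add: hop_top top_hw_mod hw_mod.scale)

lemma eop_hw_mod: "f \<in> hw_mod \<Longrightarrow> eop i f \<in> hw_mod"
  by (induction rule: hw_mod.induct)
    (auto simp: eop_vac eop_lin eop_fop hw_mod_zero intro: hw_mod.intros hop_hw_mod)

text \<open>The positive Serre elements commute with all \<open>F\<^sub>k\<close> and kill the highest weight vector.\<close>

lemma serre_eop_zero:
  assumes "i \<noteq> j" and x: "x = (comm_op (eop i) ^^ nat (1 - A $ i $ j)) (eop j)" and "f \<in> hw_mod"
  shows "x f = 0"
  using \<open>f \<in> hw_mod\<close>
proof induction
  interpret s: serre_ops smul "fop k" "eop i" "eop j" "\<lambda>f. - hop k f" for k by (rule serre_ops_eop)
  have x': "x = s.x (nat (1 - A $ i $ j))" by (simp add: x s.x_def)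
  {
    case vac
    have "s.x m vac = 0" for m
    proof (induction m)
      case (Suc m)
      have "s.x m 0 = 0" using s.x_lin(2)[of m 0 0] by (simp add: smul_zero)
      with Suc show ?case by (simp add: s.x_Suc eop_vac s.zero)
    qed (simp add: s.x_0 eop_vac)
    then show ?case by (simp add: x')
  next
    case (add f g)
    then show ?case by (simp add: x' s.x_lin)
  next
    case (scale f c)
    then show ?case by (simp add: x' s.x_lin smul_zero)
  next
    case (fop f j')
    have "fop j' 0 = 0" using fop_lin(2)[of j' 0 0] by (simp add: smul_zero)
    with fop show ?case by (simp flip: serre_fop_commute[OF assms(1,2)])
  }
qed

primrec gen_op :: "('n, 'h) mp_gen \<Rightarrow> ('n list \<Rightarrow> 'k) \<Rightarrow> 'n list \<Rightarrow> 'k" where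
  "gen_op (GT t) = top t"
| "gen_op (GE i) = eop i"
| "gen_op (GF i) = fop i"

primrec rep :: "('k, ('n, 'h) mp_gen) lie_term \<Rightarrow> ('n list \<Rightarrow> 'k) \<Rightarrow> 'n list \<Rightarrow> 'k" where
  "rep (LGen x) = gen_op x"
| "rep LZero = (\<lambda>f. 0)"
| "rep (LAdd s t) = (\<lambda>f. rep s f + rep t f)"
| "rep (LScale c s) = (\<lambda>f. smul c (rep s f))"
| "rep (LBr s t) = comm_op (rep s) (rep t)"

lemma gen_op_lin: "gen_op x (f + g) = gen_op x f + gen_op x g" "gen_op x (smul c f) = smul c (gen_op x f)"
  by (cases x; simp add: top_lin eop_lin fop_lin)+

lemma smul_add: "smul c (f + g) = smul c f + smul c g"
  and smul_diff: "smul c (f - g) = smul c f - smul c g"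
  and smul_smul: "smul a (smul c f) = smul (a * c) f"
  and smul_add_left: "smul (a + c) f = smul a f + smul c f"
  and smul_one: "smul 1 f = f"
  by (auto simp: pointwise algebra_simps)

lemma rep_lin: "rep s (f + g) = rep s f + rep s g" "rep s (smul c f) = smul c (rep s f)"
proof (induction s arbitrary: f g c)
  case (LBr s t)
  { case 1 show ?case by (simp add: comm_op_def LBr) }
  { case 2 show ?case by (simp add: comm_op_def LBr smul_diff) }
qed (auto simp: gen_op_lin smul_add smul_smul smul_zero algebra_simps)

lemma rep_zero: "rep s 0 = 0"
  using rep_lin(2)[of s 0 0] by (simp add: smul_zero)

lemma rep_diff: "rep s (f - g) = rep s f - rep s g"
  using rep_lin(1)[of s "f - g" g] by simp

lemma rep_hw_mod: "f \<in> hw_mod \<Longrightarrow> rep s f \<in> hw_mod"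
proof (induction s arbitrary: f)
  case (LGen x)
  then show ?case by (cases x) (auto intro: top_hw_mod eop_hw_mod hw_mod.fop)
qed (auto simp: hw_mod_zero comm_op_def intro: hw_mod.intros hw_mod_diff)

lemma rep_funpow: "rep ((LBr s ^^ m) t) = (comm_op (rep s) ^^ m) (rep t)"
  by (induction m) auto

lemma rep_relation:
  assumes "(s, t) \<in> mp_relations A d \<R>" "f \<in> hw_mod"
  shows "rep s f = rep t f"
proof -
  have [simp]: "top (s + t) f = top s f + top t f" "top (scl \<R> c t) f = smul c (top t f)" for s t c
    by (auto simp: top_def wt_lin pointwise algebra_simps)
  have hop: "hop i f = smul (1 / (2 * of_nat (d $ i))) (top (Tp \<R> i) f + top (Tm \<R> i) f)" for i
    by (simp add: hop_top)
  have TT: "top s (top t f) = top t (top s f)" for s t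
    by (auto simp: top_def)
  from assms(1) show ?thesis
    unfolding mp_relations_def
    by (elim UnE CollectE exE conjE)
      (auto simp: comm_op_def smul_minus TT eop_top top_fop eop_fop hop rep_funpow assms(2)
        serre_eop_zero[OF _ HOL.refl] serre_fop_zero[OF _ HOL.refl])
qed

lemma rep_cong:
  assumes "lie_cong (mp_relations A d \<R>) s t" "f \<in> hw_mod"
  shows "rep s f = rep t f"
  using assms
  by (induction arbitrary: f rule: lie_cong.induct)
    (auto simp: rep_relation comm_op_def rep_hw_mod rep_lin rep_diff smul_add smul_diff smul_smul
      smul_add_left smul_one smul_minus smul_zero algebra_simps hw_mod.intros)

end

text \<open>The functional takes the coefficient of the highest weight vector in the image of that
  vector. Elements of \<nn>_+ kill the vector, those of \<nn>_- map into functions vanishing at the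
  empty word, and toral elements act on it by \<open>lam\<close>.\<close>

lemma (in mp_realization) cartan_functional:
  fixes L :: "('k, ('k, 'n, 'h) mp_elem, 'm) lie_alg_scheme" (structure)
  assumes L: "lie_presentation L (mp_relations A d \<R>)"
    and lam: "Vector_Spaces.linear (scl \<R>) (*) lam"
  obtains \<psi> where "lfun L \<psi>" "\<And>t. \<psi> (mp_gen_class A d \<R> (GT t)) = lam t"
    "\<And>u. u \<in> lie_generated L (range (\<lambda>i. mp_gen_class A d \<R> (GE i))) \<Longrightarrow> \<psi> u = 0"
    "\<And>u. u \<in> lie_generated L (range (\<lambda>i. mp_gen_class A d \<R> (GF i))) \<Longrightarrow> \<psi> u = 0"
proof -
  interpret lie_presentation L "mp_relations A d \<R>" by (rule L)
  interpret dual_verma A d P \<R> lam by (intro dual_verma.intro dual_verma_axioms.intro mp_realization_axioms lam)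
  define \<psi> where "\<psi> X = rep (SOME s. s \<in> X) vac []" for X
  have \<psi>: "\<psi> (cls s) = rep s vac []" for s
    unfolding \<psi>_def using rep_cong[OF lie_cong_some hw_mod.vac] by simp
  show thesis
  proof
    show "lfun L \<psi>"
      unfolding lfun_def by (auto elim!: carrier_cases simp: cls_simps \<psi> plus_fun_apply smul_apply)
    show "\<psi> (mp_gen_class A d \<R> (GT t)) = lam t" for t
      by (simp add: mp_gen_class_def \<psi> top_vac vac_def smul_apply)
    \<comment> \<open>Elements of a generated subalgebra are classes of terms in its generators. Q
      is a property of operators: killing the highest weight vector in the case of the E_i,
      producing functions that vanish at the empty word in the case of the F_i.\<close>
    have lg: "\<exists>s. u = cls s \<and> Q (rep s)"
      if "u \<in> lie_generated L (range (\<lambda>i. cls (LGen (\<gamma> i))))" "Q (\<lambda>f. 0)" "\<And>i. Q (gen_op (\<gamma> i))"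
        "\<And>s t. Q (rep s) \<Longrightarrow> Q (rep t) \<Longrightarrow> Q (\<lambda>f. rep s f + rep t f) \<and> Q (comm_op (rep s) (rep t))"
        "\<And>s a. Q (rep s) \<Longrightarrow> Q (\<lambda>f. smul a (rep s f))"
      for u Q and \<gamma> :: "'n \<Rightarrow> ('n, 'h) mp_gen"
      using that(1)
    proof induction
      case zero
      show ?case by (rule exI[of _ LZero]) (simp add: zero_eq that)
    next
      case (gen u)
      then obtain i where "u = cls (LGen (\<gamma> i))" by blast
      then show ?case using that(3)[of i] by (intro exI[of _ "LGen (\<gamma> i)"]) simp
    next
      case (add u v)
      then obtain s t where "u = cls s" "v = cls t" "Q (rep s)" "Q (rep t)" by blast
      then show ?case using that(4)[of s t] by (intro exI[of _ "LAdd s t"]) (simp add: cls_simps)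
    next
      case (smult u a)
      then obtain s where "u = cls s" "Q (rep s)" by blast
      then show ?case using that(5)[of s a] by (intro exI[of _ "LScale a s"]) (simp add: cls_simps)
    next
      case (bracket u v)
      then obtain s t where "u = cls s" "v = cls t" "Q (rep s)" "Q (rep t)" by blast
      then show ?case using that(4)[of s t] by (intro exI[of _ "LBr s t"]) (simp add: cls_simps)
    qed
    show "\<psi> u = 0" if "u \<in> lie_generated L (range (\<lambda>i. mp_gen_class A d \<R> (GE i)))" for u
    proof -
      from that have "\<exists>s. u = cls s \<and> rep s vac = 0"
        unfolding mp_gen_class_def
        by (rule lg[of u GE "\<lambda>F. F vac = 0"]) (simp_all add: eop_vac comm_op_def rep_zero smul_zero)
      then show ?thesis by (auto simp: \<psi> zero_fun_apply)
    qed
    show "\<psi> u = 0" if "u \<in> lie_generated L (range (\<lambda>i. mp_gen_class A d \<R> (GF i)))" for u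
    proof -
      from that have "\<exists>s. u = cls s \<and> (\<forall>f. rep s f [] = 0)"
        unfolding mp_gen_class_def
        by (rule lg[of u GF "\<lambda>F. \<forall>f. F f [] = 0"]) (simp_all add: fop_def comm_op_def pointwise)
      then show ?thesis by (auto simp: \<psi>)
    qed
  qed
qed

section \<open>The cobracket\<close>

context lie_presentation
begin

lemma minus_smult: "x \<in> carrier L \<Longrightarrow> \<ominus> (a \<odot> x) = (- a) \<odot> x"
  using smult_l_minus[of a x] by simp

lemma cls_funpow: "cls ((LBr s ^^ m) t) = (bracket L (cls s) ^^ m) (cls t)"
  by (induction m) (simp_all flip: cls_bracket)

lemma funpow_bracket_closed: "x \<in> carrier L \<Longrightarrow> y \<in> carrier L \<Longrightarrow> (bracket L x ^^ m) y \<in> carrier L"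
  by (induction m) auto

lemma funpow_bracket_weight:
  assumes "s \<in> carrier L" "e \<in> carrier L" "f \<in> carrier L"
    and "bracket L s e = p \<odot> e" "bracket L s f = q \<odot> f"
  shows "bracket L s ((bracket L e ^^ m) f) = (q + of_nat m * p) \<odot> (bracket L e ^^ m) f"
proof (induction m)
  case (Suc m)
  let ?x = "(bracket L e ^^ m) f"
  have x: "?x \<in> carrier L" using assms by (intro funpow_bracket_closed)
  have "bracket L s (bracket L e ?x) = bracket L (bracket L s e) ?x \<oplus> bracket L e (bracket L s ?x)"
  proof (rule lfun_eqI)
    fix \<psi> assume "lfun L \<psi>"
    then show "\<psi> (bracket L s (bracket L e ?x)) = \<psi> (bracket L (bracket L s e) ?x \<oplus> bracket L e (bracket L s ?x))"
      using assms(1-3) x by (simp add: jacobi_leibniz lfun_simps)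
  qed (use assms x in auto)
  also have "\<dots> = (p + (q + of_nat m * p)) \<odot> bracket L e ?x"
    using assms x Suc by (simp add: bracket_simps smult_simps)
  finally show ?case by (simp add: algebra_simps)
qed (simp add: assms)

text \<open>Iterating the cocycle condition on \<open>ad(e)\<^sup>m f\<close>; the coefficient
  \<open>m (q + r + (m - 1) p)\<close> is the one that vanishes for the Serre exponent.\<close>

lemma coext_serre:
  fixes u v :: 'x
  defines "e \<equiv> cls (LGen u)" and "f \<equiv> cls (LGen v)"
  assumes ST: "S \<in> carrier L" "T \<in> carrier L"
    and \<delta>0: "\<And>x. \<delta>0 x \<in> tensors L 2"
    and u: "\<delta>0 u = Poly_Mapping.single [S, e] 1 - Poly_Mapping.single [e, S] 1"
    and v: "\<delta>0 v = Poly_Mapping.single [T, f] 1 - Poly_Mapping.single [f, T] 1"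
    and br: "bracket L S e = p \<odot> e" "bracket L S f = q \<odot> f" "bracket L T e = r \<odot> e"
    and b: "bilin L b"
  defines "x \<equiv> \<lambda>m. (bracket L e ^^ m) f"
  shows "pair2 b (coext \<delta>0 ((LBr (LGen u) ^^ m) (LGen v))) =
    b (T \<oplus> of_nat m \<odot> S) (x m) - b (x m) (T \<oplus> of_nat m \<odot> S)
    - of_nat m * (q + r + (of_nat m - 1) * p) * (b e (x (m - 1)) - b (x (m - 1)) e)"
  using b
proof (induction m arbitrary: b)
  case 0
  then show ?case using ST by (simp add: v x_def f_def)
next
  case (Suc m)
  have c [simp]: "e \<in> carrier L" "f \<in> carrier L" by (simp_all add: e_def f_def)
  have x [simp]: "x m \<in> carrier L" for m unfolding x_def by (intro funpow_bracket_closed) auto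
  have xS: "bracket L e (x m) = x (Suc m)" for m by (simp add: x_def)
  have eS: "bracket L e S = (- p) \<odot> e" "bracket L e T = (- r) \<odot> e"
    using ST br bracket_antisym[of S e] bracket_antisym[of T e]
    by (simp_all add: minus_smult)
  have xe: "bracket L (x m) e = (- 1) \<odot> x (Suc m)" for m
    using bracket_antisym[of e "x m"] by (simp add: xS smult_minus_one)
  have Sx: "bracket L S (x m) = (q + of_nat m * p) \<odot> x m"
    unfolding x_def using ST br by (intro funpow_bracket_weight) auto
  have xS': "bracket L (x m) S = (- (q + of_nat m * p)) \<odot> x m"
    using bracket_antisym[of S "x m"] ST Sx by (simp add: minus_smult)
  have clsx: "cls ((LBr (LGen u) ^^ m) (LGen v)) = x m"
    by (simp add: cls_funpow x_def e_def f_def)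
  note [simp] = bilin_simps[OF Suc.prems]
  have "pair2 b (coext \<delta>0 ((LBr (LGen u) ^^ Suc m) (LGen v))) =
    pair2 (badj L e b) (coext \<delta>0 ((LBr (LGen u) ^^ m) (LGen v))) - pair2 (badj L (x m) b) (\<delta>0 u)"
    using \<delta>0 by (simp add: pair2_act clsx flip: e_def)
  also have "pair2 (badj L (x m) b) (\<delta>0 u) =
     (q + of_nat m * p) * (b e (x m) - b (x m) e) - (b S (x (Suc m)) - b (x (Suc m)) S)"
    using ST by (simp add: u badj_def xS' xe) (simp add: algebra_simps)
  \<comment> \<open>For m = 0 the truncated index m - 1 is harmless, since the term that contains it
    has coefficient m.\<close>
  also have "pair2 (badj L e b) (coext \<delta>0 ((LBr (LGen u) ^^ m) (LGen v))) =
     b (T \<oplus> of_nat m \<odot> S) (x (Suc m)) - b (x (Suc m)) (T \<oplus> of_nat m \<odot> S)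
     - (r + of_nat m * p) * (b e (x m) - b (x m) e)
     - of_nat m * (q + r + (of_nat m - 1) * p) * (b e (x m) - b (x m) e)"
    unfolding Suc.IH[OF bilin_badj[OF Suc.prems c(1)]]
    using ST by (cases m) (simp_all add: badj_def xS eS bracket_simps bracket_self algebra_simps)
  finally show ?case
    using ST by (simp add: algebra_simps)
qed

end

lemma tensor_eq_cong:
  fixes L :: "('k::field, 'a, 'm) module_scheme" and L' :: "('k, 'a, 'o) module_scheme"
  assumes "carrier L = carrier L'" "add L = add L'" "smult L = smult L'"
  shows "tensor_eq L = tensor_eq L'"
  using assms by (simp add: fun_eq_iff tensor_eq_def multilinear_relators_def)

lemma linear_cocycle_cong:
  fixes L :: "('k::field, 'a, 'm) lie_alg_scheme" and L' :: "('k, 'a, 'o) lie_alg_scheme"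
  assumes "carrier L = carrier L'" "add L = add L'" "smult L = smult L'" "bracket L = bracket L'"
  shows "linear_cocycle L = linear_cocycle L'"
proof -
  have "tensor_eq L = tensor_eq L'"
    by (rule tensor_eq_cong) (simp_all add: assms)
  then show ?thesis
    by (simp add: fun_eq_iff linear_cocycle_def act_def tensors_def assms)
qed

locale mp_lie = mp_realization A d P \<R> + lie_presentation L "mp_relations A d \<R>"
  for A :: "int^'n^'n" and d :: "nat^'n" and P :: "'k::field_char_0^'n^'n"
    and \<R> :: "('k, 'n, 'h::ab_group_add) realization_data"
    and L :: "('k, ('k, 'n, 'h) mp_elem, 'm) lie_alg_scheme" (structure)
begin

abbreviation gT :: "'h \<Rightarrow> ('k, 'n, 'h) mp_elem" where "gT t \<equiv> mp_gen_class A d \<R> (GT t)"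
abbreviation gE :: "'n \<Rightarrow> ('k, 'n, 'h) mp_elem" where "gE i \<equiv> mp_gen_class A d \<R> (GE i)"
abbreviation gF :: "'n \<Rightarrow> ('k, 'n, 'h) mp_elem" where "gF i \<equiv> mp_gen_class A d \<R> (GF i)"

lemma gen_closed [simp]: "mp_gen_class A d \<R> g \<in> carrier L"
  by (simp add: mp_gen_class_def)

lemma cls_rel: "(s, t) \<in> mp_relations A d \<R> \<Longrightarrow> cls s = cls t"
  by (simp add: term_class_eq_iff lie_cong.rel)

lemma gT_add: "gT (s + t) = gT s \<oplus> gT t"
  and gT_scl: "gT (scl \<R> c t) = c \<odot> gT t"
  and bracket_TT: "bracket L (gT s) (gT t) = \<zero>"
  and bracket_TE: "bracket L (gT t) (gE j) = alpha j t \<odot> gE j"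
  and bracket_TF: "bracket L (gT t) (gF j) = (- alpha j t) \<odot> gF j"
  and bracket_EF: "bracket L (gE i) (gF i) = (1 / (2 * of_nat (d $ i))) \<odot> (gT (Tp \<R> i) \<oplus> gT (Tm \<R> i))"
  and bracket_EF': "i \<noteq> j \<Longrightarrow> bracket L (gE i) (gF j) = \<zero>"
  unfolding mp_gen_class_def cls_simps
  by (rule cls_rel; auto simp: mp_relations_def)+

lemma serre_E: "i \<noteq> j \<Longrightarrow> (bracket L (gE i) ^^ nat (1 - A $ i $ j)) (gE j) = \<zero>"
  and serre_F: "i \<noteq> j \<Longrightarrow> (bracket L (gF i) ^^ nat (1 - A $ i $ j)) (gF j) = \<zero>"
  unfolding mp_gen_class_def cls_funpow[symmetric] zero_eq
  by (rule cls_rel; auto simp: mp_relations_def)+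

lemma bracket_ET: "bracket L (gE j) (gT t) = (- alpha j t) \<odot> gE j"
  and bracket_FT: "bracket L (gF j) (gT t) = alpha j t \<odot> gF j"
  using bracket_antisym[of "gT t" "gE j"] bracket_antisym[of "gT t" "gF j"]
  by (simp_all add: bracket_TE bracket_TF minus_smult)

lemma bracket_FE: "bracket L (gF i) (gE j) = (- 1) \<odot> bracket L (gE j) (gF i)"
  using bracket_antisym[of "gE j" "gF i"] by (simp add: smult_minus_one)

primrec delta0 :: "('n, 'h) mp_gen \<Rightarrow> (('k, 'n, 'h) mp_elem list \<Rightarrow>\<^sub>0 'k)" where
  "delta0 (GT t) = 0"
| "delta0 (GE i) = Poly_Mapping.single [gT (Tp \<R> i), gE i] 1 - Poly_Mapping.single [gE i, gT (Tp \<R> i)] 1"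
| "delta0 (GF i) = Poly_Mapping.single [gT (Tm \<R> i), gF i] 1 - Poly_Mapping.single [gF i, gT (Tm \<R> i)] 1"

lemma delta0_tensors [simp]: "delta0 g \<in> tensors L 2"
  by (cases g) (auto intro!: tensors_diff tensors_single)

text \<open>The last factor in \<open>coext_serre\<close> at the exponent 1 - a_ij: with p_ii = 2
  d_i and p_ij + p_ji = 2 d_i a_ij the two contributions are opposite.\<close>

lemma serre_coefficient:
  assumes "i \<noteq> j"
  shows "P $ i $ j + P $ j $ i + (of_nat (nat (1 - A $ i $ j)) - 1) * P $ i $ i = 0"
proof -
  have "(of_nat (nat (1 - A $ i $ j)) - 1 :: 'k) = - of_int (A $ i $ j)"
    using A_nonpos[OF assms] by (simp add: of_nat_nat)
  moreover have "P $ i $ i = 2 * of_nat (d $ i)"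
    using P_sum[of i i] A_diag[of i] by simp
  ultimately show ?thesis using P_sum[of i j] by (simp add: mult.assoc)
qed

lemma coext_relation:
  assumes b: "bilin L b" and st: "(s, t) \<in> mp_relations A d \<R>"
  shows "pair2 b (coext delta0 s) = pair2 b (coext delta0 t)"
proof -
  note gc = mp_gen_class_def[of A d \<R>, symmetric]
  have E: "pair2 b (coext delta0 ((LBr (LGen (GE i)) ^^ nat (1 - A $ i $ j)) (LGen (GE j)))) = 0"
    if "i \<noteq> j" for i j
    using coext_serre[of "gT (Tp \<R> i)" "gT (Tp \<R> j)" delta0 "GE i" "GE j" "P $ i $ i" "P $ i $ j" "P $ j $ i" b]
      b serre_coefficient[OF that] serre_E[OF that]
    by (simp add: gc bracket_TE bilin_simps[OF b])
  have F: "pair2 b (coext delta0 ((LBr (LGen (GF i)) ^^ nat (1 - A $ i $ j)) (LGen (GF j)))) = 0"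
    if "i \<noteq> j" for i j
  proof -
    have "- P $ j $ i + - P $ i $ j + (of_nat (nat (1 - A $ i $ j)) - 1) * - P $ i $ i = 0"
      using serre_coefficient[OF that] by (simp add: algebra_simps)
    then show ?thesis
      using coext_serre[of "gT (Tm \<R> i)" "gT (Tm \<R> j)" delta0 "GF i" "GF j" "- P $ i $ i" "- P $ j $ i" "- P $ i $ j" b]
        b serre_F[OF that]
      by (simp add: gc bracket_TF bilin_simps[OF b])
  qed
  \<comment> \<open>Since the prescribed cobracket vanishes on toral elements, the relation for
    [E_i, F_j] requires these two actions to agree. The mixed terms match because \<alpha>_i(T_j^-)
    and \<alpha>_j(T_i^+) are both p_ij; for i = j the toral terms match because [E_i, F_i] is a
    multiple of T_i^+ + T_i^-.\<close>
  have EF: "pair2 (badj L (gE i) b) (delta0 (GF j)) = pair2 (badj L (gF j) b) (delta0 (GE i))" for i j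
    by (cases "i = j")
      (simp_all add: badj_def bracket_ET bracket_FT bracket_FE bracket_EF bracket_EF' bilin_simps[OF b] algebra_simps)
  show ?thesis
    using st[unfolded mp_relations_def]
    by (elim UnE CollectE exE conjE)
      (auto simp: pair2_act gc E F EF simp del: delta0.simps(2,3),
       auto simp: badj_def bracket_TT bracket_TE bracket_TF bracket_ET bracket_FT bilin_simps[OF b] algebra_simps)
qed

lemma cobracket_exists:
  obtains \<delta> where "linear_cocycle L \<delta>" "\<And>g. tensor_eq L (\<delta> (mp_gen_class A d \<R> g)) (delta0 g)"
  using linear_cocycle_extension[of delta0] coext_relation
  unfolding mp_gen_class_def by (metis delta0_tensors)

end

section \<open>Triangular decomposition\<close>

lemma (in lie_algebra) lie_generated_closed:
  assumes "X \<subseteq> carrier L" "x \<in> lie_generated L X"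
  shows "x \<in> carrier L"
  using assms(2) by induction (use assms(1) in auto)

lemma (in lie_algebra) lie_generated_minus:
  assumes "X \<subseteq> carrier L" "x \<in> lie_generated L X"
  shows "\<ominus> x \<in> lie_generated L X"
  using lie_generated.smult[OF assms(2), of "- 1"] lie_generated_closed[OF assms]
  by (simp add: smult_minus_one)

lemma mplba_simps:
  "carrier (mplba A d \<R>) = carrier (mp_lie_alg A d \<R>)"
  "zero (mplba A d \<R>) = zero (mp_lie_alg A d \<R>)"
  "add (mplba A d \<R>) = add (mp_lie_alg A d \<R>)"
  "smult (mplba A d \<R>) = smult (mp_lie_alg A d \<R>)"
  "bracket (mplba A d \<R>) = bracket (mp_lie_alg A d \<R>)"
  "cobracket (mplba A d \<R>) = (SOME \<delta>. is_mp_cobracket A d \<R> \<delta>)"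
  by (simp_all add: mplba_def lie_alg.defs lie_bialg.defs)

lemma lie_presentation_mplba: "lie_presentation (mplba A d \<R>) (mp_relations A d \<R>)"
  by unfold_locales (simp_all add: mplba_simps mp_lie_alg_def presented_lie_alg_def)

lemma tensor_eq_mplba: "tensor_eq (mp_lie_alg A d \<R>) = tensor_eq (mplba A d \<R>)"
  by (rule tensor_eq_cong) (simp_all add: mplba_simps)

lemma linear_cocycle_mplba: "linear_cocycle (mp_lie_alg A d \<R>) = linear_cocycle (mplba A d \<R>)"
  by (rule linear_cocycle_cong) (simp_all add: mplba_simps)

locale mp_bialg = mp_realization A d P \<R>
  for A :: "int^'n^'n" and d :: "nat^'n" and P :: "'k::field_char_0^'n^'n"
    and \<R> :: "('k, 'n, 'h::ab_group_add) realization_data" +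
  fixes L :: "('k, ('k, 'n, 'h) mp_elem) lie_bialg" (structure)
  defines L_def: "L \<equiv> mplba A d \<R>"
begin

lemma lie_presentation_L: "lie_presentation L (mp_relations A d \<R>)"
  unfolding L_def by (rule lie_presentation_mplba)

sublocale mp_lie A d P \<R> L
  by (intro mp_lie.intro mp_realization_axioms lie_presentation_L)

lemma is_mp_cobracket_iff:
  "is_mp_cobracket A d \<R> \<delta> \<longleftrightarrow> linear_cocycle L \<delta> \<and>
    (\<forall>g. tensor_eq L (\<delta> (mp_gen_class A d \<R> g)) (delta0 g))"
proof -
  have "(\<forall>g. tensor_eq L (\<delta> (mp_gen_class A d \<R> g)) (delta0 g)) \<longleftrightarrow>
     (\<forall>t. tensor_eq L (\<delta> (gT t)) (delta0 (GT t))) \<and> (\<forall>i. tensor_eq L (\<delta> (gE i)) (delta0 (GE i))) \<and>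
     (\<forall>i. tensor_eq L (\<delta> (gF i)) (delta0 (GF i)))"
    by (metis mp_gen.exhaust)
  then show ?thesis
    by (simp add: is_mp_cobracket_def Let_def linear_cocycle_mplba tensor_eq_mplba flip: L_def)
qed

text \<open>The cobracket is selected by \<open>SOME\<close>, so all knowledge about it comes from
  these two facts, which rest on \<open>cobracket_exists\<close>.\<close>

lemma cobracket_L: "linear_cocycle L (cobracket L)"
  "tensor_eq L (cobracket L (mp_gen_class A d \<R> g)) (delta0 g)"
proof -
  obtain \<delta> where "is_mp_cobracket A d \<R> \<delta>"
    using cobracket_exists unfolding is_mp_cobracket_iff by blast
  then have "is_mp_cobracket A d \<R> (SOME \<delta>. is_mp_cobracket A d \<R> \<delta>)" 
    by (rule someI[of "is_mp_cobracket A d \<R>"])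
  then have "is_mp_cobracket A d \<R> (cobracket L)" unfolding L_def by (simp add: mplba_simps)
  then show "linear_cocycle L (cobracket L)"
    "tensor_eq L (cobracket L (mp_gen_class A d \<R> g)) (delta0 g)"
    unfolding is_mp_cobracket_iff by blast+
qed

sublocale lie_coalgebra_cocycle L "cobracket L"
  by unfold_locales (rule cobracket_L)

lemma pair2_gen: "bilin L b \<Longrightarrow> pair2 b (cobracket L (mp_gen_class A d \<R> g)) = pair2 b (delta0 g)"
  using cobracket_L(2)[of g] by (subst (asm) tensor_eq2_iff) auto

lemma generators: "range (mp_gen_class A d \<R>) \<subseteq> carrier L"
  "carrier L \<subseteq> lie_generated L (range (mp_gen_class A d \<R>))"
proof -
  have "mp_gen_class A d \<R> = (\<lambda>g. cls (LGen g))" by (simp add: fun_eq_iff mp_gen_class_def)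
  then show "carrier L \<subseteq> lie_generated L (range (mp_gen_class A d \<R>))"
    using carrier_generated by simp
qed auto

lemma cobracket_antisym':
  assumes "bilin L b" "x \<in> carrier L"
  shows "pair2 (\<lambda>p q. b q p) (cobracket L x) = - pair2 b (cobracket L x)"
proof (rule antisym_generated[OF generators _ assms])
  fix b x assume b: "bilin L b" and "x \<in> range (mp_gen_class A d \<R>)"
  then obtain g where "x = mp_gen_class A d \<R> g" by blast
  then show "pair2 b (cobracket L x) + pair2 (\<lambda>p q. b q p) (cobracket L x) = 0"
    using b bilin_flip[OF b] by (cases g) (simp_all add: pair2_gen)
qed

lemma cobracket_cojac:
  assumes \<tau>: "trilin L \<tau>" "\<And>p q r. p \<in> carrier L \<Longrightarrow> q \<in> carrier L \<Longrightarrow> r \<in> carrier L \<Longrightarrow> \<tau> q r p = \<tau> p q r"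
    and "x \<in> carrier L"
  shows "cojac \<tau> x = 0"
proof (rule cojac_generated[OF generators cobracket_antisym' _ assms])
  fix \<tau> :: "('k, 'n, 'h) mp_elem \<Rightarrow> _" and x
  assume \<tau>: "trilin L \<tau>" and
    cyc: "\<And>p q r. p \<in> carrier L \<Longrightarrow> q \<in> carrier L \<Longrightarrow> r \<in> carrier L \<Longrightarrow> \<tau> q r p = \<tau> p q r"
    and "x \<in> range (mp_gen_class A d \<R>)"
  then obtain g where "x = mp_gen_class A d \<R> g" by blast
  \<comment> \<open>(\<delta> \<otimes> id) \<delta>(E_i) consists of E \<otimes> T \<otimes> T and,
    with the opposite sign, T \<otimes> E \<otimes> T; the two are rotations of each other. The same
    holds for F_i.\<close>
  then show "cojac \<tau> x = 0"
    using \<tau> cyc[of "gT _" "gE _" "gT _"] cyc[of "gT _" "gF _" "gT _"]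
    by (cases g) (simp_all add: cojac_def pair2_gen bilin_cojac trilinD(3))
qed auto

lemma lie_bialgebra_L: "lie_bialgebra L"
proof
  fix x assume x: "x \<in> carrier L"
  show "tensor_eq L (cobracket L x + word_map rev (cobracket L x)) 0"
    using cobracket_antisym' x by (intro tensor_eq_antisym)
  show "tensor_eq L (cobracket2 L x + word_map rotate1 (cobracket2 L x)
      + word_map (rotate1 \<circ> rotate1) (cobracket2 L x)) 0"
    unfolding cobracket2_def
    by (rule tensor_eq_cojacobi[OF _ x], rule cobracket_cojac[OF _ _ x])
qed (rule cobracket_L)

abbreviation nplus :: "('k, 'n, 'h) mp_elem set" where "nplus \<equiv> lie_generated L (range gE)"
abbreviation nminus :: "('k, 'n, 'h) mp_elem set" where "nminus \<equiv> lie_generated L (range gF)"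
abbreviation proj :: "('k, 'n, 'h) mp_elem \<Rightarrow> 'h" where "proj \<equiv> cartan_projection A d \<R>"

lemma n_closed: "u \<in> nplus \<Longrightarrow> u \<in> carrier L" "u \<in> nminus \<Longrightarrow> u \<in> carrier L"
  by (auto intro: lie_generated_closed[rotated])

lemma gE_nplus: "gE i \<in> nplus" and gF_nminus: "gF i \<in> nminus"
  by (auto intro: lie_generated.gen)

lemma gT_zero: "gT 0 = \<zero>"
proof -
  interpret h: vector_space "scl \<R>" by (rule vector_space_scl)
  show ?thesis using gT_scl[of 0 0] by simp
qed

text \<open>For each linear functional on \<open>\<hh>\<close> there is one on the Lie algebra that extends it by zero;
  hence the sum of the three summands is direct and \<open>\<hh>\<close> embeds.\<close>

lemma proj_eq:
  assumes "u \<in> nplus" "v \<in> nminus"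
  shows "proj (u \<oplus> gT t \<oplus> v) = t"
  unfolding cartan_projection_def n_plus_def n_minus_def L_def[symmetric]
proof (rule the_equality)
  show "\<exists>u'\<in>nplus. \<exists>v'\<in>nminus. u \<oplus> gT t \<oplus> v = u' \<oplus> gT t \<oplus> v'" using assms by blast
next
  fix t' assume "\<exists>u'\<in>nplus. \<exists>v'\<in>nminus. u \<oplus> gT t \<oplus> v = u' \<oplus> gT t' \<oplus> v'"
  then obtain u' v' where uv': "u' \<in> nplus" "v' \<in> nminus" "u \<oplus> gT t \<oplus> v = u' \<oplus> gT t' \<oplus> v'" by blast
  interpret h: vector_space "scl \<R>" by (rule vector_space_scl)
  have "lam t = lam t'" if lam: "Vector_Spaces.linear (scl \<R>) (*) lam" for lam
  proof -
    obtain \<psi> where \<psi>: "lfun L \<psi>" "\<And>t. \<psi> (gT t) = lam t" "\<And>u. u \<in> nplus \<Longrightarrow> \<psi> u = 0"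
      "\<And>u. u \<in> nminus \<Longrightarrow> \<psi> u = 0"
      using cartan_functional[OF lie_presentation_L lam] by blast
    have "\<psi> (u \<oplus> gT t \<oplus> v) = \<psi> (u' \<oplus> gT t' \<oplus> v')" using uv' by simp
    then show ?thesis using assms uv'(1,2) \<psi>(2-4) by (simp add: lfun_add[OF \<psi>(1)] n_closed)
  qed
  then have "t' - t \<in> h.span {}"
    unfolding h.in_span_iff_functionals
    by (metis (no_types, lifting) Vector_Spaces.linear_iff_module_hom module_hom.diff right_minus_eq)
  then show "t' = t" by simp
qed

section \<open>The three summands span the Lie algebra\<close>

lemma carrier_induct [consumes 1, case_names generator zero add smult bracket]:
  assumes "x \<in> carrier L" "\<And>g. Q (mp_gen_class A d \<R> g)" "Q \<zero>"
    "\<And>x y. x \<in> carrier L \<Longrightarrow> y \<in> carrier L \<Longrightarrow> Q x \<Longrightarrow> Q y \<Longrightarrow> Q (x \<oplus> y)"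
    "\<And>x a. x \<in> carrier L \<Longrightarrow> Q x \<Longrightarrow> Q (a \<odot> x)"
    "\<And>x y. x \<in> carrier L \<Longrightarrow> y \<in> carrier L \<Longrightarrow> Q x \<Longrightarrow> Q y \<Longrightarrow> Q (bracket L x y)"
  shows "Q x"
proof -
  from assms(1) have "x \<in> lie_generated L (range (mp_gen_class A d \<R>))" using generators by blast
  then have "x \<in> carrier L \<and> Q x"
    by induction (use assms in auto)
  then show ?thesis by blast
qed

lemma derivation:
  assumes "x \<in> carrier L" "y \<in> carrier L" "z \<in> carrier L"
  shows "bracket L x (bracket L y z) = bracket L (bracket L x y) z \<oplus> bracket L y (bracket L x z)"
  by (rule lfun_eqI) (use assms in \<open>auto simp: jacobi_leibniz lfun_simps\<close>)

lemma bracket_T_nplus: "u \<in> nplus \<Longrightarrow> bracket L (gT t) u \<in> nplus"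
proof (induction rule: lie_generated.induct)
  case (gen x)
  then obtain i where "x = gE i" by blast
  then show ?case by (simp add: bracket_TE lie_generated.smult[OF gE_nplus])
next
  case (bracket x y)
  then show ?case
    by (simp add: derivation[of "gT t" x y] n_closed lie_generated.add lie_generated.bracket)
qed (auto simp: bracket_simps n_closed intro: lie_generated.intros)

lemma bracket_T_nminus: "u \<in> nminus \<Longrightarrow> bracket L (gT t) u \<in> nminus"
proof (induction rule: lie_generated.induct)
  case (gen x)
  then obtain i where "x = gF i" by blast
  then show ?case by (simp add: bracket_TF lie_generated.smult[OF gF_nminus])
next
  case (bracket x y)
  then show ?case
    by (simp add: derivation[of "gT t" x y] n_closed lie_generated.add lie_generated.bracket)
qed (auto simp: bracket_simps n_closed intro: lie_generated.intros)

lemma bracket_nplus_T: "u \<in> nplus \<Longrightarrow> bracket L u (gT t) \<in> nplus"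
  using bracket_T_nplus[of u t] lie_generated_minus[of "range gE" "bracket L (gT t) u"]
  by (simp add: bracket_antisym[of "gT t" u] n_closed image_subset_iff)

lemma bracket_nminus_T: "u \<in> nminus \<Longrightarrow> bracket L u (gT t) \<in> nminus"
  using bracket_T_nminus[of u t] lie_generated_minus[of "range gF" "bracket L (gT t) u"]
  by (simp add: bracket_antisym[of "gT t" u] n_closed image_subset_iff)

abbreviation Sspan :: "'h set" where
  "Sspan \<equiv> module.span (scl \<R>) (range (\<lambda>i. Tp \<R> i + Tm \<R> i))"

lemma Sspan: "0 \<in> Sspan" "s \<in> Sspan \<Longrightarrow> t \<in> Sspan \<Longrightarrow> s + t \<in> Sspan"
  "s \<in> Sspan \<Longrightarrow> scl \<R> a s \<in> Sspan" "Tp \<R> i + Tm \<R> i \<in> Sspan"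
proof -
  interpret h: vector_space "scl \<R>" by (rule vector_space_scl)
  show "0 \<in> Sspan" "s \<in> Sspan \<Longrightarrow> t \<in> Sspan \<Longrightarrow> s + t \<in> Sspan"
    "s \<in> Sspan \<Longrightarrow> scl \<R> a s \<in> Sspan" "Tp \<R> i + Tm \<R> i \<in> Sspan"
    by (auto intro: h.span_zero h.span_add h.span_scale h.span_base)
qed

text \<open>By [e, [x, y]] = [[e, x], y] + [x, [e, y]] a toral part of [e, x] only acts on y, which
  stays in the subalgebra; toral terms thus originate from generators alone. That they lie in
  \<open>Sspan\<close> is recorded for \<open>proj_bracket\<close>.\<close>

lemma bracket_lie_generated:
  assumes e: "e \<in> carrier L" and X: "X \<subseteq> carrier L"
    and gen: "\<And>x. x \<in> X \<Longrightarrow> \<exists>t\<in>Sspan. bracket L e x = gT t"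
    and T: "\<And>u t. u \<in> lie_generated L X \<Longrightarrow> bracket L (gT t) u \<in> lie_generated L X"
      "\<And>u t. u \<in> lie_generated L X \<Longrightarrow> bracket L u (gT t) \<in> lie_generated L X"
    and v: "v \<in> lie_generated L X"
  shows "\<exists>t\<in>Sspan. \<exists>w\<in>lie_generated L X. bracket L e v = gT t \<oplus> w"
  using v
proof induction
  case zero
  show ?case
    by (rule bexI[OF _ Sspan(1)], rule bexI[OF _ lie_generated.zero]) (simp add: gT_zero e)
next
  case (gen x)
  then obtain t where "t \<in> Sspan" "bracket L e x = gT t" using assms(3) by blast
  then show ?case by (intro bexI[of _ t] bexI[OF _ lie_generated.zero]) simp_all
next
  case (add x y)
  then obtain t w t' w' where S: "t \<in> Sspan" "t' \<in> Sspan" and *: "w \<in> lie_generated L X"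
    "bracket L e x = gT t \<oplus> w" "w' \<in> lie_generated L X" "bracket L e y = gT t' \<oplus> w'" by blast
  then show ?case using add e lie_generated_closed[OF X]
    by (intro bexI[OF _ Sspan(2)[OF S]] bexI[OF _ lie_generated.add[OF *(1,3)]])
      (simp add: bracket_simps gT_add a_ac)
next
  case (smult x a)
  then obtain t w where S: "t \<in> Sspan" and *: "w \<in> lie_generated L X" "bracket L e x = gT t \<oplus> w" by blast
  then show ?case using smult e lie_generated_closed[OF X]
    by (intro bexI[OF _ Sspan(3)[OF S, of a]] bexI[OF _ lie_generated.smult[OF *(1), of a]])
      (simp add: bracket_simps gT_scl smult_simps)
next
  case (bracket x y)
  then obtain t w t' w' where *: "w \<in> lie_generated L X" "bracket L e x = gT t \<oplus> w"
    "w' \<in> lie_generated L X" "bracket L e y = gT t' \<oplus> w'" by blast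
  let ?w = "(bracket L (gT t) y \<oplus> bracket L w y) \<oplus> (bracket L x (gT t') \<oplus> bracket L x w')"
  have "bracket L e (bracket L x y) = gT 0 \<oplus> ?w"
    using * bracket e lie_generated_closed[OF X] by (simp add: derivation bracket_simps gT_zero)
  moreover have "?w \<in> lie_generated L X"
    using * bracket by (intro lie_generated.add lie_generated.bracket T)
  ultimately show ?case using Sspan(1) by blast
qed

lemma bracket_EF_Sspan:
  "\<exists>t\<in>Sspan. bracket L (gE i) (gF j) = gT t" "\<exists>t\<in>Sspan. bracket L (gF j) (gE i) = gT t"
proof -
  obtain t where t: "t \<in> Sspan" "bracket L (gE i) (gF j) = gT t"
  proof (cases "i = j")
    case True
    then show thesis
      using that[OF Sspan(3)[OF Sspan(4), of "1 / (2 * of_nat (d $ i))" i]]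
      by (simp add: bracket_EF gT_scl gT_add)
  next
    case False
    then show thesis using that[OF Sspan(1)] by (simp add: bracket_EF' gT_zero)
  qed
  then show "\<exists>t\<in>Sspan. bracket L (gE i) (gF j) = gT t" by blast
  show "\<exists>t\<in>Sspan. bracket L (gF j) (gE i) = gT t"
    using t by (intro bexI[OF _ Sspan(3)[OF t(1), of "- 1"]]) (simp add: bracket_FE gT_scl)
qed

lemma bracket_E_nminus: "v \<in> nminus \<Longrightarrow> \<exists>t\<in>Sspan. \<exists>w\<in>nminus. bracket L (gE i) v = gT t \<oplus> w"
  by (rule bracket_lie_generated[OF _ _ _ bracket_T_nminus bracket_nminus_T]) (auto intro: bracket_EF_Sspan)

lemma bracket_F_nplus: "v \<in> nplus \<Longrightarrow> \<exists>t\<in>Sspan. \<exists>w\<in>nplus. bracket L (gF i) v = gT t \<oplus> w"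
  by (rule bracket_lie_generated[OF _ _ _ bracket_T_nplus bracket_nplus_T]) (auto intro: bracket_EF_Sspan)

text \<open>The sum V of the three summands is stable under all generators. By the Jacobi identity
  its stabiliser is closed under brackets, so V is an ideal; it contains the generators and is
  therefore everything.\<close>

lemma decomposition:
  assumes "x \<in> carrier L"
  obtains u t v where "u \<in> nplus" "v \<in> nminus" "x = u \<oplus> gT t \<oplus> v"
proof -
  define V where "V = {u \<oplus> gT t \<oplus> v |u t v. u \<in> nplus \<and> v \<in> nminus}"
  have V_closed: "y \<in> carrier L" if "y \<in> V" for y
    using that by (auto simp: V_def n_closed)
  have V_add: "y \<oplus> z \<in> V" if y: "y \<in> V" and z: "z \<in> V" for y z
  proof -
    from y z obtain u t v u' t' v' where *: "u \<in> nplus" "v \<in> nminus" "y = u \<oplus> gT t \<oplus> v"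
      "u' \<in> nplus" "v' \<in> nminus" "z = u' \<oplus> gT t' \<oplus> v'" unfolding V_def by blast
    then have "y \<oplus> z = (u \<oplus> u') \<oplus> gT (t + t') \<oplus> (v \<oplus> v')"
      by (simp add: n_closed gT_add a_ac)
    then show ?thesis using * unfolding V_def by (blast intro: lie_generated.add)
  qed
  have V_smult: "a \<odot> y \<in> V" if y: "y \<in> V" for y a
  proof -
    from y obtain u t v where *: "u \<in> nplus" "v \<in> nminus" "y = u \<oplus> gT t \<oplus> v" unfolding V_def by blast
    then have "a \<odot> y = a \<odot> u \<oplus> gT (scl \<R> a t) \<oplus> a \<odot> v"
      by (simp add: n_closed gT_scl smult_simps)
    then show ?thesis using * unfolding V_def by (blast intro: lie_generated.smult)
  qed
  have V_plus: "u \<in> V" if "u \<in> nplus" for u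
    unfolding V_def using that
    by (intro CollectI exI[of _ u] exI[of _ 0] exI[of _ "\<zero>"]) (auto simp: gT_zero n_closed lie_generated.zero)
  have V_minus: "u \<in> V" if "u \<in> nminus" for u
    unfolding V_def using that
    by (intro CollectI exI[of _ u] exI[of _ 0] exI[of _ "\<zero>"]) (auto simp: gT_zero n_closed lie_generated.zero)
  have V_T: "gT t \<in> V" for t
    unfolding V_def
    by (intro CollectI exI[of _ t] exI[of _ "\<zero>"]) (auto simp: lie_generated.zero)
  have gen: "bracket L g y \<in> V" if g: "g \<in> range (mp_gen_class A d \<R>)" and y: "y \<in> V" for g y
  proof -
    from y obtain u t v where *: "u \<in> nplus" "v \<in> nminus" "y = u \<oplus> gT t \<oplus> v" unfolding V_def by blast
    have "bracket L g y = bracket L g u \<oplus> bracket L g (gT t) \<oplus> bracket L g v"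
      using * g by (auto simp: n_closed bracket_simps)
    moreover have "bracket L g u \<in> V \<and> bracket L g (gT t) \<in> V \<and> bracket L g v \<in> V"
    proof -
      from g obtain x where x: "g = mp_gen_class A d \<R> x" by blast
      show ?thesis
      proof (cases x)
        case (GT s)
        have "\<zero> \<in> nplus" by (rule lie_generated.zero)
        then show ?thesis
          using * by (simp add: x GT bracket_TT V_plus V_minus bracket_T_nplus bracket_T_nminus)
      next
        case (GE i)
        obtain t' w where w: "w \<in> nminus" "bracket L (gE i) v = gT t' \<oplus> w"
          using bracket_E_nminus[OF *(2)] by blast
        then have "bracket L (gE i) v \<in> V" by (simp add: V_add V_T V_minus)
        moreover have gi: "gE i \<in> nplus" by (blast intro: lie_generated.gen)
        then have "bracket L (gE i) u \<in> V" using * by (intro V_plus lie_generated.bracket)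
        moreover have "bracket L (gE i) (gT t) \<in> V" using gi by (intro V_plus bracket_nplus_T)
        ultimately show ?thesis by (simp add: x GE)
      next
        case (GF i)
        obtain t' w where w: "w \<in> nplus" "bracket L (gF i) u = gT t' \<oplus> w"
          using bracket_F_nplus[OF *(1)] by blast
        then have "bracket L (gF i) u \<in> V" by (simp add: V_add V_T V_plus)
        moreover have gi: "gF i \<in> nminus" by (blast intro: lie_generated.gen)
        then have "bracket L (gF i) v \<in> V" using * by (intro V_minus lie_generated.bracket)
        moreover have "bracket L (gF i) (gT t) \<in> V" using gi by (intro V_minus bracket_nminus_T)
        ultimately show ?thesis by (simp add: x GF)
      qed
    qed
    ultimately show ?thesis by (simp add: V_add)
  qed
  have V_zero: "\<zero> \<in> V" by (rule V_plus[OF lie_generated.zero])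
  have ideal: "\<forall>y\<in>V. bracket L z y \<in> V" if "z \<in> carrier L" for z
    using that
  proof (induction rule: carrier_induct)
    case (generator g)
    then show ?case using gen by blast
  next
    case (bracket z w)
    show ?case
    proof
      fix y assume y: "y \<in> V"
      have "bracket L (bracket L z w) y =
          bracket L z (bracket L w y) \<oplus> (- 1) \<odot> bracket L w (bracket L z y)"
        using bracket V_closed[OF y] by (simp add: jacobi_leibniz minus_eq smult_minus_one)
      then show "bracket L (bracket L z w) y \<in> V" using bracket.IH y by (simp add: V_add V_smult)
    qed
  qed (simp_all add: V_zero V_closed V_add V_smult bracket_simps)
  have "x \<in> V"
    using assms
  proof (induction rule: carrier_induct)
    case (generator g)
    show ?case
      by (cases g) (simp_all add: V_T V_plus[OF gE_nplus] V_minus[OF gF_nminus])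
  next
    case (bracket z w)
    then show ?case using ideal by blast
  qed (auto intro: V_zero V_add V_smult)
  then show thesis using that unfolding V_def by blast
qed

section \<open>The projection onto the Cartan part\<close>

lemma proj_add: "x \<in> carrier L \<Longrightarrow> y \<in> carrier L \<Longrightarrow> proj (x \<oplus> y) = proj x + proj y"
  and proj_smult: "x \<in> carrier L \<Longrightarrow> proj (a \<odot> x) = scl \<R> a (proj x)"
proof -
  assume x: "x \<in> carrier L"
  obtain u t v where *: "u \<in> nplus" "v \<in> nminus" "x = u \<oplus> gT t \<oplus> v" using decomposition[OF x] .
  then have "a \<odot> x = a \<odot> u \<oplus> gT (scl \<R> a t) \<oplus> a \<odot> v"
    by (simp add: n_closed gT_scl smult_simps)
  then show "proj (a \<odot> x) = scl \<R> a (proj x)"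
    using * by (simp add: proj_eq lie_generated.smult)
  assume y: "y \<in> carrier L"
  obtain u' t' v' where **: "u' \<in> nplus" "v' \<in> nminus" "y = u' \<oplus> gT t' \<oplus> v'" using decomposition[OF y] .
  then have "x \<oplus> y = (u \<oplus> u') \<oplus> gT (t + t') \<oplus> (v \<oplus> v')"
    using * by (simp add: n_closed gT_add a_ac)
  then show "proj (x \<oplus> y) = proj x + proj y"
    using * ** by (simp add: proj_eq lie_generated.add)
qed

lemma proj_T [simp]: "proj (gT t) = t"
  and proj_nplus: "u \<in> nplus \<Longrightarrow> proj u = 0"
  and proj_nminus: "u \<in> nminus \<Longrightarrow> proj u = 0"
proof -
  have z: "\<zero> \<in> nplus" "\<zero> \<in> nminus" by (rule lie_generated.zero)+
  show "proj (gT t) = t" using proj_eq[OF z] by simp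
  show "u \<in> nplus \<Longrightarrow> proj u = 0" using proj_eq[of u "\<zero>" 0] z by (simp add: gT_zero n_closed)
  show "u \<in> nminus \<Longrightarrow> proj u = 0" using proj_eq[of "\<zero>" u 0] z by (simp add: gT_zero n_closed)
qed

text \<open>Toral terms in a bracket come only from the [E_i, F_i]. This is what lets the condition
  in \<open>Alt_S\<close> take effect: such forms do not see the Cartan part of a bracket. As in
  \<open>decomposition\<close>, the brackets in the first argument are resolved by the Jacobi
  identity.\<close>

lemma proj_bracket:
  assumes "x \<in> carrier L" "y \<in> carrier L"
  shows "proj (bracket L x y) \<in> Sspan"
proof -
  have "\<forall>y\<in>carrier L. proj (bracket L x y) \<in> Sspan"
    using assms(1)
  proof (induction rule: carrier_induct)
    case (generator g)
    show ?case
    proof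
      fix y assume "y \<in> carrier L"
      then obtain u t v where *: "u \<in> nplus" "v \<in> nminus" "y = u \<oplus> gT t \<oplus> v" using decomposition by blast
      let ?b = "bracket L (mp_gen_class A d \<R> g)"
      have "proj (?b y) = proj (?b u) + proj (?b (gT t)) + proj (?b v)"
        using * by (simp add: n_closed bracket_simps proj_add)
      moreover have "proj (?b u) \<in> Sspan \<and> proj (?b (gT t)) \<in> Sspan \<and> proj (?b v) \<in> Sspan"
      proof (cases g)
        case (GT s)
        have "proj \<zero> = 0" by (rule proj_nplus[OF lie_generated.zero])
        then show ?thesis using * GT Sspan(1)
          by (simp add: bracket_TT proj_nplus bracket_T_nplus proj_nminus bracket_T_nminus)
      next
        case (GE i)
        obtain t' w where w: "t' \<in> Sspan" "w \<in> nminus" "bracket L (gE i) v = gT t' \<oplus> w"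
          using bracket_E_nminus[OF *(2)] by blast
        have "bracket L (gE i) u \<in> nplus" "bracket L (gE i) (gT t) \<in> nplus"
          using * gE_nplus by (auto intro: lie_generated.bracket bracket_nplus_T)
        then show ?thesis using GE w Sspan(1) by (simp add: proj_nplus proj_add proj_nminus n_closed)
      next
        case (GF i)
        obtain t' w where w: "t' \<in> Sspan" "w \<in> nplus" "bracket L (gF i) u = gT t' \<oplus> w"
          using bracket_F_nplus[OF *(1)] by blast
        have "bracket L (gF i) v \<in> nminus" "bracket L (gF i) (gT t) \<in> nminus"
          using * gF_nminus by (auto intro: lie_generated.bracket bracket_nminus_T)
        then show ?thesis using GF w Sspan(1) by (simp add: proj_nplus proj_add proj_nminus n_closed)
      qed
      ultimately show "proj (?b y) \<in> Sspan" by (auto intro: Sspan)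
    qed
  next
    case zero
    show ?case by (simp add: proj_nplus[OF lie_generated.zero] Sspan)
  next
    case (bracket z w)
    show ?case
    proof
      fix y assume y: "y \<in> carrier L"
      have "bracket L (bracket L z w) y =
          bracket L z (bracket L w y) \<oplus> (- 1) \<odot> bracket L w (bracket L z y)"
        using bracket y by (simp add: jacobi_leibniz minus_eq smult_minus_one)
      then show "proj (bracket L (bracket L z w) y) \<in> Sspan"
        using bracket y by (simp add: proj_add proj_smult Sspan)
    qed
  qed (auto simp: bracket_simps proj_add proj_smult Sspan)
  then show ?thesis using assms(2) by blast
qed

end

section \<open>Toral deformations\<close>

locale mp_toral = mp_bialg A d P \<R> L
  for A :: "int^'n^'n" and d :: "nat^'n" and P :: "'k::field_char_0^'n^'n"
    and \<R> :: "('k, 'n, 'h::ab_group_add) realization_data"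
    and L :: "('k, ('k, 'n, 'h) mp_elem) lie_bialg" (structure) +
  fixes c :: "'h \<Rightarrow> 'h \<Rightarrow> 'k"
  assumes c: "c \<in> Alt_S \<R>"
begin

lemma linear_c: "Vector_Spaces.linear (scl \<R>) (*) (c x)"
  "Vector_Spaces.linear (scl \<R>) (*) (\<lambda>x. c x y)"
  using c unfolding Alt_S_def by blast+

lemma c_antisym: "c x y = - c y x"
  using c unfolding Alt_S_def by blast

lemma c_lin: "c x (s + t) = c x s + c x t" "c (s + t) x = c s x + c t x"
  "c x (scl \<R> a t) = a * c x t" "c (scl \<R> a t) x = a * c t x"
  "c x 0 = 0" "c 0 x = 0"
proof -
  interpret l: Vector_Spaces.linear "scl \<R>" "(*)" "c x" by (rule linear_c)
  interpret r: Vector_Spaces.linear "scl \<R>" "(*)" "\<lambda>t. c t x" by (rule linear_c)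
  show "c x (s + t) = c x s + c x t" "c (s + t) x = c s x + c t x"
    "c x (scl \<R> a t) = a * c x t" "c (scl \<R> a t) x = a * c t x" "c x 0 = 0" "c 0 x = 0"
    by (rule l.add, rule r.add, rule l.scale, rule r.scale, rule l.zero, rule r.zero)
qed

lemma c_S: "c (Tp \<R> i + Tm \<R> i) x = 0"
proof -
  have "c (scl \<R> (1 / 2) (Tp \<R> i + Tm \<R> i)) x = 0"
    using c unfolding Alt_S_def coroot_S_def by blast
  then show ?thesis by (simp add: c_lin)
qed

lemma c_Tm: "c (Tm \<R> i) x = - c (Tp \<R> i) x"
  using c_S[of i x] by (simp add: c_lin add_eq_0_iff)

lemma c_Sspan: "s \<in> Sspan \<Longrightarrow> c s x = 0"
proof -
  interpret h: vector_space "scl \<R>" by (rule vector_space_scl)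
  show "s \<in> Sspan \<Longrightarrow> c s x = 0"
    unfolding h.in_span_iff_functionals using linear_c(2)[of x] c_S[of _ x] by blast
qed

lemma c_proj_bracket [simp]: "x \<in> carrier L \<Longrightarrow> y \<in> carrier L \<Longrightarrow> c (proj (bracket L x y)) s = 0"
  "x \<in> carrier L \<Longrightarrow> y \<in> carrier L \<Longrightarrow> c s (proj (bracket L x y)) = 0"
  using c_Sspan[OF proj_bracket] c_antisym[of s] by simp_all

section \<open>The contraction derivations\<close>

definition D :: "'h \<Rightarrow> ('k, 'n, 'h) mp_elem \<Rightarrow> ('k, 'n, 'h) mp_elem" where
  "D s x = (\<Oplus>w\<in>Poly_Mapping.keys (cobracket L x).
     (Poly_Mapping.lookup (cobracket L x) w * c (proj (w ! 0)) s) \<odot> (w ! 1))"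

lemma contract_eq_D: "contract L (toral_cocycle A d \<R> c) x y = D (proj y) x"
  by (simp add: contract_def D_def toral_cocycle_def)

lemma D_term_closed:
  "x \<in> carrier L \<Longrightarrow> w \<in> Poly_Mapping.keys (cobracket L x) \<Longrightarrow> w ! 1 \<in> carrier L"
  by (rule tensors2_cases[OF cocycle_tensors]) auto

lemma D_closed [simp]: "x \<in> carrier L \<Longrightarrow> D s x \<in> carrier L"
  unfolding D_def by (auto intro!: finsum_closed D_term_closed[simplified])

text \<open>D is computed from a chosen formal combination; in this form, together with
  \<open>bilin_proj\<close>, only the tensor represented by it matters.\<close>

lemma lfun_D:
  assumes "lfun L \<psi>" "x \<in> carrier L"
  shows "\<psi> (D s x) = pair2 (\<lambda>p q. c (proj p) s * \<psi> q) (cobracket L x)"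
  unfolding D_def pair2_def pairing_def
  using assms D_term_closed
  by (subst lfun_finsum) (auto intro!: sum.cong simp: lfun_smult)

lemma bilin_proj: "lfun L \<psi> \<Longrightarrow> bilin L (\<lambda>p q. c (proj p) s * \<psi> q)"
  unfolding bilin_def lfun_def by (auto simp: proj_add proj_smult c_lin algebra_simps)

lemma D_add: "x \<in> carrier L \<Longrightarrow> y \<in> carrier L \<Longrightarrow> D s (x \<oplus> y) = D s x \<oplus> D s y"
  and D_smult: "x \<in> carrier L \<Longrightarrow> D s (a \<odot> x) = a \<odot> D s x"
  by (rule lfun_eqI; simp add: lfun_simps lfun_D lfun_add[OF cocycle_lfun[OF bilin_proj]]
      lfun_smult[OF cocycle_lfun[OF bilin_proj]])+

lemma lfun_D_lfun: "lfun L \<psi> \<Longrightarrow> lfun L (\<lambda>x. \<psi> (D s x))"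
  by (simp add: lfun_def D_add D_smult)

lemma D_zero [simp]: "D s \<zero> = \<zero>"
  by (rule lfun_eqI) (auto simp: lfun_zero lfun_zero[OF lfun_D_lfun])

lemma D_minus: "x \<in> carrier L \<Longrightarrow> D s (\<ominus> x) = \<ominus> D s x"
  using D_smult[of x s "- 1"] by (simp add: smult_minus_one)

lemma D_diff: "x \<in> carrier L \<Longrightarrow> y \<in> carrier L \<Longrightarrow> D s (x \<ominus> y) = D s x \<ominus> D s y"
  by (simp add: minus_eq D_add D_minus)

lemma D_left: "x \<in> carrier L \<Longrightarrow> D (s + t) x = D s x \<oplus> D t x"
  "x \<in> carrier L \<Longrightarrow> D (scl \<R> a s) x = a \<odot> D s x"
  "x \<in> carrier L \<Longrightarrow> D 0 x = \<zero>"
  "x \<in> carrier L \<Longrightarrow> y \<in> carrier L \<Longrightarrow> z \<in> carrier L \<Longrightarrow> D (proj (bracket L x y)) z = \<zero>"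
  by (rule lfun_eqI; simp add: lfun_simps lfun_D c_lin pair2_fun_add[symmetric]
      pair2_fun_mult[symmetric] distrib_right mult.assoc pair2_def[of "\<lambda>p q. 0"] pairing_def)+

lemma D_bracket:
  assumes c: "x \<in> carrier L" "y \<in> carrier L"
  shows "D s (bracket L x y) = bracket L x (D s y) \<ominus> bracket L y (D s x)"
proof (rule lfun_eqI)
  fix \<psi> assume \<psi>: "lfun L \<psi>"
  have *: "pair2 (badj L z (\<lambda>p q. c (proj p) s * \<psi> q)) (cobracket L w) = \<psi> (bracket L z (D s w))"
    if "z \<in> carrier L" "w \<in> carrier L" for z w
    unfolding lfun_D[OF lfun_bracket(1)[OF \<psi> that(1)] that(2)]
    by (rule pair2_cong[OF cocycle_tensors[OF that(2)]]) (use that in \<open>simp add: badj_def\<close>)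
  show "\<psi> (D s (bracket L x y)) = \<psi> (bracket L x (D s y) \<ominus> bracket L y (D s x))"
    using c by (simp add: lfun_D[OF \<psi>] cocycle_bracket bilin_proj[OF \<psi>] * lfun_diff[OF \<psi>])
qed (use c in auto)

lemma D_T: "D s (gT t) = \<zero>"
  and D_E: "D s (gE i) = c (Tp \<R> i) s \<odot> gE i"
  and D_F: "D s (gF i) = c (Tm \<R> i) s \<odot> gF i"
  by (rule lfun_eqI; simp add: lfun_simps lfun_D pair2_gen bilin_proj proj_nplus[OF gE_nplus]
      proj_nminus[OF gF_nminus] c_lin)+

lemma D_nplus: "u \<in> nplus \<Longrightarrow> D s u \<in> nplus"
  and D_nminus: "v \<in> nminus \<Longrightarrow> D s v \<in> nminus"
proof -
  have m: "x \<ominus> y \<in> nplus" if "x \<in> nplus" "y \<in> nplus" for x y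
    using that unfolding minus_eq by (intro lie_generated.add lie_generated_minus) auto
  have m': "x \<ominus> y \<in> nminus" if "x \<in> nminus" "y \<in> nminus" for x y
    using that unfolding minus_eq by (intro lie_generated.add lie_generated_minus) auto
  show "u \<in> nplus \<Longrightarrow> D s u \<in> nplus"
  proof (induction rule: lie_generated.induct)
    case (gen x)
    then obtain i where "x = gE i" by blast
    then show ?case by (simp add: D_E lie_generated.smult[OF gE_nplus])
  qed (auto simp: D_add D_smult D_bracket n_closed intro: lie_generated.intros m)
  show "v \<in> nminus \<Longrightarrow> D s v \<in> nminus"
  proof (induction rule: lie_generated.induct)
    case (gen x)
    then obtain i where "x = gF i" by blast
    then show ?case by (simp add: D_F lie_generated.smult[OF gF_nminus])
  qed (auto simp: D_add D_smult D_bracket n_closed intro: lie_generated.intros m')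
qed

lemma proj_D [simp]: "x \<in> carrier L \<Longrightarrow> proj (D s x) = 0"
proof -
  assume "x \<in> carrier L"
  then obtain u t v where *: "u \<in> nplus" "v \<in> nminus" "x = u \<oplus> gT t \<oplus> v" by (rule decomposition)
  then show ?thesis
    by (simp add: D_add D_T n_closed proj_add proj_nplus D_nplus proj_nminus D_nminus)
qed

text \<open>The commutator of two derivations is a derivation; here it vanishes on the generators,
  which are eigenvectors of every \<open>D s\<close>.\<close>

lemma D_commute:
  assumes "x \<in> carrier L"
  shows "D s (D t x) = D t (D s x)"
  using assms
proof (induction rule: carrier_induct)
  case (generator g)
  show ?case
    by (cases g) (simp_all add: D_T D_E D_F D_smult smult_assoc1[simplified, symmetric] mult.commute)
next
  case (bracket x y)
  show ?case
  proof (rule lfun_eqI)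
    fix \<psi> assume "lfun L \<psi>"
    then show "\<psi> (D s (D t (bracket L x y))) = \<psi> (D t (D s (bracket L x y)))"
      using bracket bracket_antisym[of "D s x" "D t y"] bracket_antisym[of "D t x" "D s y"]
      by (simp add: D_bracket D_diff lfun_simps)
  qed (use bracket in auto)
qed (auto simp: D_add D_smult)

text \<open>A coderivation property, on which the deformed cocycle rule depends. It holds on
  generators because \<open>D s\<close> kills toral elements and scales each E_i and F_i, and it
  passes to brackets because \<open>D s\<close> is a derivation.\<close>

lemma cobracket_D:
  assumes "x \<in> carrier L" "bilin L b"
  shows "pair2 b (cobracket L (D s x)) = pair2 (\<lambda>p q. b (D s p) q + b p (D s q)) (cobracket L x)"
proof -
  define E where "E b = (\<lambda>p q. b (D s p) q + b p (D s q))" for b :: "('k, 'n, 'h) mp_elem \<Rightarrow> ('k, 'n, 'h) mp_elem \<Rightarrow> 'k"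
  have E: "bilin L (E b)" if b: "bilin L b" for b
    unfolding bilin_def lfun_def E_def
    by (auto simp: D_add D_smult bilin_simps[OF b] algebra_simps)
  have "\<forall>b. bilin L b \<longrightarrow> pair2 b (cobracket L (D s x)) = pair2 (E b) (cobracket L x)"
    using assms(1)
  proof (induction rule: carrier_induct)
    case (generator g)
    show ?case
    proof (intro allI impI)
      fix b assume b: "bilin L b"
      have z: "pair2 b (cobracket L \<zero>) = 0" using lfun_zero[OF cocycle_lfun[OF b]] .
      show "pair2 b (cobracket L (D s (mp_gen_class A d \<R> g))) = pair2 (E b) (cobracket L (mp_gen_class A d \<R> g))"
        by (cases g) (simp_all add: pair2_gen E b z D_T D_E D_F lfun_smult[OF cocycle_lfun[OF b]],
          simp_all add: E_def D_T D_E D_F bilin_simps[OF b] algebra_simps)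
    qed
  next
    case zero
    show ?case using lfun_zero[OF cocycle_lfun] E by simp
  next
    case (bracket x y)
    show ?case
    proof (intro allI impI)
      fix b assume b: "bilin L b"
      \<comment> \<open>The transposed form of [D s z, r] = D s [z, r] - [z, D s r]: the action of D
        s z is the commutator of D s with the action of z.\<close>
      have *: "pair2 (badj L (D s z) b) (cobracket L w) =
        pair2 (badj L z (E b)) (cobracket L w) - pair2 (E (badj L z b)) (cobracket L w)"
        if zw: "z \<in> carrier L" "w \<in> carrier L" for z w
        unfolding pair2_fun_diff[symmetric]
      proof (rule pair2_cong[OF cocycle_tensors[OF zw(2)]])
        fix p q assume pq: "p \<in> carrier L" "q \<in> carrier L"
        have "bracket L (D s z) r = D s (bracket L z r) \<ominus> bracket L z (D s r)" if "r \<in> carrier L" for r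
          by (rule lfun_eqI)
            (use that zw bracket_antisym[of "D s z" r] in \<open>auto simp: D_bracket lfun_simps\<close>)
        then show "badj L (D s z) b p q = badj L z (E b) p q - E (badj L z b) p q"
          using zw pq by (simp add: badj_def E_def bilin_simps[OF b])
      qed
      show "pair2 b (cobracket L (D s (bracket L x y))) = pair2 (E b) (cobracket L (bracket L x y))"
        using bracket b E
        by (simp add: D_bracket lfun_diff[OF cocycle_lfun] cocycle_bracket bilin_badj *)
    qed
  qed (auto simp: D_add D_smult E lfun_add[OF cocycle_lfun] lfun_smult[OF cocycle_lfun])
  then show ?thesis using assms(2) unfolding E_def by blast
qed

section \<open>The deformed bracket\<close>

definition dbr :: "('k, 'n, 'h) mp_elem \<Rightarrow> ('k, 'n, 'h) mp_elem \<Rightarrow> ('k, 'n, 'h) mp_elem" where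
  "dbr x y = bracket L x y \<oplus> D (proj y) x \<ominus> D (proj x) y"

abbreviation M :: "('k, ('k, 'n, 'h) mp_elem) lie_bialg" where "M \<equiv> toral_deformation A d \<R> c"

lemma toral_deformation_eq: "M = L\<lparr>bracket := dbr\<rparr>"
  unfolding toral_deformation_def cocycle_deformation_def contract_eq_D L_def[symmetric]
  by (simp add: dbr_def[abs_def])

lemma toral_deformation_simps: "carrier M = carrier L" "zero M = \<zero>" "add M = add L"
  "smult M = smult L" "cobracket M = cobracket L" "bracket M = dbr"
  unfolding toral_deformation_eq by simp_all

lemma dbr_closed [simp]: "x \<in> carrier L \<Longrightarrow> y \<in> carrier L \<Longrightarrow> dbr x y \<in> carrier L"
  by (simp add: dbr_def)

lemma D_dbr: "x \<in> carrier L \<Longrightarrow> y \<in> carrier L \<Longrightarrow> z \<in> carrier L \<Longrightarrow> D (proj (dbr x y)) z = \<zero>"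
  by (simp add: dbr_def minus_eq smult_minus_one[symmetric] proj_add proj_smult D_left
      smult_r_null[simplified])

text \<open>Besides the original Jacobi sum there are terms linear in D, which cancel by the
  derivation rule, and terms quadratic in D, which cancel because the D's commute. The Cartan part
  of an inner deformed bracket contributes nothing by \<open>D_dbr\<close>.\<close>

lemma dbr_jacobi:
  assumes c: "x \<in> carrier L" "y \<in> carrier L" "z \<in> carrier L"
  shows "dbr x (dbr y z) \<oplus> dbr y (dbr z x) \<oplus> dbr z (dbr x y) = \<zero>"
proof (rule lfun_eqI)
  fix \<psi> assume \<psi>: "lfun L \<psi>"
  have "\<psi> (bracket L x (bracket L y z) \<oplus> bracket L y (bracket L z x) \<oplus> bracket L z (bracket L x y)) = 0"
    using jacobi[OF c] lfun_zero[OF \<psi>] by simp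
  then have j: "\<psi> (bracket L x (bracket L y z)) + \<psi> (bracket L y (bracket L z x)) + \<psi> (bracket L z (bracket L x y)) = 0"
    using c by (simp add: lfun_simps[OF \<psi>])
  have e: "\<psi> (dbr u (dbr v w)) = \<psi> (bracket L u (bracket L v w)) + \<psi> (bracket L u (D (proj w) v))
      - \<psi> (bracket L u (D (proj v) w)) - \<psi> (bracket L v (D (proj u) w)) + \<psi> (bracket L w (D (proj u) v))
      - \<psi> (D (proj u) (D (proj w) v)) + \<psi> (D (proj u) (D (proj v) w))"
    if "u \<in> carrier L" "v \<in> carrier L" "w \<in> carrier L" for u v w
  proof -
    have "dbr u (dbr v w) = bracket L u (dbr v w) \<oplus> \<zero> \<ominus> D (proj u) (dbr v w)"
      using that by (simp add: dbr_def[of u] D_dbr)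
    then show ?thesis
      using that by (simp add: dbr_def bracket_simps D_add D_diff D_bracket lfun_simps[OF \<psi>])
  qed
  show "\<psi> (dbr x (dbr y z) \<oplus> dbr y (dbr z x) \<oplus> dbr z (dbr x y)) = \<psi> \<zero>"
    using c j D_commute[of x "proj y" "proj z"] D_commute[of y "proj x" "proj z"] D_commute[of z "proj x" "proj y"]
    by (simp add: lfun_simps[OF \<psi>] e algebra_simps)
qed (use c in auto)

lemma lie_algebra_deformation: "lie_algebra M"
proof -
  have "Module.module scalars M"
    by (rule moduleI[OF cring_scalars abelian_groupI])
      (auto simp: toral_deformation_simps smult_simps a_ac intro!: bexI[of _ "\<ominus> _"] l_neg)
  then show ?thesis
  proof (rule lie_algebra.intro[OF _ lie_algebra_axioms.intro], unfold toral_deformation_simps)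
    fix x y z and a :: 'k
    assume x: "x \<in> carrier L"
    show "dbr x x = \<zero>"
      by (rule lfun_eqI) (use x in \<open>auto simp: dbr_def bracket_self lfun_simps\<close>)
    assume y: "y \<in> carrier L"
    show "dbr x y \<in> carrier L" using x y by simp
    show "dbr (a \<odot> x) y = a \<odot> dbr x y" "dbr x (a \<odot> y) = a \<odot> dbr x y"
      by (rule lfun_eqI; use x y in \<open>auto simp: dbr_def bracket_simps proj_smult D_left D_smult lfun_simps algebra_simps\<close>)+
    assume z: "z \<in> carrier L"
    show "dbr (x \<oplus> y) z = dbr x z \<oplus> dbr y z" "dbr x (y \<oplus> z) = dbr x y \<oplus> dbr x z"
      by (rule lfun_eqI; use x y z in \<open>auto simp: dbr_def bracket_simps proj_add D_left D_add lfun_simps algebra_simps\<close>)+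
    show "dbr x (dbr y z) \<oplus> dbr y (dbr z x) \<oplus> dbr z (dbr x y) = \<zero>"
      using x y z by (rule dbr_jacobi)
  qed
qed

lemma tensor_deformation:
  "bilin M b = bilin L b"
  "lfun M \<psi> = lfun L \<psi>"
  "tensors M n = tensors L n"
  "tensor_eq M = tensor_eq L"
  by (simp_all add: bilin_def lfun_def tensors_def toral_deformation_simps cong: tensor_eq_cong)

text \<open>The terms in which a fixed D acts on the legs are absorbed by the coderivation property.
  What remains are the terms in which a leg p of \<delta>(y) acts on x through D (proj p), and the
  same with x and y exchanged; they cancel each other.\<close>

lemma cobracket_dbr:
  assumes b: "bilin L b" and c: "x \<in> carrier L" "y \<in> carrier L"
  shows "pair2 b (cobracket L (dbr x y)) =
    pair2 (\<lambda>p q. b (dbr x p) q + b p (dbr x q)) (cobracket L y)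
    - pair2 (\<lambda>p q. b (dbr y p) q + b p (dbr y q)) (cobracket L x)"
proof -
  define X where "X x y = pair2 (\<lambda>p q. pair2 (\<lambda>r r'. c (proj r) (proj p) * (b r' q - b q r')) (cobracket L x)) (cobracket L y)" for x y
  have split: "pair2 (\<lambda>p q. b (dbr x p) q + b p (dbr x q)) (cobracket L y) =
      pair2 (badj L x b) (cobracket L y) - pair2 b (cobracket L (D (proj x) y)) + X x y"
    if c: "x \<in> carrier L" "y \<in> carrier L" for x y
  proof -
    have D1: "bilin L (\<lambda>p q. b p (D (proj q) x))"
      unfolding bilin_def lfun_def using c
      by (auto simp: proj_add proj_smult D_left bilin_simps[OF b])
    have "pair2 (\<lambda>p q. b (dbr x p) q + b p (dbr x q)) (cobracket L y) =
      pair2 (\<lambda>p q. badj L x b p q - (b (D (proj x) p) q + b p (D (proj x) q))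
         + (b (D (proj p) x) q + b p (D (proj q) x))) (cobracket L y)"
      by (rule pair2_cong[OF cocycle_tensors[OF c(2)]])
        (use c in \<open>simp add: dbr_def badj_def bilin_simps[OF b]\<close>)
    also have "\<dots> = pair2 (badj L x b) (cobracket L y) - pair2 b (cobracket L (D (proj x) y))
         + (pair2 (\<lambda>p q. b (D (proj p) x) q) (cobracket L y) + pair2 (\<lambda>p q. b p (D (proj q) x)) (cobracket L y))"
      using c by (simp add: pair2_fun_add pair2_fun_diff cobracket_D[OF _ b])
    also have "pair2 (\<lambda>p q. b p (D (proj q) x)) (cobracket L y) = - pair2 (\<lambda>p q. b q (D (proj p) x)) (cobracket L y)"
      using cobracket_antisym'[OF D1 c(2)] by simp
    also have "pair2 (\<lambda>p q. b (D (proj p) x) q) (cobracket L y) + - pair2 (\<lambda>p q. b q (D (proj p) x)) (cobracket L y) = X x y"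
      unfolding X_def pair2_fun_uminus[symmetric] pair2_fun_add[symmetric]
    proof (rule pair2_cong[OF cocycle_tensors[OF c(2)]])
      fix p q assume pq: "p \<in> carrier L" "q \<in> carrier L"
      have "lfun L (\<lambda>r. b r q - b q r)"
        using pq by (simp add: lfun_def bilin_simps[OF b] algebra_simps)
      from lfun_D[OF this c(1), of "proj p"]
      show "b (D (proj p) x) q + - b q (D (proj p) x) =
          pair2 (\<lambda>r r'. c (proj r) (proj p) * (b r' q - b q r')) (cobracket L x)" by simp
    qed
    finally show ?thesis .
  qed
  \<comment> \<open>Exchanging x and y changes the sign of \<chi> by its antisymmetry, and also the
    sign of the antisymmetrised b.\<close>
  have "X x y = X y x"
  proof -
    have "X x y = pair2 (\<lambda>r r'. pair2 (\<lambda>p q. c (proj r) (proj p) * (b r' q - b q r')) (cobracket L y)) (cobracket L x)"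
      unfolding X_def by (rule pair2_swap)
    also have "\<dots> = pair2 (\<lambda>r r'. pair2 (\<lambda>p q. c (proj p) (proj r) * (b q r' - b r' q)) (cobracket L y)) (cobracket L x)"
      by (rule arg_cong[where f = "\<lambda>F. pair2 (\<lambda>r r'. pair2 (F r r') (cobracket L y)) (cobracket L x)"], intro ext,
          subst c_antisym) (simp add: algebra_simps)
    also have "\<dots> = X y x"
      by (simp add: X_def)
    finally show ?thesis .
  qed
  moreover have "pair2 b (cobracket L (dbr x y)) = pair2 b (cobracket L (bracket L x y))
      + pair2 b (cobracket L (D (proj y) x)) - pair2 b (cobracket L (D (proj x) y))"
    using c by (simp add: dbr_def lfun_simps[OF cocycle_lfun[OF b]])
  ultimately show ?thesis
    using c by (simp add: split cocycle_bracket b)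
qed

text \<open>Antisymmetry and co-Jacobi carry over because the cobracket and the vector space are
  unchanged; the cocycle rule is the one axiom that ties the new bracket to the cobracket.\<close>

lemma lie_bialgebra_deformation: "lie_bialgebra M"
proof -
  interpret M: lie_algebra M by (rule lie_algebra_deformation)
  interpret L: lie_bialgebra L by (rule lie_bialgebra_L)
  have c2: "cobracket2 M = cobracket2 L"
    by (simp add: fun_eq_iff cobracket2_def toral_deformation_simps)
  show ?thesis
  proof
    show "linear_cocycle M (cobracket M)"
      unfolding M.linear_cocycle_iff tensor_deformation toral_deformation_simps badj_def
      using cocycle_lfun cobracket_dbr by auto
    show "tensor_eq M (cobracket M x + word_map rev (cobracket M x)) 0" if "x \<in> carrier M" for x
      using that unfolding tensor_deformation toral_deformation_simps by (rule L.cobracket_antisym)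
    show "tensor_eq M (cobracket2 M x + word_map rotate1 (cobracket2 M x)
      + word_map (rotate1 \<circ> rotate1) (cobracket2 M x)) 0" if "x \<in> carrier M" for x
      using that unfolding tensor_deformation toral_deformation_simps c2 by (rule L.cojacobi)
  qed
qed

end

section \<open>Morphisms\<close>

lemma pair2_word_map_map:
  assumes "t \<in> tensors L 2"
  shows "pair2 b (word_map (map f) t) = pair2 (\<lambda>p q. b (f p) (f q)) t"
  unfolding pair2_def pairing_word_map
  by (rule pairing_cong) (use assms in \<open>auto elim!: tensors2_cases\<close>)

lemma (in lie_bialgebra) cobracket_in_tensors: "x \<in> carrier L \<Longrightarrow> cobracket L x \<in> tensors L 2"
  using cobracket_cocycle by (simp add: linear_cocycle_def)

lemma bilin_comp:
  assumes "bilin M b" "f \<in> carrier L \<rightarrow> carrier M"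
    "\<And>x y. x \<in> carrier L \<Longrightarrow> y \<in> carrier L \<Longrightarrow> f (x \<oplus>\<^bsub>L\<^esub> y) = f x \<oplus>\<^bsub>M\<^esub> f y"
    "\<And>a x. x \<in> carrier L \<Longrightarrow> f (a \<odot>\<^bsub>L\<^esub> x) = a \<odot>\<^bsub>M\<^esub> f x"
  shows "bilin L (\<lambda>p q. b (f p) (f q))"
  using assms(1,2) unfolding bilin_def lfun_def by (auto simp: assms(3,4) Pi_iff)

lemma lie_bialg_hom_iff:
  fixes L :: "('k::field, 'a, 'm) lie_bialg_scheme" and M :: "('k, 'b, 'o) lie_bialg_scheme"
  assumes "lie_bialgebra L" "lie_bialgebra M"
  shows "lie_bialg_hom L M f \<longleftrightarrow>
     f \<in> carrier L \<rightarrow> carrier M \<and>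
     (\<forall>x\<in>carrier L. \<forall>y\<in>carrier L. f (x \<oplus>\<^bsub>L\<^esub> y) = f x \<oplus>\<^bsub>M\<^esub> f y) \<and>
     (\<forall>a. \<forall>x\<in>carrier L. f (a \<odot>\<^bsub>L\<^esub> x) = a \<odot>\<^bsub>M\<^esub> f x) \<and>
     (\<forall>x\<in>carrier L. \<forall>y\<in>carrier L. f (bracket L x y) = bracket M (f x) (f y)) \<and>
     (\<forall>x\<in>carrier L. \<forall>b. bilin M b \<longrightarrow>
        pair2 (\<lambda>p q. b (f p) (f q)) (cobracket L x) = pair2 b (cobracket M (f x)))"
proof (cases "f \<in> carrier L \<rightarrow> carrier M")
  case f: True
  have "tensor_eq M (word_map (map f) (cobracket L x)) (cobracket M (f x)) \<longleftrightarrow>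
      (\<forall>b. bilin M b \<longrightarrow> pair2 (\<lambda>p q. b (f p) (f q)) (cobracket L x) = pair2 b (cobracket M (f x)))"
    if x: "x \<in> carrier L" for x
  proof -
    have t: "cobracket L x \<in> tensors L 2" by (rule lie_bialgebra.cobracket_in_tensors[OF assms(1) x])
    have "cobracket M (f x) \<in> tensors M 2"
      using f x by (intro lie_bialgebra.cobracket_in_tensors[OF assms(2)]) auto
    moreover have "word_map (map f) (cobracket L x) \<in> tensors M 2"
      using t f by (intro tensors_word_map) (auto simp: tensors_def)
    ultimately show ?thesis
      by (simp add: tensor_eq2_iff pair2_word_map_map[OF t])
  qed
  then show ?thesis unfolding lie_bialg_hom_def by (simp cong: ball_cong)
qed (simp add: lie_bialg_hom_def)

lemma lie_bialg_iso_trans: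
  fixes L :: "('k::field, 'a, 'm) lie_bialg_scheme" and M :: "('k, 'b, 'o) lie_bialg_scheme"
    and N :: "('k, 'c, 'p) lie_bialg_scheme"
  assumes "L \<cong>\<^sub>b M" "M \<cong>\<^sub>b N"
  shows "L \<cong>\<^sub>b N"
proof -
  from assms have b: "lie_bialgebra L" "lie_bialgebra M" "lie_bialgebra N" by (auto simp: lie_bialg_iso_def)
  from assms obtain f g where f: "lie_bialg_hom L M f" "bij_betw f (carrier L) (carrier M)"
    and g: "lie_bialg_hom M N g" "bij_betw g (carrier M) (carrier N)" by (auto simp: lie_bialg_iso_def)
  have "lie_bialg_hom L N (g \<circ> f)"
    unfolding lie_bialg_hom_iff[OF b(1,3)]
  proof (intro conjI ballI allI impI)
    note f' = f(1)[unfolded lie_bialg_hom_iff[OF b(1,2)]] and g' = g(1)[unfolded lie_bialg_hom_iff[OF b(2,3)]]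
    show "g \<circ> f \<in> carrier L \<rightarrow> carrier N" using f' g' by auto
    fix x y and a :: 'k assume x: "x \<in> carrier L"
    then have fx: "f x \<in> carrier M" using f' by auto
    show "(g \<circ> f) (a \<odot>\<^bsub>L\<^esub> x) = a \<odot>\<^bsub>N\<^esub> (g \<circ> f) x" using x fx f' g' by simp
    { assume y: "y \<in> carrier L"
      then have fy: "f y \<in> carrier M" using f' by auto
      show "(g \<circ> f) (x \<oplus>\<^bsub>L\<^esub> y) = (g \<circ> f) x \<oplus>\<^bsub>N\<^esub> (g \<circ> f) y"
        "(g \<circ> f) (bracket L x y) = bracket N ((g \<circ> f) x) ((g \<circ> f) y)" using x y fx fy f' g' by simp_all }
    fix c assume c: "bilin N c"
    have "bilin M (\<lambda>p q. c (g p) (g q))" by (rule bilin_comp[OF c]) (use g' in auto)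
    then have "pair2 (\<lambda>p q. c (g (f p)) (g (f q))) (cobracket L x) = pair2 (\<lambda>p q. c (g p) (g q)) (cobracket M (f x))"
      using f' x by blast
    also have "\<dots> = pair2 c (cobracket N (g (f x)))" using g' fx c by blast
    finally show "pair2 (\<lambda>p q. c ((g \<circ> f) p) ((g \<circ> f) q)) (cobracket L x) = pair2 c (cobracket N ((g \<circ> f) x))"
      by simp
  qed
  with bij_betw_trans[OF f(2) g(2)] b show ?thesis unfolding lie_bialg_iso_def by blast
qed

section \<open>Morphisms out of a multiparameter Lie bialgebra\<close>

context mp_bialg
begin

lemma lift_gen:
  assumes "lie_algebra N" "\<And>x. \<gamma> x \<in> carrier N"
    "\<And>s t. (s, t) \<in> mp_relations A d \<R> \<Longrightarrow> leval N \<gamma> s = leval N \<gamma> t"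
  shows "lift N \<gamma> (mp_gen_class A d \<R> x) = \<gamma> x"
  by (simp add: mp_gen_class_def lift_cls[OF assms])

text \<open>Both ways around the square obey the same cocycle rule along the lifted Lie morphism, so
  agreement on generators propagates to brackets.\<close>

lemma lie_bialg_hom_lift:
  fixes N :: "('k, 'b, 'o) lie_bialg_scheme" and \<gamma> :: "('n, 'h) mp_gen \<Rightarrow> 'b"
  assumes N: "lie_bialgebra N" and \<gamma>: "\<And>x. \<gamma> x \<in> carrier N"
    and rel: "\<And>s t. (s, t) \<in> mp_relations A d \<R> \<Longrightarrow> leval N \<gamma> s = leval N \<gamma> t"
    and cob: "\<And>b t. bilin N b \<Longrightarrow> pair2 b (cobracket N (\<gamma> (GT t))) = 0"
    "\<And>b i. bilin N b \<Longrightarrow> pair2 b (cobracket N (\<gamma> (GE i))) = b (\<gamma> (GT (Tp \<R> i))) (\<gamma> (GE i)) - b (\<gamma> (GE i)) (\<gamma> (GT (Tp \<R> i)))"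
    "\<And>b i. bilin N b \<Longrightarrow> pair2 b (cobracket N (\<gamma> (GF i))) = b (\<gamma> (GT (Tm \<R> i))) (\<gamma> (GF i)) - b (\<gamma> (GF i)) (\<gamma> (GT (Tm \<R> i)))"
  shows "lie_bialg_hom L N (lift N \<gamma>)"
proof -
  interpret N: lie_bialgebra N by (rule N)
  interpret N: lie_coalgebra_cocycle N "cobracket N"
    by unfold_locales (rule N.cobracket_cocycle)
  let ?F = "lift N \<gamma>"
  have cls: "?F (cls s) = leval N \<gamma> s" for s
    by (rule lift_cls[OF N.lie_algebra_axioms \<gamma> rel])
  have F: "?F \<in> carrier L \<rightarrow> carrier N" using \<gamma> by (auto elim!: carrier_cases simp: cls)
  have add: "?F (x \<oplus> y) = ?F x \<oplus>\<^bsub>N\<^esub> ?F y" and br: "?F (bracket L x y) = bracket N (?F x) (?F y)"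
    if "x \<in> carrier L" "y \<in> carrier L" for x y
    using that by (auto elim!: carrier_cases simp: cls_simps cls)
  have sc: "?F (a \<odot> x) = a \<odot>\<^bsub>N\<^esub> ?F x" if "x \<in> carrier L" for x a
    using that by (auto elim!: carrier_cases simp: cls_simps cls)
  have F_zero: "?F \<zero> = \<zero>\<^bsub>N\<^esub>" by (simp add: zero_eq cls)
  have bF: "bilin L (\<lambda>p q. b (?F p) (?F q))" if "bilin N b" for b
    using bilin_comp[OF that F] add sc by blast
  have "\<forall>b. bilin N b \<longrightarrow> pair2 (\<lambda>p q. b (?F p) (?F q)) (cobracket L x) = pair2 b (cobracket N (?F x))"
    if "x \<in> carrier L" for x
    using that
  proof (induction rule: carrier_induct)
    case (generator g)
    have "?F (mp_gen_class A d \<R> x) = \<gamma> x" for x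
      by (rule lift_gen[OF N.lie_algebra_axioms \<gamma> rel])
    then show ?case by (cases g) (simp_all add: pair2_gen bF cob)
  next
    case zero
    then show ?case by (simp add: F_zero lfun_zero[OF cocycle_lfun[OF bF]] N.lfun_zero[OF N.cocycle_lfun])
  next
    case (add x y)
    then have "?F x \<in> carrier N" "?F y \<in> carrier N" using F by auto
    with add show ?case
      by (simp add: \<open>\<And>y x. x \<in> carrier L \<Longrightarrow> y \<in> carrier L \<Longrightarrow> ?F (x \<oplus> y) = ?F x \<oplus>\<^bsub>N\<^esub> ?F y\<close>
          lfun_add[OF cocycle_lfun[OF bF]] lfun_add[OF N.cocycle_lfun])
  next
    case (smult x a)
    then have "?F x \<in> carrier N" using F by auto
    with smult show ?case
      by (simp add: sc lfun_smult[OF cocycle_lfun[OF bF]] lfun_smult[OF N.cocycle_lfun])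
  next
    case (bracket x y)
    then have c: "?F x \<in> carrier N" "?F y \<in> carrier N" using F by auto
    show ?case
    proof (intro allI impI)
      fix b assume b: "bilin N b"
      have *: "pair2 (badj L z (\<lambda>p q. b (?F p) (?F q))) (cobracket L w) = pair2 (badj N (?F z) b) (cobracket N (?F w))"
        if z: "z \<in> carrier L" and w: "w \<in> carrier L"
          "\<forall>b. bilin N b \<longrightarrow> pair2 (\<lambda>p q. b (?F p) (?F q)) (cobracket L w) = pair2 b (cobracket N (?F w))" for z w
      proof -
        have "bilin N (badj N (?F z) b)" using b F z by (intro N.bilin_badj) auto
        then have "pair2 (\<lambda>p q. badj N (?F z) b (?F p) (?F q)) (cobracket L w) =
            pair2 (badj N (?F z) b) (cobracket N (?F w))" using w by blast
        moreover have "pair2 (badj L z (\<lambda>p q. b (?F p) (?F q))) (cobracket L w) =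
            pair2 (\<lambda>p q. badj N (?F z) b (?F p) (?F q)) (cobracket L w)"
          by (rule pair2_cong[OF cocycle_tensors[OF w(1)]]) (use z in \<open>simp add: badj_def br\<close>)
        ultimately show ?thesis by simp
      qed
      show "pair2 (\<lambda>p q. b (?F p) (?F q)) (cobracket L (bracket L x y)) =
          pair2 b (cobracket N (?F (bracket L x y)))"
        using bracket c by (simp add: br cocycle_bracket[OF bF[OF b]] N.cocycle_bracket[OF b] *)
    qed
  qed
  then show ?thesis
    unfolding lie_bialg_hom_iff[OF lie_bialgebra_L N] by (simp add: F add sc br)
qed

end

lemma lie_bialg_isoI:
  assumes "lie_bialgebra L" "lie_bialgebra M" "lie_bialg_hom L M f"
    and "\<And>y. y \<in> carrier M \<Longrightarrow> g y \<in> carrier L"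
    "\<And>x. x \<in> carrier L \<Longrightarrow> g (f x) = x" "\<And>y. y \<in> carrier M \<Longrightarrow> f (g y) = y"
  shows "L \<cong>\<^sub>b M"
proof -
  have "f x \<in> carrier M" if "x \<in> carrier L" for x
    using assms(3) that by (auto simp: lie_bialg_hom_def)
  then have "bij_betw f (carrier L) (carrier M)"
    using assms(4-6) by (intro bij_betwI[of _ _ _ g]) auto
  then show ?thesis using assms unfolding lie_bialg_iso_def by blast
qed

text \<open>A linear map compatible with generators and with the brackets inside \<open>\<nn>\<^sub>+\<close> and \<open>\<nn>\<^sub>-\<close>:
  the common shadow of a morphism to a toral deformation, where only brackets with \<open>\<hh>\<close> change.\<close>

definition triangular_map where
  "triangular_map A d \<R> \<R>' f \<longleftrightarrow>
    (let L = mplba A d \<R>; L' = mplba A d \<R>' in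
     f \<in> carrier L \<rightarrow> carrier L' \<and>
     (\<forall>x\<in>carrier L. \<forall>y\<in>carrier L. f (x \<oplus>\<^bsub>L\<^esub> y) = f x \<oplus>\<^bsub>L'\<^esub> f y) \<and>
     (\<forall>a. \<forall>x\<in>carrier L. f (a \<odot>\<^bsub>L\<^esub> x) = a \<odot>\<^bsub>L'\<^esub> f x) \<and>
     (\<forall>g. f (mp_gen_class A d \<R> g) = mp_gen_class A d \<R>' g) \<and>
     (\<forall>x\<in>n_plus A d \<R>. f x \<in> n_plus A d \<R>') \<and> (\<forall>x\<in>n_minus A d \<R>. f x \<in> n_minus A d \<R>') \<and>
     (\<forall>x\<in>n_plus A d \<R>. \<forall>y\<in>n_plus A d \<R>. f (bracket L x y) = bracket L' (f x) (f y)) \<and>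
     (\<forall>x\<in>n_minus A d \<R>. \<forall>y\<in>n_minus A d \<R>. f (bracket L x y) = bracket L' (f x) (f y)))"

context mp_bialg
begin

text \<open>The composite is known to be multiplicative only inside \<nn>_+ and inside \<nn>_-.
  There it fixes the generators, hence everything; on \<hh> each element is itself a generator, and
  the triangular decomposition does the rest.\<close>

lemma triangular_map_inverse:
  assumes f: "triangular_map A d \<R> \<R>' f" and h: "triangular_map A d \<R>' \<R> h" and x: "x \<in> carrier L"
  shows "h (f x) = x"
proof -
  let ?L' = "mplba A d \<R>'"
  have f': "f \<in> carrier L \<rightarrow> carrier ?L'"
    "\<And>x y. x \<in> carrier L \<Longrightarrow> y \<in> carrier L \<Longrightarrow> f (x \<oplus> y) = f x \<oplus>\<^bsub>?L'\<^esub> f y"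
    "\<And>a x. x \<in> carrier L \<Longrightarrow> f (a \<odot> x) = a \<odot>\<^bsub>?L'\<^esub> f x"
    "\<And>g. f (mp_gen_class A d \<R> g) = mp_gen_class A d \<R>' g"
    "\<And>x. x \<in> n_plus A d \<R> \<Longrightarrow> f x \<in> n_plus A d \<R>'"
    "\<And>x. x \<in> n_minus A d \<R> \<Longrightarrow> f x \<in> n_minus A d \<R>'"
    "\<And>x y. x \<in> n_plus A d \<R> \<Longrightarrow> y \<in> n_plus A d \<R> \<Longrightarrow> f (bracket L x y) = bracket ?L' (f x) (f y)"
    "\<And>x y. x \<in> n_minus A d \<R> \<Longrightarrow> y \<in> n_minus A d \<R> \<Longrightarrow> f (bracket L x y) = bracket ?L' (f x) (f y)"
    using f unfolding triangular_map_def Let_def L_def by blast+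
  have h': "h \<in> carrier ?L' \<rightarrow> carrier L"
    "\<And>x y. x \<in> carrier ?L' \<Longrightarrow> y \<in> carrier ?L' \<Longrightarrow> h (x \<oplus>\<^bsub>?L'\<^esub> y) = h x \<oplus> h y"
    "\<And>a x. x \<in> carrier ?L' \<Longrightarrow> h (a \<odot>\<^bsub>?L'\<^esub> x) = a \<odot> h x"
    "\<And>g. h (mp_gen_class A d \<R>' g) = mp_gen_class A d \<R> g"
    "\<And>x y. x \<in> n_plus A d \<R>' \<Longrightarrow> y \<in> n_plus A d \<R>' \<Longrightarrow> h (bracket ?L' x y) = bracket L (h x) (h y)"
    "\<And>x y. x \<in> n_minus A d \<R>' \<Longrightarrow> y \<in> n_minus A d \<R>' \<Longrightarrow> h (bracket ?L' x y) = bracket L (h x) (h y)"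
    using h unfolding triangular_map_def Let_def L_def by blast+
  have closed: "f x \<in> carrier ?L'" if "x \<in> carrier L" for x using f'(1) that by auto
  have add: "h (f (x \<oplus> y)) = h (f x) \<oplus> h (f y)" if "x \<in> carrier L" "y \<in> carrier L" for x y
    by (simp only: f'(2)[OF that] h'(2)[OF closed[OF that(1)] closed[OF that(2)]])
  have sc: "h (f (a \<odot> x)) = a \<odot> h (f x)" if "x \<in> carrier L" for x a
    by (simp only: f'(3)[OF that] h'(3)[OF closed[OF that]])
  have hf: "h (f \<zero>) \<in> carrier L" using h'(1) closed[OF zero_closed] by (rule funcset_mem)
  have hf_zero: "h (f \<zero>) = \<zero>"
    using sc[of \<zero> 0] hf by simp
  have gen: "h (f (mp_gen_class A d \<R> g)) = mp_gen_class A d \<R> g" for g by (simp only: f'(4) h'(4))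
  have plus: "h (f x) = x" if "x \<in> nplus" for x
    using that
  proof (induction rule: lie_generated.induct)
    case (bracket x y)
    then have m: "x \<in> n_plus A d \<R>" "y \<in> n_plus A d \<R>" by (simp_all add: n_plus_def flip: L_def)
    have "h (f (bracket L x y)) = bracket L (h (f x)) (h (f y))"
      by (simp only: f'(7)[OF m] h'(5)[OF f'(5)[OF m(1)] f'(5)[OF m(2)]])
    then show ?case using bracket by simp
  qed (auto simp: hf_zero gen add sc n_closed)
  have minus: "h (f x) = x" if "x \<in> nminus" for x
    using that
  proof (induction rule: lie_generated.induct)
    case (bracket x y)
    then have m: "x \<in> n_minus A d \<R>" "y \<in> n_minus A d \<R>" by (simp_all add: n_minus_def flip: L_def)
    have "h (f (bracket L x y)) = bracket L (h (f x)) (h (f y))"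
      by (simp only: f'(8)[OF m] h'(6)[OF f'(6)[OF m(1)] f'(6)[OF m(2)]])
    then show ?case using bracket by simp
  qed (auto simp: hf_zero gen add sc n_closed)
  obtain u t v where "u \<in> nplus" "v \<in> nminus" "x = u \<oplus> gT t \<oplus> v" using decomposition[OF x] .
  then show ?thesis by (simp add: add gen plus minus n_closed)
qed

end

section \<open>Deformed realizations\<close>

lemma vector_space_field: "vector_space ((*) :: 'k::field \<Rightarrow> 'k \<Rightarrow> 'k)"
  by unfold_locales (auto simp: algebra_simps)

lemma leval_funpow: "leval N g ((LBr s ^^ m) t) = (bracket N (leval N g s) ^^ m) (leval N g t)"
  by (induction m) auto

context mp_toral
begin

abbreviation P' :: "'k^'n^'n" where "P' \<equiv> deformed_matrix P \<R> c"
abbreviation \<R>' :: "('k, 'n, 'h) realization_data" where "\<R>' \<equiv> deformed_realization \<R> c"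

lemma deformed_simps [simp]:
  "scl \<R>' = scl \<R>" "Tp \<R>' = Tp \<R>" "Tm \<R>' = Tm \<R>" "rt \<R>' i t = alpha i t + c t (Tp \<R> i)"
  "coroot_S \<R>' = coroot_S \<R>"
  by (simp_all add: deformed_realization_def coroot_S_def fun_eq_iff)

lemma cartan_type_deformed: "cartan_type A d P'"
proof -
  have "P' + transpose P' = P + transpose P"
  proof -
    have "P $ i $ j + c (Tp \<R> i) (Tp \<R> j) + (P $ j $ i + c (Tp \<R> j) (Tp \<R> i)) = P $ i $ j + P $ j $ i" for i j
      using c_antisym[of "Tp \<R> i" "Tp \<R> j"] by simp
    then show ?thesis by (simp add: vec_eq_iff deformed_matrix_def transpose_def)
  qed
  then show ?thesis using type_P by (simp add: cartan_type_def)
qed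

lemma realization_deformed: "realization P' \<R>'"
proof -
  have r: "vector_space (scl \<R>)" "\<exists>B. finite B \<and> module.span (scl \<R>) B = UNIV"
    "lin_indep_family (scl \<R>) (coroot_S \<R>)" using real by (auto simp: realization_def)
  interpret p: vector_space_pair "scl \<R>" "(*) :: 'k \<Rightarrow> 'k \<Rightarrow> 'k"
    by (intro vector_space_pair.intro r(1) vector_space_field)
  have "Vector_Spaces.linear (scl \<R>) (*) (rt \<R>' i)" for i
    using p.linear_compose_add[OF linear_alpha linear_c(2)] by (simp add: deformed_realization_def)
  \<comment> \<open>The condition at T_i^- asks for the transposed entry: replacing T_i^- by T_i^+
    and exchanging the arguments each change the sign.\<close>
  moreover have "c (Tm \<R> i) (Tp \<R> j) = c (Tp \<R> j) (Tp \<R> i)" for i j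
    using c_Tm c_antisym by metis
  ultimately show ?thesis
    using r by (simp add: realization_def deformed_matrix_def)
qed

sublocale def: mp_bialg A d P' \<R>' "mplba A d \<R>'"
  by unfold_locales (rule cartan symmetrizer cartan_type_deformed realization_deformed)+

text \<open>By -\<chi>(T_j^+, t) = \<chi>(t, T_j^+) the contraction term of the deformed bracket is
  exactly the shift of the root. For F_j the passage from T_j^- to T_j^+ supplies the other
  sign.\<close>

lemma dbr_TT: "dbr (gT s) (gT t) = \<zero>"
  and dbr_TE: "dbr (gT t) (gE j) = rt \<R>' j t \<odot> gE j"
  and dbr_TF: "dbr (gT t) (gF j) = (- rt \<R>' j t) \<odot> gF j"
  by (rule lfun_eqI; simp add: dbr_def bracket_TT bracket_TE bracket_TF D_T D_E D_F D_left c_Tm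
      proj_nplus[OF gE_nplus] proj_nminus[OF gF_nminus] lfun_simps
      c_antisym[of "Tp \<R> j" t] algebra_simps)+

lemma dbr_eq_bracket:
  assumes "x \<in> carrier L" "y \<in> carrier L" "proj x = 0" "proj y = 0"
  shows "dbr x y = bracket L x y"
  using assms by (simp add: dbr_def D_left minus_eq)

lemma dbr_nplus: "x \<in> nplus \<Longrightarrow> y \<in> nplus \<Longrightarrow> dbr x y = bracket L x y"
  and dbr_nminus: "x \<in> nminus \<Longrightarrow> y \<in> nminus \<Longrightarrow> dbr x y = bracket L x y"
  by (simp_all add: dbr_eq_bracket n_closed proj_nplus proj_nminus)

lemma dbr_serre:
  "(dbr (gE i) ^^ m) (gE j) = (bracket L (gE i) ^^ m) (gE j)"
  "(dbr (gF i) ^^ m) (gF j) = (bracket L (gF i) ^^ m) (gF j)"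
proof -
  have "(dbr (gE i) ^^ m) (gE j) = (bracket L (gE i) ^^ m) (gE j) \<and> (bracket L (gE i) ^^ m) (gE j) \<in> nplus"
    by (induction m) (auto simp: gE_nplus dbr_nplus intro: lie_generated.bracket[OF gE_nplus])
  moreover have "(dbr (gF i) ^^ m) (gF j) = (bracket L (gF i) ^^ m) (gF j) \<and> (bracket L (gF i) ^^ m) (gF j) \<in> nminus"
    by (induction m) (auto simp: gF_nminus dbr_nminus intro: lie_generated.bracket[OF gF_nminus])
  ultimately show "(dbr (gE i) ^^ m) (gE j) = (bracket L (gE i) ^^ m) (gE j)"
  "(dbr (gF i) ^^ m) (gF j) = (bracket L (gF i) ^^ m) (gF j)" by blast+
qed

text \<open>Roots shift by \<open>dbr_TE\<close> and \<open>dbr_TF\<close>, while brackets among the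
  E_i and F_j keep their values because these elements have no Cartan part. This is what the
  universal property requires for a map from the deformed realization.\<close>

lemma leval_deformed_relation:
  assumes "(s, t) \<in> mp_relations A d \<R>'"
  shows "leval M (mp_gen_class A d \<R>) s = leval M (mp_gen_class A d \<R>) t"
proof -
  have EF: "dbr (gE i) (gF j) = bracket L (gE i) (gF j)" for i j
    by (simp add: dbr_eq_bracket proj_nplus[OF gE_nplus] proj_nminus[OF gF_nminus])
  show ?thesis
    using assms[unfolded mp_relations_def]
    by (elim UnE CollectE exE conjE)
      (simp_all add: toral_deformation_simps gT_add gT_scl dbr_TT dbr_TE dbr_TF EF bracket_EF
        bracket_EF' leval_funpow dbr_serre serre_E serre_F del: deformed_simps(4))
qed

lemma deformation_map:
  obtains f where "lie_bialg_hom (mplba A d \<R>') M f" "triangular_map A d \<R>' \<R> f"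
proof
  let ?L' = "mplba A d \<R>'"
  let ?f = "def.lift M (mp_gen_class A d \<R>)"
  have \<gamma>: "mp_gen_class A d \<R> x \<in> carrier M" for x by (simp add: toral_deformation_simps)
  show hom: "lie_bialg_hom ?L' M ?f"
    by (rule def.lie_bialg_hom_lift[OF lie_bialgebra_deformation \<gamma> leval_deformed_relation])
      (auto simp: tensor_deformation toral_deformation_simps pair2_gen)
  have f_gen: "?f (mp_gen_class A d \<R>' x) = mp_gen_class A d \<R> x" for x
    by (rule def.lift_gen[OF lie_algebra_deformation \<gamma> leval_deformed_relation])
  have h: "?f \<in> carrier ?L' \<rightarrow> carrier L"
    "\<And>x y. x \<in> carrier ?L' \<Longrightarrow> y \<in> carrier ?L' \<Longrightarrow> ?f (x \<oplus>\<^bsub>?L'\<^esub> y) = ?f x \<oplus> ?f y"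
    "\<And>a x. x \<in> carrier ?L' \<Longrightarrow> ?f (a \<odot>\<^bsub>?L'\<^esub> x) = a \<odot> ?f x"
    "\<And>x y. x \<in> carrier ?L' \<Longrightarrow> y \<in> carrier ?L' \<Longrightarrow> ?f (bracket ?L' x y) = dbr (?f x) (?f y)"
    using hom unfolding lie_bialg_hom_def toral_deformation_simps by blast+
  have f_zero: "?f \<zero>\<^bsub>?L'\<^esub> = \<zero>"
  proof -
    have "?f \<zero>\<^bsub>?L'\<^esub> \<in> carrier L" using h(1) def.zero_closed by (rule funcset_mem)
    then show ?thesis using h(3)[OF def.zero_closed, of 0]
      by (simp)
  qed
  have plus: "?f x \<in> nplus" if "x \<in> def.nplus" for x
    using that
  proof (induction rule: lie_generated.induct)
    case (gen x)
    then obtain i where "x = def.gE i" by blast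
    then show ?case using gE_nplus by (simp add: f_gen)
  qed (auto simp: f_zero h def.n_closed dbr_nplus intro: lie_generated.intros)
  have minus: "?f x \<in> nminus" if "x \<in> def.nminus" for x
    using that
  proof (induction rule: lie_generated.induct)
    case (gen x)
    then obtain i where "x = def.gF i" by blast
    then show ?case using gF_nminus by (simp add: f_gen)
  qed (auto simp: f_zero h def.n_closed dbr_nminus intro: lie_generated.intros)
  show "triangular_map A d \<R>' \<R> ?f"
    unfolding triangular_map_def Let_def n_plus_def n_minus_def L_def[symmetric]
    using plus minus by (simp add: h f_gen def.n_closed dbr_nplus dbr_nminus)
qed

lemma Alt_S_deformed: "(\<lambda>x y. - c x y) \<in> Alt_S \<R>'"
proof -
  interpret p: vector_space_pair "scl \<R>" "(*) :: 'k \<Rightarrow> 'k \<Rightarrow> 'k"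
    by (intro vector_space_pair.intro vector_space_scl vector_space_field)
  have "c (coroot_S \<R> i) x = 0" "c x (coroot_S \<R> i) = 0" for i x
    using c unfolding Alt_S_def by blast+
  moreover have "- c x y = - (- c y x)" for x y using c_antisym[of x y] by simp
  ultimately show ?thesis
    unfolding Alt_S_def using linear_c p.linear_compose_neg by simp
qed

lemma deformed_inverse: "deformed_realization \<R>' (\<lambda>x y. - c x y) = \<R>"
  by (simp add: deformed_realization_def)

theorem deformation_iso: "mplba A d \<R>' \<cong>\<^sub>b M"
proof -
  obtain f where f: "lie_bialg_hom (mplba A d \<R>') M f" "triangular_map A d \<R>' \<R> f"
    by (rule deformation_map)
  interpret inverse: mp_toral A d P' \<R>' "mplba A d \<R>'" "\<lambda>x y. - c x y"
    by unfold_locales (rule Alt_S_deformed)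
  \<comment> \<open>This g comes from a morphism into the deformation of
    \<open>mplba A d \<R>'\<close> by -c, which has the vector space of
    \<open>mplba A d \<R>'\<close> but another bracket; only the triangular data survive the change
    of target.\<close>
  obtain g where g: "triangular_map A d \<R> \<R>' g"
    using inverse.deformation_map unfolding deformed_inverse by blast
  show ?thesis
  proof (rule lie_bialg_isoI[OF def.lie_bialgebra_L lie_bialgebra_deformation f(1)])
    show "g (f x) = x" if "x \<in> carrier (mplba A d \<R>')" for x
      using f(2) g that by (rule def.triangular_map_inverse)
    show "f (g y) = y" if "y \<in> carrier M" for y
      using g f(2) that unfolding toral_deformation_simps by (rule triangular_map_inverse)
    show "g y \<in> carrier (mplba A d \<R>')" if "y \<in> carrier M" for y
      using g that unfolding triangular_map_def Let_def toral_deformation_simps L_def by blast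
  qed
qed

end

section \<open>Dependence on the realization\<close>

lemma realization_map:
  fixes \<R> :: "('k::field_char_0, 'n::finite, 'h::ab_group_add) realization_data"
    and \<R>1 :: "('k, 'n, 'g::ab_group_add) realization_data"
  assumes 1: "mp_realization A d P1 \<R>1" and 2: "mp_realization A d P \<R>"
    and lin: "\<And>s t. \<eta> (s + t) = \<eta> s + \<eta> t" "\<And>a t. \<eta> (scl \<R>1 a t) = scl \<R> a (\<eta> t)"
    and T: "\<And>i. \<eta> (Tp \<R>1 i) = Tp \<R> i" "\<And>i. \<eta> (Tm \<R>1 i) = Tm \<R> i"
    and rt: "\<And>j t. rt \<R> j (\<eta> t) = rt \<R>1 j t"
  obtains f where "lie_bialg_hom (mplba A d \<R>1) (mplba A d \<R>) f"
    "\<And>t. f (mp_gen_class A d \<R>1 (GT t)) = mp_gen_class A d \<R> (GT (\<eta> t))"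
    "\<And>i. f (mp_gen_class A d \<R>1 (GE i)) = mp_gen_class A d \<R> (GE i)"
    "\<And>i. f (mp_gen_class A d \<R>1 (GF i)) = mp_gen_class A d \<R> (GF i)"
proof
  interpret src: mp_bialg A d P1 \<R>1 "mplba A d \<R>1" by (rule mp_bialg.intro[OF 1])
  interpret tgt: mp_bialg A d P \<R> "mplba A d \<R>" by (rule mp_bialg.intro[OF 2])
  let ?L = "mplba A d \<R>"
  define \<gamma> where "\<gamma> x = mp_gen_class A d \<R> (case x of GT t \<Rightarrow> GT (\<eta> t) | GE i \<Rightarrow> GE i | GF i \<Rightarrow> GF i)" for x
  have \<gamma>_simps: "\<gamma> (GT t) = tgt.gT (\<eta> t)" "\<gamma> (GE i) = tgt.gE i" "\<gamma> (GF i) = tgt.gF i" for t i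
    by (simp_all add: \<gamma>_def)
  have \<gamma>: "\<gamma> x \<in> carrier ?L" for x unfolding \<gamma>_def by (rule tgt.gen_closed)
  have rel: "leval ?L \<gamma> s = leval ?L \<gamma> t" if "(s, t) \<in> mp_relations A d \<R>1" for s t
    using that[unfolded mp_relations_def]
    by (elim UnE CollectE exE conjE)
      (simp_all add: \<gamma>_simps lin T rt tgt.gT_add tgt.gT_scl tgt.bracket_TT tgt.bracket_TE tgt.bracket_TF
        tgt.bracket_EF tgt.bracket_EF' leval_funpow tgt.serre_E tgt.serre_F)
  show "lie_bialg_hom (mplba A d \<R>1) ?L (src.lift ?L \<gamma>)"
    by (rule src.lie_bialg_hom_lift[OF tgt.lie_bialgebra_L \<gamma> rel])
      (simp_all add: \<gamma>_simps tgt.pair2_gen T)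
  have "src.lift ?L \<gamma> (mp_gen_class A d \<R>1 x) = \<gamma> x" for x
    by (rule src.lift_gen[OF tgt.lie_algebra_axioms \<gamma> rel])
  then show "src.lift ?L \<gamma> (src.gT t) = tgt.gT (\<eta> t)" "src.lift ?L \<gamma> (src.gE i) = tgt.gE i"
    "src.lift ?L \<gamma> (src.gF i) = tgt.gF i" for t i
    by (simp_all only: \<gamma>_simps)
qed

lemma (in mp_bialg) lie_bialg_endo_id:
  assumes f: "lie_bialg_hom L N f" and g: "lie_bialg_hom N L g"
    and gen: "\<And>x. g (f (mp_gen_class A d \<R> x)) = mp_gen_class A d \<R> x" and x: "x \<in> carrier L"
  shows "g (f x) = x"
proof -
  have f': "f \<in> carrier L \<rightarrow> carrier N"
    "\<And>x y. x \<in> carrier L \<Longrightarrow> y \<in> carrier L \<Longrightarrow> f (x \<oplus> y) = f x \<oplus>\<^bsub>N\<^esub> f y"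
    "\<And>a x. x \<in> carrier L \<Longrightarrow> f (a \<odot> x) = a \<odot>\<^bsub>N\<^esub> f x"
    "\<And>x y. x \<in> carrier L \<Longrightarrow> y \<in> carrier L \<Longrightarrow> f (bracket L x y) = bracket N (f x) (f y)"
    using f unfolding lie_bialg_hom_def by blast+
  have g': "g \<in> carrier N \<rightarrow> carrier L"
    "\<And>x y. x \<in> carrier N \<Longrightarrow> y \<in> carrier N \<Longrightarrow> g (x \<oplus>\<^bsub>N\<^esub> y) = g x \<oplus> g y"
    "\<And>a x. x \<in> carrier N \<Longrightarrow> g (a \<odot>\<^bsub>N\<^esub> x) = a \<odot> g x"
    "\<And>x y. x \<in> carrier N \<Longrightarrow> y \<in> carrier N \<Longrightarrow> g (bracket N x y) = bracket L (g x) (g y)"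
    using g unfolding lie_bialg_hom_def by blast+
  have c: "f x \<in> carrier N" if "x \<in> carrier L" for x using f'(1) that by auto
  have gf_zero: "g (f \<zero>) = \<zero>"
  proof -
    have "g (f \<zero>) \<in> carrier L" using g'(1) c[OF zero_closed] by (rule funcset_mem)
    moreover have "g (f (0 \<odot> \<zero>)) = 0 \<odot> g (f \<zero>)"
      by (simp only: f'(3)[OF zero_closed] g'(3)[OF c[OF zero_closed]])
    ultimately show ?thesis by simp
  qed
  show ?thesis
    using x by (induction rule: carrier_induct) (simp_all add: gen gf_zero f' g' c)
qed

lemma realization_iso:
  fixes \<R> :: "('k::field_char_0, 'n::finite, 'h::ab_group_add) realization_data"
    and \<R>1 :: "('k, 'n, 'g::ab_group_add) realization_data"
  assumes 1: "mp_realization A d P1 \<R>1" and 2: "mp_realization A d P \<R>"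
    and lin: "\<And>s t. \<eta> (s + t) = \<eta> s + \<eta> t" "\<And>a t. \<eta> (scl \<R>1 a t) = scl \<R> a (\<eta> t)"
    and inv: "\<And>t. \<theta> (\<eta> t) = t" "\<And>t. \<eta> (\<theta> t) = t"
    and T: "\<And>i. \<eta> (Tp \<R>1 i) = Tp \<R> i" "\<And>i. \<eta> (Tm \<R>1 i) = Tm \<R> i"
    and rt: "\<And>j t. rt \<R> j (\<eta> t) = rt \<R>1 j t"
  shows "mplba A d \<R>1 \<cong>\<^sub>b mplba A d \<R>"
proof -
  interpret src: mp_bialg A d P1 \<R>1 "mplba A d \<R>1" by (rule mp_bialg.intro[OF 1])
  interpret tgt: mp_bialg A d P \<R> "mplba A d \<R>" by (rule mp_bialg.intro[OF 2])
  obtain f where f: "lie_bialg_hom (mplba A d \<R>1) (mplba A d \<R>) f"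
    "\<And>t. f (src.gT t) = tgt.gT (\<eta> t)" "\<And>i. f (src.gE i) = tgt.gE i" "\<And>i. f (src.gF i) = tgt.gF i"
    using realization_map[OF 1 2 lin T rt] by blast
  have lin': "\<theta> (s + t) = \<theta> s + \<theta> t" "\<theta> (scl \<R> a t) = scl \<R>1 a (\<theta> t)" for s t a
    using lin inv by metis+
  have T': "\<theta> (Tp \<R> i) = Tp \<R>1 i" "\<theta> (Tm \<R> i) = Tm \<R>1 i" for i
    using T inv by metis+
  have rt': "rt \<R>1 j (\<theta> t) = rt \<R> j t" for j t using rt inv by metis
  obtain g where g: "lie_bialg_hom (mplba A d \<R>) (mplba A d \<R>1) g"
    "\<And>t. g (tgt.gT t) = src.gT (\<theta> t)" "\<And>i. g (tgt.gE i) = src.gE i" "\<And>i. g (tgt.gF i) = src.gF i"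
    using realization_map[OF 2 1 lin' T' rt'] by blast
  have gf: "g (f (mp_gen_class A d \<R>1 x)) = mp_gen_class A d \<R>1 x" for x
    by (cases x) (simp_all add: f g inv)
  have fg: "f (g (mp_gen_class A d \<R> x)) = mp_gen_class A d \<R> x" for x
    by (cases x) (simp_all add: f g inv)
  show ?thesis
  proof (rule lie_bialg_isoI[OF src.lie_bialgebra_L tgt.lie_bialgebra_L f(1)])
    show "g y \<in> carrier (mplba A d \<R>1)" if "y \<in> carrier (mplba A d \<R>)" for y
      using g(1) that unfolding lie_bialg_hom_def by blast
    show "g (f x) = x" if "x \<in> carrier (mplba A d \<R>1)" for x
      using that by (rule src.lie_bialg_endo_id[OF f(1) g(1) gf])
    show "f (g y) = y" if "y \<in> carrier (mplba A d \<R>)" for y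
      using that by (rule tgt.lie_bialg_endo_id[OF g(1) f(1) fg])
  qed
qed

section \<open>Linear algebra of split realizations\<close>

lemma lin_indep_family_extend:
  assumes V: "vector_space s" and W: "vector_space s'" and v: "lin_indep_family s v"
  obtains f where "Vector_Spaces.linear s s' f" "\<And>i. f (v i) = w i"
proof -
  interpret p: vector_space_pair s s' by (intro vector_space_pair.intro V W)
  have "inj v" "\<not> module.dependent s (range v)" using v by (auto simp: lin_indep_family_def)
  with p.linear_independent_extend[of "range v" "\<lambda>x. w (inv_into UNIV v x)"]
  obtain f where "Vector_Spaces.linear s s' f" "\<forall>x\<in>range v. f x = w (inv_into UNIV v x)" by blast
  then show thesis using \<open>inj v\<close> by (intro that[of f]) auto
qed

text \<open>The functionals form a dual family: a vector in the span of the others would be killed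
  by its own dual functional.\<close>

lemma lin_indep_familyI:
  assumes V: "vector_space s" and l: "\<And>i. Vector_Spaces.linear s (*) (\<tau> i)"
    and \<tau>: "\<And>i j. \<tau> i (v j) = (if i = j then 1 else 0)"
  shows "lin_indep_family s v"
proof -
  interpret vector_space s by (rule V)
  have "inj v"
    by (rule injI) (metis \<tau> zero_neq_one)
  moreover have "\<not> dependent (range v)"
  proof
    assume "dependent (range v)"
    then obtain j where "v j \<in> span (range v - {v j})" unfolding dependent_def by blast
    then have "\<tau> j (v j) = 0"
      unfolding in_span_iff_functionals using l \<tau> by (metis (no_types, lifting) Diff_iff imageE singletonI)
    then show False using \<tau> by simp
  qed
  ultimately show ?thesis by (simp add: lin_indep_family_def)
qed

lemma linear_intro:
  assumes "vector_space s" "vector_space s'" "\<And>x y. f (x + y) = f x + f y" "\<And>a x. f (s a x) = s' a (f x)"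
  shows "Vector_Spaces.linear s s' f"
proof -
  interpret vector_space_pair s s' by (intro vector_space_pair.intro assms)
  show ?thesis by unfold_locales (fact assms)+
qed

lemma linear_unique_on_span:
  assumes "Vector_Spaces.linear s s' f" "Vector_Spaces.linear s s' g" "module.span s B = UNIV"
    "\<And>x. x \<in> B \<Longrightarrow> f x = g x"
  shows "f = g"
proof -
  interpret f: Vector_Spaces.linear s s' f by fact
  interpret p: vector_space_pair s s' ..
  show ?thesis using p.linear_eq_on_span[OF assms(1,2,4)] assms(3) by auto
qed

lemma (in mp_realization) mp_toralI: "c \<in> Alt_S \<R> \<Longrightarrow> mp_toral A d P \<R> c"
  by (intro mp_toral.intro mp_bialg.intro mp_realization_axioms mp_toral_axioms.intro)

text \<open>P' - P is antisymmetric because both matrices have the same symmetric part. Given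
  functionals \<tau>_i that are dual to the T_i^+ and vanish on all S_j, the form with coefficients
  P' - P in the \<tau>_i \<otimes> \<tau>_j has the required values.\<close>

lemma (in mp_realization) split_deforms:
  assumes split: "split_realization \<R>" and P': "cartan_type A d P'"
  obtains c where "c \<in> Alt_S \<R>" "P' = deformed_matrix P \<R> c"
proof -
  define m where "m i j = P' $ i $ j - P $ i $ j" for i j
  have m: "m i j = - m j i" for i j
  proof -
    have "(P + transpose P) $ i $ j = (P' + transpose P') $ i $ j"
      using type_P P' by (simp add: cartan_type_def)
    then show ?thesis by (simp add: transpose_def m_def algebra_simps)
  qed
  \<comment> \<open>The value -1 at T_i^- makes the functional vanish on S_i; splitness is what
    allows values on the T_j^+ and T_j^- to be prescribed independently.\<close>
  have "\<exists>f. Vector_Spaces.linear (scl \<R>) (*) f \<and>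
      (\<forall>j. f (Tp \<R> j) = (if i = j then 1 else 0) \<and> f (Tm \<R> j) = (if i = j then - 1 else 0))" for i
  proof -
    obtain f where "Vector_Spaces.linear (scl \<R>) (*) f"
      "\<And>k. f (case_sum (Tp \<R>) (Tm \<R>) k) =
        case_sum (\<lambda>j. if i = j then 1 else 0) (\<lambda>j. if i = j then - 1 else (0::'k)) k"
      using lin_indep_family_extend[OF vector_space_scl vector_space_field split[unfolded split_realization_def]] by blast
    from this(1) this(2)[of "Inl _"] this(2)[of "Inr _"] show ?thesis by auto
  qed
  then obtain \<tau> where \<tau>: "\<And>i. Vector_Spaces.linear (scl \<R>) (*) (\<tau> i)"
    "\<And>i j. \<tau> i (Tp \<R> j) = (if i = j then 1 else 0)" "\<And>i j. \<tau> i (Tm \<R> j) = (if i = j then - 1 else 0)"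
    by metis
  have \<tau>_lin: "\<tau> i (x + y) = \<tau> i x + \<tau> i y" "\<tau> i (scl \<R> a x) = a * \<tau> i x" for i x y a
  proof -
    interpret Vector_Spaces.linear "scl \<R>" "(*)" "\<tau> i" by (rule \<tau>(1))
    show "\<tau> i (x + y) = \<tau> i x + \<tau> i y" "\<tau> i (scl \<R> a x) = a * \<tau> i x" by (rule add, rule scale)
  qed
  have \<tau>S: "\<tau> i (coroot_S \<R> j) = 0" for i j by (simp add: coroot_S_def \<tau> \<tau>_lin)
  define c where "c x y = (\<Sum>i\<in>UNIV. \<Sum>j\<in>UNIV. m i j * \<tau> i x * \<tau> j y)" for x y
  have lin: "Vector_Spaces.linear (scl \<R>) (*) (c x)" "Vector_Spaces.linear (scl \<R>) (*) (\<lambda>x. c x y)" for x y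
    unfolding c_def
    by (rule linear_intro[OF vector_space_scl vector_space_field];
        simp add: \<tau>_lin sum.distrib sum_distrib_left distrib_left distrib_right mult.assoc mult.left_commute)+
  have "c x y = - c y x" for x y
  proof -
    have "c x y = (\<Sum>i\<in>UNIV. \<Sum>j\<in>UNIV. m j i * \<tau> j x * \<tau> i y)"
      unfolding c_def by (rule sum.swap)
    also have "\<dots> = (\<Sum>i\<in>UNIV. \<Sum>j\<in>UNIV. - (m i j * \<tau> i y * \<tau> j x))"
    proof (rule sum.cong[OF HOL.refl], rule sum.cong[OF HOL.refl])
      show "m j i * \<tau> j x * \<tau> i y = - (m i j * \<tau> i y * \<tau> j x)" for i j
        using m[of j i] by simp
    qed
    finally show ?thesis by (simp add: c_def sum_negf)
  qed
  moreover have c_S: "c (coroot_S \<R> i) x = 0" "c x (coroot_S \<R> i) = 0" for i x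
    by (simp_all add: c_def \<tau>S)
  ultimately have "c \<in> Alt_S \<R>" unfolding Alt_S_def using lin by blast
  moreover have "P' = deformed_matrix P \<R> c"
  proof -
    have "c (Tp \<R> a) (Tp \<R> b) = m a b" for a b
      by (simp add: c_def \<tau> if_distrib[of "(*) _"] if_distrib[of "\<lambda>x. x * _"] cong: if_cong)
    then show ?thesis by (simp add: deformed_matrix_def vec_eq_iff m_def)
  qed
  ultimately show thesis by (rule that)
qed

text \<open>Split and minimal together say that the coroots form a basis of \<hh>. Matching the two
  bases is a linear isomorphism, and it respects the roots because their values on the basis are
  entries of P.\<close>

lemma split_minimal_iso:
  fixes \<R> :: "('k::field_char_0, 'n::finite, 'h::ab_group_add) realization_data"
    and \<R>1 :: "('k, 'n, 'g::ab_group_add) realization_data"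
  assumes 1: "mp_realization A d P \<R>1" and 2: "mp_realization A d P \<R>"
    and s: "split_realization \<R>1" "split_realization \<R>"
    and m: "minimal_realization \<R>1" "minimal_realization \<R>"
  shows "mplba A d \<R>1 \<cong>\<^sub>b mplba A d \<R>"
proof -
  interpret src: mp_realization A d P \<R>1 by (rule 1)
  interpret tgt: mp_realization A d P \<R> by (rule 2)
  let ?v1 = "case_sum (Tp \<R>1) (Tm \<R>1)" and ?v = "case_sum (Tp \<R>) (Tm \<R>)"
  obtain \<eta> where \<eta>: "Vector_Spaces.linear (scl \<R>1) (scl \<R>) \<eta>" "\<And>k. \<eta> (?v1 k) = ?v k"
    using lin_indep_family_extend[OF src.vector_space_scl tgt.vector_space_scl s(1)[unfolded split_realization_def]] by blast
  obtain \<theta> where \<theta>: "Vector_Spaces.linear (scl \<R>) (scl \<R>1) \<theta>" "\<And>k. \<theta> (?v k) = ?v1 k"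
    using lin_indep_family_extend[OF tgt.vector_space_scl src.vector_space_scl s(2)[unfolded split_realization_def]] by blast
  have \<eta>T: "\<eta> (Tp \<R>1 i) = Tp \<R> i" "\<eta> (Tm \<R>1 i) = Tm \<R> i" for i
    using \<eta>(2)[of "Inl i"] \<eta>(2)[of "Inr i"] by simp_all
  have \<theta>T: "\<theta> (Tp \<R> i) = Tp \<R>1 i" "\<theta> (Tm \<R> i) = Tm \<R>1 i" for i
    using \<theta>(2)[of "Inl i"] \<theta>(2)[of "Inr i"] by simp_all
  interpret \<eta>: Vector_Spaces.linear "scl \<R>1" "scl \<R>" \<eta> by (rule \<eta>(1))
  have id1: "\<theta> \<circ> \<eta> = id"
    by (rule linear_unique_on_span[OF Vector_Spaces.linear_compose[OF \<eta>(1) \<theta>(1)] \<eta>.vs1.linear_id m(1)[unfolded minimal_realization_def]])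
      (auto simp: \<eta>T \<theta>T)
  have id2: "\<eta> \<circ> \<theta> = id"
    by (rule linear_unique_on_span[OF Vector_Spaces.linear_compose[OF \<theta>(1) \<eta>(1)] \<eta>.vs2.linear_id m(2)[unfolded minimal_realization_def]])
      (auto simp: \<eta>T \<theta>T)
  have rt: "rt \<R> j \<circ> \<eta> = rt \<R>1 j" for j
    by (rule linear_unique_on_span[OF Vector_Spaces.linear_compose[OF \<eta>(1) tgt.linear_alpha] src.linear_alpha m(1)[unfolded minimal_realization_def]])
      (auto simp: \<eta>T)
  show ?thesis
    by (rule realization_iso[OF 1 2 \<eta>.add \<eta>.scale, of \<theta>])
      (use id1 id2 rt in \<open>auto simp: \<eta>T fun_eq_iff\<close>)
qed

lemma cartan_type_DA: "symmetrizer A d \<Longrightarrow> cartan_type A d (DA A d :: 'k::field_char_0^'n^'n)"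
proof -
  assume s: "symmetrizer A d"
  have "of_nat (d $ j) * of_int (A $ j $ i) = (of_nat (d $ i) * of_int (A $ i $ j) :: 'k)" for i j
  proof -
    have "int (d $ i) * A $ i $ j = int (d $ j) * A $ j $ i" using s by (simp add: symmetrizer_def)
    then have "(of_int (int (d $ i) * A $ i $ j) :: 'k) = of_int (int (d $ j) * A $ j $ i)" by (rule arg_cong)
    then show ?thesis by simp
  qed
  then show ?thesis by (simp add: cartan_type_def vec_eq_iff transpose_def DA_def)
qed

section \<open>The realization of the Manin double\<close>

lemma vector_space_vec: "vector_space ((*s) :: 'k::field \<Rightarrow> 'k^'n \<Rightarrow> 'k^'n)"
  by unfold_locales (auto simp: vec_eq_iff algebra_simps)

lemma span_axis: "module.span (*s) (range (\<lambda>i. axis i (1::'k::field))) = (UNIV :: ('k^'n::finite) set)"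
proof -
  interpret vector_space "(*s) :: 'k \<Rightarrow> 'k^'n \<Rightarrow> 'k^'n" by (rule vector_space_vec)
  have "x \<in> span (range (\<lambda>i. axis i (1::'k)))" for x :: "'k^'n"
    by (subst basis_expansion[symmetric]) (intro span_sum span_scale span_base rangeI)
  then show ?thesis by blast
qed

lemma linear_vec_sum:
  "Vector_Spaces.linear (*s) (*) (\<lambda>x :: 'k::field^'n::finite. \<Sum>i\<in>I. x $ \<sigma> i * a i + x $ \<rho> i * b i)"
  by (rule linear_intro[OF vector_space_vec vector_space_field])
    (simp_all add: sum.distrib sum_distrib_left distrib_left distrib_right mult.assoc)

lemma double_realization:
  fixes A :: "int^'n^'n"
  assumes "symmetrizer A d"
  defines "\<D> \<equiv> double_realization A d :: ('k::field_char_0, 'n, 'k^('n + 'n)) realization_data"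
  shows "realization (DA A d) \<D>" "split_realization \<D>" "minimal_realization \<D>"
proof -
  have D [simp]: "scl \<D> = (*s)" "Tp \<D> i = axis (Inl i) 1" "Tm \<D> i = axis (Inr i) 1"
    "rt \<D> j = (\<lambda>t. \<Sum>i\<in>UNIV. t $ Inl i * DA A d $ i $ j + t $ Inr i * DA A d $ j $ i)" for i j
    by (simp_all add: \<D>_def double_realization_def)
  have TpTm: "case_sum (Tp \<D>) (Tm \<D>) = (\<lambda>k. axis k 1)"
    by (auto simp: fun_eq_iff split: sum.split)
  have coord: "Vector_Spaces.linear (*s) (*) (\<lambda>x :: 'k^('n+'n). a * x $ k)" for k a
    by (rule linear_intro[OF vector_space_vec vector_space_field]) (simp_all add: algebra_simps)
  show split: "split_realization \<D>"
    unfolding split_realization_def TpTm D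
    using coord[of 1] by (intro lin_indep_familyI[OF vector_space_vec, of "\<lambda>k x. 1 * x $ k"]) (auto simp: axis_def)
  \<comment> \<open>Twice the coordinate \<open>Inl i\<close> is dual to S_i, since S_i is half the
    sum of two basis vectors.\<close>
  have S: "lin_indep_family (*s) (coroot_S \<D>)"
    using coord[of 2] by (intro lin_indep_familyI[OF vector_space_vec, of "\<lambda>i x. 2 * x $ Inl i"])
      (auto simp: coroot_S_def axis_def)
  have rT: "rt \<D> j (Tp \<D> i) = DA A d $ i $ j" "rt \<D> j (Tm \<D> i) = DA A d $ j $ i" for i j
    by (simp_all add: axis_def if_distrib[of "\<lambda>x. x * _"] cong: if_cong)
  have lin: "Vector_Spaces.linear (*s) (*) (rt \<D> j)" for j
    unfolding D by (rule linear_vec_sum)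
  have fin: "\<exists>B. finite B \<and> module.span (*s) B = (UNIV :: ('k^('n+'n)) set)"
    using span_axis by (intro exI[of _ "range (\<lambda>i. axis i 1)"]) auto
  show "realization (DA A d) \<D>"
    unfolding realization_def using vector_space_vec S fin lin rT by (simp del: D(2-4))
  have "range (Tp \<D>) \<union> range (Tm \<D>) = range (case_sum (Tp \<D>) (Tm \<D>))"
    by (simp only: UNIV_sum image_Un image_image sum.case)
  then show "minimal_realization \<D>"
    unfolding minimal_realization_def TpTm D using span_axis by simp
qed

lemma deformed_realization_preserves:
  "split_realization (deformed_realization \<R> c) = split_realization \<R>"
  "minimal_realization (deformed_realization \<R> c) = minimal_realization \<R>"
  "realization_rank (deformed_realization \<R> c) = realization_rank \<R>"
  by (simp_all add: deformed_realization_def split_realization_def minimal_realization_def realization_rank_def)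

text \<open>Once P1 is written as P_(c), the given realization and the deformed one are both split
  minimal realizations of P1, so \<open>split_minimal_iso\<close> and \<open>deformation_iso\<close>
  compose. The second realization may live on another type, as the Manin double requires.\<close>

lemma (in mp_realization) split_minimal_deforms:
  fixes \<R>1 :: "('k, 'n, 'g::ab_group_add) realization_data"
  assumes "split_realization \<R>" "minimal_realization \<R>" and P1: "cartan_type A d P1"
    and \<R>1: "realization P1 \<R>1" "split_realization \<R>1" "minimal_realization \<R>1"
  shows "\<exists>c\<in>Alt_S \<R>. mplba A d \<R>1 \<cong>\<^sub>b toral_deformation A d \<R> c"
proof -
  obtain c where hc: "c \<in> Alt_S \<R>" "P1 = deformed_matrix P \<R> c"
    using split_deforms[OF assms(1) P1] .
  interpret mp_toral A d P \<R> "mplba A d \<R>" c by (rule mp_toralI[OF hc(1)])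
  have "mplba A d \<R>1 \<cong>\<^sub>b mplba A d \<R>'"
  proof (rule split_minimal_iso)
    show "mp_realization A d P1 \<R>1" "mp_realization A d P1 \<R>'"
      using \<R>1(1) P1 realization_deformed
      by (auto intro!: mp_realization.intro cartan symmetrizer simp: hc(2))
  qed (simp_all add: assms deformed_realization_preserves)
  then have "mplba A d \<R>1 \<cong>\<^sub>b M"
    using deformation_iso by (rule lie_bialg_iso_trans)
  then show ?thesis using hc(1) by blast
qed

theorem theorem3p4p3:
  fixes A :: "int^'n^'n" and d :: "nat^'n"
  assumes "gen_cartan_matrix A" and "symmetrizer A d"
  shows
    "(\<forall>(P :: 'k::field_char_0^'n^'n) (\<R> :: ('k, 'n, 'h::ab_group_add) realization_data). \<forall>c\<in>Alt_S \<R>.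
        cartan_type A d P \<and> realization P \<R> \<longrightarrow>
          cartan_type A d (deformed_matrix P \<R> c) \<and>
          realization (deformed_matrix P \<R> c) (deformed_realization \<R> c) \<and>
          mplba A d (deformed_realization \<R> c) \<cong>\<^sub>b toral_deformation A d \<R> c)
     \<and> (\<forall>r. toral_stable A d
          (cartan_realizations A d r :: ('k, 'n, 'h) realization_data set))
     \<and> (\<forall>r. toral_stable A d
          {\<R> \<in> cartan_realizations A d r :: ('k, 'n, 'h) realization_data set. split_realization \<R>})
     \<and> (\<forall>r. toral_stable A d
          {\<R> \<in> cartan_realizations A d r :: ('k, 'n, 'h) realization_data set. minimal_realization \<R>})

     \<and> (\<forall>(P :: 'k^'n^'n) (P' :: 'k^'n^'n) (\<R> :: ('k, 'n, 'h) realization_data).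
        cartan_type A d P \<and> cartan_type A d P' \<and> realization P \<R> \<and> split_realization \<R> \<longrightarrow>
          (\<exists>c\<in>Alt_S \<R>.
             P' = deformed_matrix P \<R> c \<and>
             realization P' (deformed_realization \<R> c) \<and>
             split_realization (deformed_realization \<R> c) \<and>
             mplba A d (deformed_realization \<R> c) \<cong>\<^sub>b toral_deformation A d \<R> c))

     \<and> (\<forall>(P :: 'k^'n^'n) (P' :: 'k^'n^'n)
          (\<R> :: ('k, 'n, 'h) realization_data) (\<R>' :: ('k, 'n, 'g::ab_group_add) realization_data).
        cartan_type A d P \<and> cartan_type A d P' \<and>
        realization P \<R> \<and> split_realization \<R> \<and> minimal_realization \<R> \<and>
        realization P' \<R>' \<and> split_realization \<R>' \<and> minimal_realization \<R>' \<longrightarrow>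
          (\<exists>c\<in>Alt_S \<R>. mplba A d \<R>' \<cong>\<^sub>b toral_deformation A d \<R> c))

     \<and> (let \<D> = double_realization A d :: ('k, 'n, 'k^('n + 'n)) realization_data in
        realization (DA A d) \<D> \<and> split_realization \<D> \<and> minimal_realization \<D> \<and>
        (\<forall>(P' :: 'k^'n^'n) (\<R>' :: ('k, 'n, 'g) realization_data).
          cartan_type A d P' \<and> realization P' \<R>' \<and> split_realization \<R>' \<and> minimal_realization \<R>' \<longrightarrow>
            (\<exists>c\<in>Alt_S \<D>. mplba A d \<R>' \<cong>\<^sub>b toral_deformation A d \<D> c)))"
proof -
  \<comment> \<open>The type of the vector space is kept general, since this is applied to the given
    realizations and to that of the Manin double.\<close>
  have mp: "mp_realization A d P \<R>" if "cartan_type A d P" "realization P \<R>"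
    for P :: "'k^'n^'n" and \<R> :: "('k, 'n, 'v::ab_group_add) realization_data"
    using that assms by (intro mp_realization.intro)
  have a: "cartan_type A d (deformed_matrix P \<R> c) \<and>
      realization (deformed_matrix P \<R> c) (deformed_realization \<R> c) \<and>
      mplba A d (deformed_realization \<R> c) \<cong>\<^sub>b toral_deformation A d \<R> c"
    if P: "cartan_type A d P" "realization P \<R>" and c: "c \<in> Alt_S \<R>"
    for P :: "'k^'n^'n" and \<R> :: "('k, 'n, 'h) realization_data" and c
  proof -
    interpret mp_toral A d P \<R> "mplba A d \<R>" c
      by (rule mp_realization.mp_toralI[OF mp[OF P] c])
    show ?thesis using cartan_type_deformed realization_deformed deformation_iso by blast
  qed
  \<comment> \<open>The three classes differ by a predicate that is insensitive to deformation,
    because deformation changes the roots and keeps \<hh> and the coroots.\<close>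
  have stable: "toral_stable A d {\<R> \<in> cartan_realizations A d r :: ('k, 'n, 'h) realization_data set. Q \<R>}"
    if Q: "\<And>\<R> c. Q (deformed_realization \<R> c) = Q \<R>" for Q r
    unfolding toral_stable_def
  proof (intro ballI)
    fix \<R> :: "('k, 'n, 'h) realization_data" and c
    assume R: "\<R> \<in> {\<R> \<in> cartan_realizations A d r. Q \<R>}" and c: "c \<in> Alt_S \<R>"
    then obtain P :: "'k^'n^'n" where P: "cartan_type A d P" "realization P \<R>"
      by (auto simp: cartan_realizations_def)
    have "deformed_realization \<R> c \<in> {\<R> \<in> cartan_realizations A d r. Q \<R>}"
      using R a[OF P c] by (auto simp: cartan_realizations_def deformed_realization_preserves Q)
    then show "\<exists>\<R>'\<in>{\<R> \<in> cartan_realizations A d r. Q \<R>}. mplba A d \<R>' \<cong>\<^sub>b toral_deformation A d \<R> c"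
      using a[OF P c] by blast
  qed
  have b1: "\<exists>c\<in>Alt_S \<R>. P' = deformed_matrix P \<R> c \<and> realization P' (deformed_realization \<R> c) \<and>
      split_realization (deformed_realization \<R> c) \<and>
      mplba A d (deformed_realization \<R> c) \<cong>\<^sub>b toral_deformation A d \<R> c"
    if P: "cartan_type A d P" "realization P \<R>" and P': "cartan_type A d P'" and s: "split_realization \<R>"
    for P P' :: "'k^'n^'n" and \<R> :: "('k, 'n, 'h) realization_data"
  proof -
    obtain c where c: "c \<in> Alt_S \<R>" "P' = deformed_matrix P \<R> c"
      using mp_realization.split_deforms[OF mp[OF P] s P'] .
    then show ?thesis using a[OF P c(1)] s by (auto simp: deformed_realization_preserves)
  qed
  note D = double_realization[OF assms(2)] and DA = cartan_type_DA[OF assms(2)]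
  show ?thesis
    unfolding Let_def
  proof (intro conjI allI impI ballI)
    fix r
    show "toral_stable A d (cartan_realizations A d r :: ('k, 'n, 'h) realization_data set)"
      using stable[of "\<lambda>_. True" r] by simp
    show "toral_stable A d {\<R> \<in> cartan_realizations A d r :: ('k, 'n, 'h) realization_data set. split_realization \<R>}"
      "toral_stable A d {\<R> \<in> cartan_realizations A d r :: ('k, 'n, 'h) realization_data set. minimal_realization \<R>}"
      by (rule stable, simp add: deformed_realization_preserves)+
  next
    fix P P' :: "'k^'n^'n" and \<R> :: "('k, 'n, 'h) realization_data" and \<R>' :: "('k, 'n, 'g) realization_data"
    assume "cartan_type A d P \<and> cartan_type A d P' \<and> realization P \<R> \<and> split_realization \<R> \<and>
      minimal_realization \<R> \<and> realization P' \<R>' \<and> split_realization \<R>' \<and> minimal_realization \<R>'"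
    then show "\<exists>c\<in>Alt_S \<R>. mplba A d \<R>' \<cong>\<^sub>b toral_deformation A d \<R> c"
      by (intro mp_realization.split_minimal_deforms[OF mp, of P \<R> P' \<R>']) simp_all
  next
    fix P' :: "'k^'n^'n" and \<R>' :: "('k, 'n, 'g) realization_data"
    assume "cartan_type A d P' \<and> realization P' \<R>' \<and> split_realization \<R>' \<and> minimal_realization \<R>'"
    then show "\<exists>c\<in>Alt_S (double_realization A d). mplba A d \<R>' \<cong>\<^sub>b toral_deformation A d (double_realization A d) c"
      by (intro mp_realization.split_minimal_deforms[OF mp[OF DA D(1)] D(2,3), of P' \<R>']) simp_all
  qed (use a b1 D in blast)+
qed

end
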